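(* Let $g\ge 1$ and $m\ge 1$ be integers. Let $A_g[m]^{\mathrm{trop}}$ be the tropical moduli space of abelian varieties with level structure $m$, let $S_{g,m}$ be the set of isomorphism classes of principally polarized tropical abelian varieties of dimension $g$ with level $m$ structure, let $\pi\colon \bigsqcup_W \mathrm{PD}(W^\vee)\to A_g[m]^{\mathrm{trop}}$ be the natural surjection, where $W$ ranges over all isotropic subspaces of $\mathbb{Z}^{2g}$, and let $\Phi\colon \bigsqcup_W \mathrm{PD}(W^\vee)\to S_{g,m}$ be the map $T\mapsto[\mathbb{Z}^{2g},J,\mathrm{id},Q_T]$ (all defined in the context). Then there is a bijection of sets $\Psi\colon A_g[m]^{\mathrm{trop}}\to S_{g,m}$ such that $\Psi\circ\pi=\Phi$.
   Context: Symplectic form and isotropic subspaces. For a commutative ring $R$, the free module $R^{2g}$ with basis $e_1,\dots,e_g,f_1,\dots,f_g$ carries the standard symplectic form $J$ with $J(e_i,e_j)=J(f_i,f_j)=0$, $J(e_i,f_j)=\delta_{ij}$. A free $R$-submodule of a free module with symplectic form is called an isotropic subspace if it is totally isotropic and is a direct summand with free complement (the zero submodule is included). Put $\Gamma[m]=\ker(\mathrm{Sp}_{2g}(\mathbb{Z})\to \mathrm{Sp}_{2g}(\mathbb{Z}/m\mathbb{Z}))$. Cones. For an isotropic subspace $W\subset\mathbb{Z}^{2g}$ let $W_{\mathbb{R}}=W\otimes\mathbb{R}$; identify $\mathrm{Sym}^2(W_{\mathbb{R}})$ with the space of symmetric bilinear forms on $W_{\mathbb{R}}^\vee$. $\mathrm{PD}(W^\vee)\subset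 \mathrm{Sym}^2(W_{\mathbb{R}})$ is the cone of positive definite forms on $W_{\mathbb{R}}^\vee$ (a single point if $W=0$), and $\mathrm{PD}(W^\vee)^{\mathrm{rt}}$ is the set of positive semi-definite forms on $W_{\mathbb{R}}^\vee$ whose kernel is spanned by vectors of $W^\vee$. The space $A_g[m]^{\mathrm{trop}}$. Whenever $\gamma\in\Gamma[m]$ and $\gamma W\subseteq W'$ for isotropic subspaces $W,W'$ of $\mathbb{Z}^{2g}$, $\gamma$ induces an injection $\mathrm{Sym}^2(W_{\mathbb{R}})\to \mathrm{Sym}^2(W'_{\mathbb{R}})$ taking $\mathrm{PD}(W^\vee)^{\mathrm{rt}}$ into $\mathrm{PD}((W')^\vee)^{\mathrm{rt}}$. As a set, $A_g[m]^{\mathrm{trop}}$ is the colimit of the sets $\mathrm{PD}(W^\vee)^{\mathrm{rt}}$ along all these maps, i.e. the quotient of $\bigsqcup_W \mathrm{PD}(W^\vee)^{\mathrm{rt}}$ by the equivalence relation generated by identifying each point with its images under these maps (only the underlying set matters here). The map $\pi$ is the restriction of the quotient map to $\bigsqcup_W\mathrm{PD}(W^\vee)$. Tropical abelian varieties. A principally polarized tropical abelian variety (pptav) of dimension $g$ with level $m$ structure is a quadruple $(\Lambda,S,i,Q)$ where: (1) $\Lambda$ is a free abelian group of rank $2g$; (2) $S\colon\Lambda\times\Lambda\to\mathbb{Z}$ is a symplectic (alternating, non-degenerate, bilinear) form of determinant $1$; (3) $i\colon\Lambda/m\Lambda\to(\mathbb{Z}/m\mathbb{Z})^{2g}$ is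 an isomorphism taking the form induced by $S$ to the standard symplectic form; (4) $Q\colon\Lambda_{\mathbb{R}}\times\Lambda_{\mathbb{R}}\to\mathbb{R}$ is a positive semi-definite symmetric bilinear form whose kernel is $W_{\mathbb{R}}^\perp$ (orthogonal complement with respect to $S$) for some isotropic subspace $W\subset\Lambda$ with respect to $S$. An isomorphism $(\Lambda,S,i,Q)\to(\Lambda',S',i',Q')$ is an isomorphism of $\mathbb{Z}$-modules $\Lambda\to\Lambda'$ taking $S$ to $S'$, $i$ to $i'$ and $Q$ to $Q'$. The isomorphism class is denoted $[\Lambda,S,i,Q]$. The map $\Phi$. For an isotropic subspace $W\subset\Lambda=\mathbb{Z}^{2g}$, the form $J$ induces an isomorphism $\Lambda_{\mathbb{R}}/W_{\mathbb{R}}^\perp\cong W_{\mathbb{R}}^\vee$, $x\mapsto J(x,\cdot)|_{W}$. For $T\in\mathrm{PD}(W^\vee)$, let $Q_T$ be the positive semi-definite form on $\Lambda_{\mathbb{R}}$ with kernel $W_{\mathbb{R}}^\perp$ obtained by pulling back $T$ along $\Lambda_{\mathbb{R}}\to\Lambda_{\mathbb{R}}/W_{\mathbb{R}}^\perp\cong W_{\mathbb{R}}^\vee$. Then $\Phi(T)=[\mathbb{Z}^{2g},J,\mathrm{id},Q_T]$, where $\mathrm{id}$ is the identity of $(\mathbb{Z}/m\mathbb{Z})^{2g}$. *)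

theory Defs
  imports
    "HOL-Analysis.Analysis"
    "HOL-Algebra.Free_Abelian_Groups"
    "HOL-Algebra.Module"
    "HOL-Library.Infinite_Typeclass"
    "HOL-Number_Theory.Cong"
begin

text \<open>
  The genus is \<open>g = CARD('n)\<close>, so \<open>g \<ge> 1\<close> holds automatically. The basis of \<open>R\<^sup>2\<^sup>g\<close> is indexed by
  \<open>'n + 'n\<close>, with \<open>Inl i\<close> standing for \<open>e\<^sub>i\<close> and \<open>Inr i\<close> for \<open>f\<^sub>i\<close>. The abstract abelian groups
  are those of HOL-Algebra and hence written multiplicatively.
\<close>

section \<open>Symmetric bilinear forms\<close>

text \<open>
  A real vector space with an explicit carrier is an element of the type \<open>(real, 'v) module\<close> of
  HOL-Algebra; the fields \<open>mult\<close> and \<open>one\<close> of that record type are not used.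
\<close>

definition sym_bilinear :: "(real, 'v) module \<Rightarrow> ('v \<Rightarrow> 'v \<Rightarrow> real) \<Rightarrow> bool" where
  "sym_bilinear V B \<longleftrightarrow>
     (\<forall>u\<in>carrier V. \<forall>v\<in>carrier V. B u v = B v u) \<and>
     (\<forall>u\<in>carrier V. \<forall>v\<in>carrier V. \<forall>w\<in>carrier V. B (u \<oplus>\<^bsub>V\<^esub> v) w = B u w + B v w) \<and>
     (\<forall>c. \<forall>u\<in>carrier V. \<forall>v\<in>carrier V. B (c \<odot>\<^bsub>V\<^esub> u) v = c * B u v)"

definition pos_semidef :: "(real, 'v) module \<Rightarrow> ('v \<Rightarrow> 'v \<Rightarrow> real) \<Rightarrow> bool" where
  "pos_semidef V B \<longleftrightarrow> (\<forall>v\<in>carrier V. 0 \<le> B v v)"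

definition pos_def :: "(real, 'v) module \<Rightarrow> ('v \<Rightarrow> 'v \<Rightarrow> real) \<Rightarrow> bool" where
  "pos_def V B \<longleftrightarrow> (\<forall>v\<in>carrier V. v \<noteq> \<zero>\<^bsub>V\<^esub> \<longrightarrow> 0 < B v v)"

definition form_kernel :: "(real, 'v) module \<Rightarrow> ('v \<Rightarrow> 'v \<Rightarrow> real) \<Rightarrow> 'v set" where
  "form_kernel V B = {v \<in> carrier V. \<forall>w\<in>carrier V. B v w = 0}"

definition real_span :: "(real, 'v) module \<Rightarrow> 'v set \<Rightarrow> 'v set" where
  "real_span V X = {\<Oplus>\<^bsub>V\<^esub>x\<in>F. a x \<odot>\<^bsub>V\<^esub> x |a F. finite F \<and> F \<subseteq> X}"

section \<open>Isotropic subspaces and congruence subgroups\<close>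

definition is_free_abelian :: "'a monoid \<Rightarrow> bool" where
  "is_free_abelian G \<longleftrightarrow> (\<exists>B :: 'a set. G \<cong> free_Abelian_group B)"

definition isotropic :: "'a monoid \<Rightarrow> ('a \<Rightarrow> 'a \<Rightarrow> int) \<Rightarrow> 'a set \<Rightarrow> bool" where
  "isotropic L S W \<longleftrightarrow>
     subgroup W L \<and> is_free_abelian (L\<lparr>carrier := W\<rparr>) \<and>
     (\<forall>x\<in>W. \<forall>y\<in>W. S x y = 0) \<and>
     (\<exists>U. subgroup U L \<and> is_free_abelian (L\<lparr>carrier := U\<rparr>) \<and>
          W \<inter> U = {\<one>\<^bsub>L\<^esub>} \<and> W <#>\<^bsub>L\<^esub> U = carrier L)"

definition std_form :: "('n::finite + 'n \<Rightarrow> 'r::comm_ring_1) \<Rightarrow> ('n + 'n \<Rightarrow> 'r) \<Rightarrow> 'r" where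
  "std_form x y = (\<Sum>i\<in>UNIV. x (Inl i) * y (Inr i) - x (Inr i) * y (Inl i))"

definition J :: "'r::comm_ring_1 ^ ('n::finite + 'n) \<Rightarrow> 'r ^ ('n + 'n) \<Rightarrow> 'r" where
  "J x y = std_form (($) x) (($) y)"

definition std_lattice :: "(int ^ 'k::finite) monoid" where
  "std_lattice = \<lparr>carrier = UNIV, monoid.mult = (+), one = 0\<rparr>"

definition Sp :: "('r::comm_ring_1 ^ ('n::finite + 'n) ^ ('n + 'n)) set" where
  "Sp = {A. \<forall>x y. J (A *v x) (A *v y) = J x y}"

definition Gamma :: "nat \<Rightarrow> (int ^ ('n::finite + 'n) ^ ('n + 'n)) set" where
  "Gamma m = {A \<in> Sp. \<forall>i j. [A $ i $ j = mat 1 $ i $ j] (mod int m)}"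

section \<open>Cones\<close>

definition real_vec :: "int ^ 'k::finite \<Rightarrow> real ^ 'k" where
  "real_vec x = (\<chi> i. real_of_int (x $ i))"

definition real_mat :: "int ^ 'k::finite ^ 'k \<Rightarrow> real ^ 'k ^ 'k" where
  "real_mat A = (\<chi> i j. real_of_int (A $ i $ j))"

text \<open>For a direct summand \<open>W\<close> of \<open>\<int>\<^sup>2\<^sup>g\<close>, the space \<open>W\<^sub>\<real>\<close> is realized inside \<open>\<real>\<^sup>2\<^sup>g\<close>.\<close>

definition WR :: "(int ^ 'k::finite) set \<Rightarrow> (real ^ 'k) set" where
  "WR W = span (real_vec ` W)"

definition dual_space :: "(int ^ 'k::finite) set \<Rightarrow> (real, real ^ 'k \<Rightarrow> real) module" where
  "dual_space W =
     \<lparr>carrier = {\<phi> \<in> WR W \<rightarrow>\<^sub>E UNIV.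
        (\<forall>x\<in>WR W. \<forall>y\<in>WR W. \<phi> (x + y) = \<phi> x + \<phi> y) \<and>
        (\<forall>c. \<forall>x\<in>WR W. \<phi> (c *\<^sub>R x) = c * \<phi> x)},
      monoid.mult = undefined, one = undefined,
      zero = (\<lambda>x\<in>WR W. 0),
      add = (\<lambda>\<phi> \<psi>. \<lambda>x\<in>WR W. \<phi> x + \<psi> x),
      smult = (\<lambda>c \<phi>. \<lambda>x\<in>WR W. c * \<phi> x)\<rparr>"

text \<open>The lattice \<open>W\<^sup>\<or> = Hom(W, \<int>)\<close> inside the dual of \<open>W\<^sub>\<real>\<close>.\<close>

definition dual_lattice :: "(int ^ 'k::finite) set \<Rightarrow> (real ^ 'k \<Rightarrow> real) set" where
  "dual_lattice W = {\<phi> \<in> carrier (dual_space W). \<forall>w\<in>W. \<phi> (real_vec w) \<in> \<int>}"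

type_synonym 'k dual_form = "(real ^ 'k \<Rightarrow> real) \<Rightarrow> (real ^ 'k \<Rightarrow> real) \<Rightarrow> real"

text \<open>
  \<open>Sym\<^sup>2(W\<^sub>\<real>)\<close>, as symmetric bilinear forms on the dual of \<open>W\<^sub>\<real>\<close>. The forms are extensional, so
  that each form is a single element of the type.
\<close>

definition Sym2 :: "(int ^ 'k::finite) set \<Rightarrow> 'k dual_form set" where
  "Sym2 W = {T \<in> carrier (dual_space W) \<rightarrow>\<^sub>E (carrier (dual_space W) \<rightarrow>\<^sub>E UNIV).
     sym_bilinear (dual_space W) T}"

definition PD :: "(int ^ 'k::finite) set \<Rightarrow> 'k dual_form set" where
  "PD W = {T \<in> Sym2 W. pos_def (dual_space W) T}"

definition PD_rt :: "(int ^ 'k::finite) set \<Rightarrow> 'k dual_form set" where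
  "PD_rt W = {T \<in> Sym2 W. pos_semidef (dual_space W) T \<and>
     (\<exists>B \<subseteq> dual_lattice W. form_kernel (dual_space W) T = real_span (dual_space W) B)}"

section \<open>The tropical moduli space\<close>

text \<open>
  If \<open>A W \<subseteq> W'\<close>, the map \<open>Sym\<^sup>2(W\<^sub>\<real>) \<rightarrow> Sym\<^sup>2(W'\<^sub>\<real>)\<close> induced by \<open>A\<close> evaluates a form on the
  pullbacks of functionals on \<open>W'\<^sub>\<real>\<close> along \<open>A : W\<^sub>\<real> \<rightarrow> W'\<^sub>\<real>\<close>.
\<close>

definition pull_dual ::
    "(int ^ 'k::finite ^ 'k) \<Rightarrow> (int ^ 'k) set \<Rightarrow> (real ^ 'k \<Rightarrow> real) \<Rightarrow> real ^ 'k \<Rightarrow> real" where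
  "pull_dual A W \<phi> = (\<lambda>x\<in>WR W. \<phi> (real_mat A *v x))"

definition push_form ::
    "(int ^ 'k::finite ^ 'k) \<Rightarrow> (int ^ 'k) set \<Rightarrow> (int ^ 'k) set \<Rightarrow> 'k dual_form \<Rightarrow> 'k dual_form" where
  "push_form A W W' T =
     (\<lambda>\<phi>\<in>carrier (dual_space W'). \<lambda>\<psi>\<in>carrier (dual_space W').
        T (pull_dual A W \<phi>) (pull_dual A W \<psi>))"

type_synonym 'k cone_point = "(int ^ 'k) set \<times> 'k dual_form"

definition PD_union :: "('n::finite + 'n) cone_point set" where
  "PD_union = (SIGMA W:{W. isotropic std_lattice J W}. PD W)"

definition PD_rt_union :: "('n::finite + 'n) cone_point set" where
  "PD_rt_union = (SIGMA W:{W. isotropic std_lattice J W}. PD_rt W)"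

definition trop_step ::
    "nat \<Rightarrow> ('n::finite + 'n) cone_point \<Rightarrow> ('n + 'n) cone_point \<Rightarrow> bool" where
  "trop_step m = (\<lambda>(W, T) (W', T').
     (W, T) \<in> PD_rt_union \<and> isotropic std_lattice J W' \<and>
     (\<exists>A\<in>Gamma m. (*v) A ` W \<subseteq> W' \<and> T' = push_form A W W' T))"

definition trop_rel :: "nat \<Rightarrow> (('n::finite + 'n) cone_point \<times> ('n + 'n) cone_point) set" where
  "trop_rel m = {(p, q). p \<in> PD_rt_union \<and> q \<in> PD_rt_union \<and> equivclp (trop_step m) p q}"

definition Ag_trop :: "nat \<Rightarrow> ('n::finite + 'n) cone_point set set" where
  "Ag_trop m = PD_rt_union // trop_rel m"

definition trop_proj :: "nat \<Rightarrow> ('n::finite + 'n) cone_point \<Rightarrow> ('n + 'n) cone_point set" where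
  "trop_proj m p = trop_rel m `` {p}"

section \<open>Extension of scalars\<close>

text \<open>
  \<open>L \<otimes> \<real>\<close> is the quotient of the real vector space of formal real combinations of elements
  of \<open>L\<close> by the subspace generated by all \<open>[x y] - [x] - [y]\<close>. Its elements are cosets.
\<close>

definition fscale :: "real \<Rightarrow> ('a \<Rightarrow>\<^sub>0 real) \<Rightarrow> ('a \<Rightarrow>\<^sub>0 real)" where
  "fscale c \<xi> = Poly_Mapping.map ((*) c) \<xi>"

lemma lookup_fscale [simp]: "Poly_Mapping.lookup (fscale c \<xi>) x = c * Poly_Mapping.lookup \<xi> x"
  by (simp add: fscale_def Poly_Mapping.map.rep_eq when_def)

lemma vector_space_fscale: "vector_space fscale"
  by unfold_locales (auto intro!: poly_mapping_eqI simp: lookup_add algebra_simps)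

definition formal_sums :: "'a monoid \<Rightarrow> ('a \<Rightarrow>\<^sub>0 real) monoid" where
  "formal_sums L = \<lparr>carrier = {\<xi>. Poly_Mapping.keys \<xi> \<subseteq> carrier L}, monoid.mult = (+), one = 0\<rparr>"

definition tensor_relations :: "'a monoid \<Rightarrow> ('a \<Rightarrow>\<^sub>0 real) set" where
  "tensor_relations L = Modules.module.span fscale
     {Poly_Mapping.single (x \<otimes>\<^bsub>L\<^esub> y) 1 - Poly_Mapping.single x 1 - Poly_Mapping.single y 1 |x y.
        x \<in> carrier L \<and> y \<in> carrier L}"

definition real_ext :: "'a monoid \<Rightarrow> (real, ('a \<Rightarrow>\<^sub>0 real) set) module" where
  "real_ext L =
     \<lparr>carrier = carrier (formal_sums L Mod tensor_relations L),
      monoid.mult = undefined, one = undefined,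
      zero = \<one>\<^bsub>formal_sums L Mod tensor_relations L\<^esub>,
      add = (\<otimes>\<^bsub>formal_sums L Mod tensor_relations L\<^esub>),
      smult = (\<lambda>c X. tensor_relations L <#>\<^bsub>formal_sums L\<^esub> (fscale c ` X))\<rparr>"

text \<open>The element \<open>x \<otimes> 1\<close>.\<close>

definition ext_elem :: "'a monoid \<Rightarrow> 'a \<Rightarrow> ('a \<Rightarrow>\<^sub>0 real) set" where
  "ext_elem L x = tensor_relations L #>\<^bsub>formal_sums L\<^esub> Poly_Mapping.single x 1"

text \<open>
  Bilinear extension of \<open>S\<close>, functoriality, and the identification of \<open>\<int>\<^sup>k \<otimes> \<real>\<close> with \<open>\<real>\<^sup>k\<close>. Each
  is computed on representatives; the result does not depend on their choice.
\<close>

definition form_ext ::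
    "('a \<Rightarrow> 'a \<Rightarrow> int) \<Rightarrow> ('a \<Rightarrow>\<^sub>0 real) set \<Rightarrow> ('a \<Rightarrow>\<^sub>0 real) set \<Rightarrow> real" where
  "form_ext S X Y = the_elem ((\<lambda>(\<xi>, \<eta>).
     \<Sum>x\<in>Poly_Mapping.keys \<xi>. \<Sum>y\<in>Poly_Mapping.keys \<eta>.
       Poly_Mapping.lookup \<xi> x * Poly_Mapping.lookup \<eta> y * real_of_int (S x y)) ` (X \<times> Y))"

definition map_ext ::
    "'b monoid \<Rightarrow> ('a \<Rightarrow> 'b) \<Rightarrow> ('a \<Rightarrow>\<^sub>0 real) set \<Rightarrow> ('b \<Rightarrow>\<^sub>0 real) set" where
  "map_ext L' \<alpha> X = tensor_relations L' <#>\<^bsub>formal_sums L'\<^esub>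
     ((\<lambda>\<xi>. \<Sum>x\<in>Poly_Mapping.keys \<xi>. Poly_Mapping.single (\<alpha> x) (Poly_Mapping.lookup \<xi> x)) ` X)"

definition ext_vec :: "(int ^ 'k::finite \<Rightarrow>\<^sub>0 real) set \<Rightarrow> real ^ 'k" where
  "ext_vec X = the_elem ((\<lambda>\<xi>.
     \<Sum>x\<in>Poly_Mapping.keys \<xi>. Poly_Mapping.lookup \<xi> x *\<^sub>R real_vec x) ` X)"

text \<open>The orthogonal complement of \<open>W\<^sub>\<real>\<close> in \<open>L \<otimes> \<real>\<close>.\<close>

definition perp_ext ::
    "'a monoid \<Rightarrow> ('a \<Rightarrow> 'a \<Rightarrow> int) \<Rightarrow> 'a set \<Rightarrow> ('a \<Rightarrow>\<^sub>0 real) set set" where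
  "perp_ext L S W = {X \<in> carrier (real_ext L).
     \<forall>Y \<in> real_span (real_ext L) (ext_elem L ` W). form_ext S X Y = 0}"

section \<open>Tropical abelian varieties with level structure\<close>

definition mult_subgroup :: "nat \<Rightarrow> 'a monoid \<Rightarrow> 'a set" where
  "mult_subgroup m L = (\<lambda>x. x [^]\<^bsub>L\<^esub> m) ` carrier L"

definition residue_class :: "nat \<Rightarrow> 'a monoid \<Rightarrow> 'a \<Rightarrow> 'a set" where
  "residue_class m L x = mult_subgroup m L #>\<^bsub>L\<^esub> x"

text \<open>\<open>(\<int>/m\<int>)\<^sup>2\<^sup>g\<close>, with \<open>\<int>/m\<int>\<close> represented by the residues \<open>0, \<dots>, m - 1\<close>.\<close>

definition level_group :: "nat \<Rightarrow> ('n::finite + 'n \<Rightarrow> int) monoid" where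
  "level_group m = product_group UNIV (\<lambda>_. integer_mod_group m)"

type_synonym ('a, 'n) pptav =
  "'a monoid \<times> ('a \<Rightarrow> 'a \<Rightarrow> int) \<times> ('a set \<Rightarrow> 'n + 'n \<Rightarrow> int) \<times>
   (('a \<Rightarrow>\<^sub>0 real) set \<Rightarrow> ('a \<Rightarrow>\<^sub>0 real) set \<Rightarrow> real)"

text \<open>The last conjunct says that a Gram matrix of \<open>S\<close> has determinant 1; this is independent of the basis.\<close>

definition unimodular_symplectic ::
    "'n::finite itself \<Rightarrow> 'a monoid \<Rightarrow> ('a \<Rightarrow> 'a \<Rightarrow> int) \<Rightarrow> bool" where
  "unimodular_symplectic TYPE('n) L S \<longleftrightarrow>
     (\<forall>x\<in>carrier L. \<forall>y\<in>carrier L. \<forall>z\<in>carrier L. S (x \<otimes>\<^bsub>L\<^esub> y) z = S x z + S y z) \<and>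
     (\<forall>x\<in>carrier L. \<forall>y\<in>carrier L. \<forall>z\<in>carrier L. S x (y \<otimes>\<^bsub>L\<^esub> z) = S x y + S x z) \<and>
     (\<forall>x\<in>carrier L. S x x = 0) \<and>
     (\<forall>x\<in>carrier L. (\<forall>y\<in>carrier L. S x y = 0) \<longrightarrow> x = \<one>\<^bsub>L\<^esub>) \<and>
     (\<exists>h \<in> iso (free_Abelian_group (UNIV :: ('n + 'n) set)) L.
        det (\<chi> i j. S (h (frag_of i)) (h (frag_of j))) = 1)"

definition is_pptav :: "nat \<Rightarrow> ('a, 'n::finite) pptav \<Rightarrow> bool" where
  "is_pptav m = (\<lambda>(L, S, i, Q).
     comm_group L \<and> L \<cong> free_Abelian_group (UNIV :: ('n + 'n) set) \<and>
     unimodular_symplectic TYPE('n) L S \<and>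
     i \<in> iso (L Mod mult_subgroup m L) (level_group m) \<and>
     (\<forall>x\<in>carrier L. \<forall>y\<in>carrier L.
        [std_form (i (residue_class m L x)) (i (residue_class m L y)) = S x y] (mod int m)) \<and>
     sym_bilinear (real_ext L) Q \<and> pos_semidef (real_ext L) Q \<and>
     (\<exists>W. isotropic L S W \<and> form_kernel (real_ext L) Q = perp_ext L S W))"

definition pptav_iso :: "nat \<Rightarrow> ('a, 'n::finite) pptav \<Rightarrow> ('b, 'n) pptav \<Rightarrow> bool" where
  "pptav_iso m = (\<lambda>(L, S, i, Q) (L', S', i', Q').
     \<exists>\<alpha> \<in> iso L L'.
       (\<forall>x\<in>carrier L. \<forall>y\<in>carrier L. S' (\<alpha> x) (\<alpha> y) = S x y) \<and>
       (\<forall>x\<in>carrier L. i' (residue_class m L' (\<alpha> x)) = i (residue_class m L x)) \<and>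
       (\<forall>X\<in>carrier (real_ext L). \<forall>Y\<in>carrier (real_ext L).
          Q' (map_ext L' \<alpha> X) (map_ext L' \<alpha> Y) = Q X Y))"

text \<open>
  The isomorphism class of \<open>X\<close> consists of the objects isomorphic to \<open>X\<close> whose lattice is carried by a
  subset of the universe \<open>'u\<close>, whichever type carries \<open>X\<close> itself. Any infinite \<open>'u\<close> contains copies
  of all lattices of finite rank, so no isomorphism type is lost.
\<close>

definition pptav_class :: "nat \<Rightarrow> ('a, 'n::finite) pptav \<Rightarrow> ('u::infinite, 'n) pptav set" where
  "pptav_class m X = {Y. is_pptav m Y \<and> pptav_iso m X Y}"

definition pptav_classes :: "nat \<Rightarrow> ('u::infinite, 'n::finite) pptav set set" where
  "pptav_classes m = pptav_class m ` {X :: ('u, 'n) pptav. is_pptav m X}"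

section \<open>The map \<open>\<Phi>\<close>\<close>

text \<open>The identification of \<open>\<int>\<^sup>2\<^sup>g/m\<int>\<^sup>2\<^sup>g\<close> with \<open>(\<int>/m\<int>)\<^sup>2\<^sup>g\<close>.\<close>

definition std_level :: "nat \<Rightarrow> (int ^ ('n::finite + 'n)) set \<Rightarrow> 'n + 'n \<Rightarrow> int" where
  "std_level m X = the_elem ((\<lambda>x k. (x $ k) mod int m) ` X)"

definition Q_form :: "('n::finite + 'n) cone_point \<Rightarrow>
    (int ^ ('n + 'n) \<Rightarrow>\<^sub>0 real) set \<Rightarrow> (int ^ ('n + 'n) \<Rightarrow>\<^sub>0 real) set \<Rightarrow> real" where
  "Q_form = (\<lambda>(W, T) X Y. T (\<lambda>w\<in>WR W. J (ext_vec X) w) (\<lambda>w\<in>WR W. J (ext_vec Y) w))"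

definition Phi :: "nat \<Rightarrow> ('n::finite + 'n) cone_point \<Rightarrow> ('u::infinite, 'n) pptav set" where
  "Phi m p = pptav_class m (std_lattice, J, std_level m, Q_form p)"

end

theory Submission
  imports Defs
begin

text \<open>
  Pulling a point \<open>T\<close> of a cone back to \<open>\<real>\<^sup>2\<^sup>g\<close> gives a form \<open>Q\<^sub>T\<close> that does not change when the cone
  is enlarged, and \<open>\<Gamma>[m]\<close> acts on these forms by change of variables. Every point of \<open>PD_rt W\<close> comes from
  \<open>PD W\<^sub>0\<close> for an isotropic \<open>W\<^sub>0 \<subseteq> W\<close>, because the radical of \<open>Q\<^sub>T\<close> is rational, and a point of \<open>PD W\<close>
  is determined by its form, since \<open>W\<close> can be read off from the radical. Hence two points are identified
  in the moduli space exactly when their forms differ by an element of \<open>\<Gamma>[m]\<close>.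

  On the other side, every tropical abelian variety with level structure is isomorphic to some
  \<open>(\<int>\<^sup>2\<^sup>g, J, id, Q)\<close>: a symplectic basis modulo \<open>m\<close> lifts to an integral one, one hyperbolic pair at a
  time. The form \<open>Q\<close> is unique up to \<open>\<Gamma>[m]\<close>, because automorphisms of \<open>(\<int>\<^sup>2\<^sup>g, J, id)\<close> are exactly the
  elements of \<open>\<Gamma>[m]\<close>.
\<close>

section \<open>The standard symplectic form\<close>

text \<open>Both sides are compared through one invariant in a fixed space: a form on
  \<open>real ^ ('n + 'n)\<close> modulo \<open>Gamma_equiv\<close>. This avoids an analysis of
  zigzags of \<open>trop_step\<close>: each step preserves the invariant, and two points with the
  same invariant are joined by three steps through representatives in \<open>PD_union\<close>. On
  the other side a frame turns cosets of formal sums into coordinate vectors, and isomorphic objects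
  are those having frames with a common form.

  Integral and real data are linked by purity: the subgroups with a free complement are those closed
  under division by nonzero integers. Such a subgroup is spanned by part of a lattice basis; the
  basis dual to it under \<open>J\<close> shows that the double complement returns the subgroup and
  that complements commute with real extension.

  Determinant 1 enters because it makes every integral functional equal to \<open>S y\<close> for a
  lattice vector \<open>y\<close>, so that a primitive vector pairs to 1 with some vector and can
  start a hyperbolic pair. A vector given only modulo \<open>m\<close> may still be divisible by a
  number prime to \<open>m\<close>; this is the obstacle in the lifting.\<close>

lemma sum_UNIV_sum:
  fixes f :: "'n::finite + 'm::finite \<Rightarrow> 'a::comm_monoid_add"
  shows "sum f UNIV = (\<Sum>i\<in>UNIV. f (Inl i)) + (\<Sum>i\<in>UNIV. f (Inr i))"
proof -
  have "sum f UNIV = sum f (range Inl) + sum f (range Inr)"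
    unfolding UNIV_sum by (intro sum.union_disjoint) auto
  then show ?thesis by (simp add: sum.reindex)
qed

lemma J_add_left: "J (x + y) z = J x z + J y z"
  and J_add_right: "J z (x + y) = J z x + J z y"
  and J_diff_left: "J (x - y) z = J x z - J y z"
  and J_diff_right: "J z (x - y) = J z x - J z y"
  and J_scale_left: "J (c *s x) z = c * J x z"
  and J_scale_right: "J z (c *s x) = c * J z x"
  by (simp_all add: J_def std_form_def algebra_simps sum.distrib sum_subtractf sum_distrib_left)

lemma J_zero_left [simp]: "J 0 x = 0" and J_zero_right [simp]: "J x 0 = 0"
  and J_self [simp]: "J x x = 0"
  by (simp_all add: J_def std_form_def algebra_simps)

lemma J_minus_right: "J z (- x) = - J z x"
  using J_diff_right [of z 0 x] by simp

lemma J_antisym: "J y x = - J x y"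
  by (simp add: J_def std_form_def algebra_simps sum_negf [symmetric])

lemma J_scaleR_left: "J (c *\<^sub>R x) z = c * J x (z :: real ^ ('n::finite + 'n))"
  and J_scaleR_right: "J z (c *\<^sub>R x) = c * J z (x :: real ^ ('n::finite + 'n))"
  using J_scale_left [of c x z] J_scale_right [of z c x] by (simp_all add: scalar_mult_eq_scaleR)

lemma J_sum_left: "J (sum f A) x = (\<Sum>i\<in>A. J (f i) x)"
  and J_sum_right: "J x (sum f A) = (\<Sum>i\<in>A. J x (f i))"
  by (induction A rule: infinite_finite_induct) (simp_all add: J_add_left J_add_right)

lemma J_axis_Inl: "J x (axis (Inl i) 1) = - x $ Inr i"
  and J_axis_Inr: "J x (axis (Inr i) 1) = x $ Inl i"
proof -
  have "J x (axis (Inl i) 1) = (\<Sum>j\<in>UNIV. if j = i then - x $ Inr i else 0)"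
    unfolding J_def std_form_def by (rule sum.cong) (auto simp: axis_def)
  then show "J x (axis (Inl i) 1) = - x $ Inr i" by simp
  have "J x (axis (Inr i) 1) = (\<Sum>j\<in>UNIV. if j = i then x $ Inl i else 0)"
    unfolding J_def std_form_def by (rule sum.cong) (auto simp: axis_def)
  then show "J x (axis (Inr i) 1) = x $ Inl i" by simp
qed

lemma J_nondegenerate:
  assumes "\<And>y. J x y = 0" shows "x = 0"
proof (rule vec_eq_iff [THEN iffD2], rule allI)
  fix k show "x $ k = 0 $ k"
    using assms [of "axis (Inr (projl k)) 1"] assms [of "axis (Inl (projr k)) 1"]
    by (cases k) (auto simp: J_axis_Inl J_axis_Inr)
qed

lemma J_eqI: "(\<And>z. J x z = J y z) \<Longrightarrow> x = y"
  using J_nondegenerate [of "x - y"] by (simp add: J_diff_left)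

lemma J_real_vec: "J (real_vec x) (real_vec y) = real_of_int (J x y)"
  by (simp add: J_def std_form_def real_vec_def)

lemma real_vec_add: "real_vec (x + y) = real_vec x + real_vec y"
  and real_vec_diff: "real_vec (x - y) = real_vec x - real_vec y"
  and real_vec_scale: "real_vec (c *s x) = real_of_int c *\<^sub>R real_vec x"
  and real_vec_zero [simp]: "real_vec 0 = 0"
  and real_vec_axis: "real_vec (axis i 1) = axis i 1"
  by (simp_all add: real_vec_def vec_eq_iff axis_def)

lemma real_vec_inject [simp]: "real_vec x = real_vec y \<longleftrightarrow> x = y"
  by (simp add: real_vec_def vec_eq_iff)

lemma real_vec_sum: "real_vec (sum f A) = (\<Sum>i\<in>A. real_vec (f i))"
  by (induction A rule: infinite_finite_induct) (simp_all add: real_vec_add)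

lemma additive_int_simps:
  fixes f :: "int ^ 'k \<Rightarrow> 'b::ab_group_add"
  assumes "\<And>x y. f (x + y) = f x + f y"
  shows "f 0 = 0" "f (- x) = - f x" "f (x - y) = f x - f y" "f (sum g A) = (\<Sum>i\<in>A. f (g i))"
proof -
  interpret additive f by (unfold_locales) (rule assms)
  show "f 0 = 0" "f (- x) = - f x" "f (x - y) = f x - f y" "f (sum g A) = (\<Sum>i\<in>A. f (g i))"
    by (rule zero minus diff sum)+
qed

lemma additive_int_scale:
  fixes f :: "int ^ 'k::finite \<Rightarrow> int"
  assumes "\<And>x y. f (x + y) = f x + f y"
  shows "f (c *s x) = c * f x"
proof (induction c rule: int_induct [where k = 0])
  case base
  then show ?case using additive_int_simps(1) [of f, OF assms] by simp
next
  case (step1 i)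
  then show ?case by (simp add: vector_sadd_rdistrib assms algebra_simps)
next
  case (step2 i)
  then show ?case by (simp add: vector_sub_rdistrib additive_int_simps(3) [of f, OF assms] algebra_simps)
qed

lemma J_represents:
  fixes \<phi> :: "'r::comm_ring_1 ^ ('n::finite + 'n) \<Rightarrow> 'r"
  assumes add: "\<And>x y. \<phi> (x + y) = \<phi> x + \<phi> y" and scale: "\<And>c x. \<phi> (c *s x) = c * \<phi> x"
  obtains y where "\<And>x. \<phi> x = J y x"
proof
  \<comment> \<open>The sign pattern inverts \<open>J_axis_Inl\<close> and
    \<open>J_axis_Inr\<close>: pairing \<open>y\<close> with a basis vector returns, up to sign, the
    opposite coordinate of \<open>y\<close>.\<close>
  define y :: "'r ^ ('n + 'n)"
    where "y = (\<chi> k. case k of Inl i \<Rightarrow> \<phi> (axis (Inr i) 1) | Inr i \<Rightarrow> - \<phi> (axis (Inl i) 1))"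
  fix x :: "'r ^ ('n + 'n)"
  have sum: "\<phi> (sum h A) = (\<Sum>i\<in>A. \<phi> (h i))" for h and A :: "('n + 'n) set"
    using scale [of 0 0] by (induction A rule: infinite_finite_induct) (auto simp: add)
  have "\<phi> x = \<phi> (\<Sum>k\<in>UNIV. x $ k *s axis k 1)" by (simp add: basis_expansion)
  also have "\<dots> = (\<Sum>k\<in>UNIV. x $ k * \<phi> (axis k 1))" by (simp add: sum scale)
  also have "\<dots> = J y x"
    by (simp add: sum_UNIV_sum J_def std_form_def y_def sum.distrib [symmetric] algebra_simps)
  finally show "\<phi> x = J y x" .
qed

lemma J_represents_int:
  fixes \<phi> :: "int ^ ('n::finite + 'n) \<Rightarrow> int"
  assumes "\<And>x y. \<phi> (x + y) = \<phi> x + \<phi> y"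
  obtains y where "\<And>x. \<phi> x = J y x"
  using J_represents [of \<phi>] additive_int_scale [of \<phi>] assms by metis

section \<open>Pure subgroups of the integer lattice\<close>

text \<open>These are the saturated subgroups, the direct summands of the lattice. The case
  \<open>n = -1\<close> of the last clause gives closure under negation.\<close>

definition pure_subgroup :: "(int ^ 'k::finite) set \<Rightarrow> bool" where
  "pure_subgroup H \<longleftrightarrow> 0 \<in> H \<and> (\<forall>x\<in>H. \<forall>y\<in>H. x + y \<in> H) \<and>
     (\<forall>n x. n \<noteq> 0 \<longrightarrow> n *s x \<in> H \<longrightarrow> x \<in> H)"

lemma pure_subgroupD:
  assumes "pure_subgroup H"
  shows "0 \<in> H" "\<And>x y. x \<in> H \<Longrightarrow> y \<in> H \<Longrightarrow> x + y \<in> H"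
    "\<And>n x. n \<noteq> 0 \<Longrightarrow> n *s x \<in> H \<Longrightarrow> x \<in> H"
  using assms unfolding pure_subgroup_def by blast+

lemma pure_subgroup_uminus:
  assumes "pure_subgroup H" "x \<in> H" shows "- x \<in> H"
  using pure_subgroupD(3) [OF assms(1), of "-1" "- x"] assms(2)
  by (simp add: vec_eq_iff vector_scalar_mult_def)

lemma pure_subgroup_diff:
  assumes "pure_subgroup H" "x \<in> H" "y \<in> H" shows "x - y \<in> H"
  using pure_subgroupD(2) [OF assms(1,2), of "- y"] pure_subgroup_uminus [OF assms(1,3)] by simp

lemma pure_subgroup_scale:
  assumes "pure_subgroup H" "x \<in> H" shows "n *s x \<in> H"
proof (induction n rule: int_induct [where k = 0])
  case base
  then show ?case using pure_subgroupD(1) [OF assms(1)] by simp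
next
  case (step1 i)
  then show ?case using pure_subgroupD(2) [OF assms(1)] assms(2) by (simp add: vector_sadd_rdistrib)
next
  case (step2 i)
  then show ?case using pure_subgroup_diff [OF assms(1)] assms(2) by (simp add: vector_sub_rdistrib)
qed

lemma pure_subgroup_sum:
  assumes "pure_subgroup H" "\<And>i. i \<in> A \<Longrightarrow> f i \<in> H" shows "sum f A \<in> H"
  using assms(2)
  by (induction A rule: infinite_finite_induct) (auto intro: pure_subgroupD [OF assms(1)])

text \<open>\<open>u\<close> is the dual family of coordinate functionals, carried along so that a
  change of basis needs no matrix inverse.\<close>

definition int_basis :: "('k::finite \<Rightarrow> int ^ 'k) \<Rightarrow> ('k \<Rightarrow> int ^ 'k \<Rightarrow> int) \<Rightarrow> bool" where
  "int_basis f u \<longleftrightarrow> (\<forall>i x y. u i (x + y) = u i x + u i y) \<and>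
     (\<forall>x. x = (\<Sum>i\<in>UNIV. u i x *s f i)) \<and> (\<forall>i j. u i (f j) = (if i = j then 1 else 0))"

lemma int_basis_axis: "int_basis (\<lambda>i. axis i 1) (\<lambda>i x. x $ i)"
  unfolding int_basis_def by (simp add: basis_expansion) (auto simp: axis_def)

lemma int_basisD:
  assumes "int_basis f u"
  shows "u i (x + y) = u i x + u i y" "(\<Sum>i\<in>UNIV. u i x *s f i) = x"
    "u i (f j) = (if i = j then 1 else 0)" "u i (c *s x) = c * u i x"
    "u i (sum h A) = (\<Sum>a\<in>A. u i (h a))" "u i (x - y) = u i x - u i y"
proof -
  have add: "\<And>x y. u i (x + y) = u i x + u i y"
    using assms by (simp add: int_basis_def)
  show "u i (x + y) = u i x + u i y" "u i (c *s x) = c * u i x"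
    "u i (sum h A) = (\<Sum>a\<in>A. u i (h a))" "u i (x - y) = u i x - u i y"
    using add additive_int_scale [of "u i", OF add] additive_int_simps [of "u i", OF add] by auto
  show "(\<Sum>i\<in>UNIV. u i x *s f i) = x" "u i (f j) = (if i = j then 1 else 0)"
    using assms unfolding int_basis_def by (metis, metis)
qed

lemma int_basis_shear:
  fixes f :: "'k::finite \<Rightarrow> int ^ 'k"
  assumes B: "int_basis f u" and jl: "j \<noteq> l"
  shows "int_basis (f(l := f l + s *s f j)) (u(j := \<lambda>x. u j x - s * u l x))"
  unfolding int_basis_def
proof (intro conjI allI)
  let ?f = "f(l := f l + s *s f j)" and ?u = "u(j := \<lambda>x. u j x - s * u l x)"
  note D = int_basisD [OF B]
  show "?u i (x + y) = ?u i x + ?u i y" for i x y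
    by (simp add: D algebra_simps)
  show "?u i (?f k) = (if i = k then 1 else 0)" for i k
    using jl by (auto simp: D)
  fix x
  have "(\<Sum>i\<in>UNIV. ?u i x *s ?f i) = (\<Sum>i\<in>UNIV. u i x *s f i
      + (if i = j then - (s * u l x) *s f j else 0) + (if i = l then (s * u l x) *s f j else 0))"
    using jl by (intro sum.cong) (auto simp: vec_eq_iff algebra_simps)
  also have "\<dots> = x"
    by (simp add: sum.distrib D vec_eq_iff)
  finally show "x = (\<Sum>i\<in>UNIV. ?u i x *s ?f i)" by simp
qed

text \<open>Euclid's algorithm on the coordinates of \<open>x\<close>, carried out by shears of the basis, ends when a
  single nonzero coordinate is left; purity then puts the corresponding basis vector into \<open>H\<close>.\<close>

lemma pure_subgroup_extend_basis:
  fixes f :: "'k::finite \<Rightarrow> int ^ 'k"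
  assumes H: "pure_subgroup H" and "int_basis f u" and "\<forall>i\<in>I. f i \<in> H"
    and "x \<in> H" and "\<forall>i\<in>I. u i x = 0" and "x \<noteq> 0"
  shows "\<exists>f' u' j. int_basis f' u' \<and> j \<notin> I \<and> (\<forall>i\<in>insert j I. f' i \<in> H)"
  using assms(2-5)
proof (induction "nat (\<Sum>i\<in>UNIV. \<bar>u i x\<bar>)" arbitrary: f u rule: less_induct)
  case less
  note D = int_basisD [OF less.prems(1)]
  obtain j0 where j0: "u j0 x \<noteq> 0"
    using D(2) [of x] assms(6) by (metis (no_types, lifting) sum.neutral vector_smult_lzero)
  show ?case
  proof (cases "\<exists>l. l \<noteq> j0 \<and> u l x \<noteq> 0")
    case False
    have "x = (\<Sum>i\<in>UNIV. u i x *s f i)" by (simp add: D)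
    also have "\<dots> = (\<Sum>i\<in>UNIV. if i = j0 then u j0 x *s f j0 else 0)"
      using False by (intro sum.cong) auto
    finally have "u j0 x *s f j0 \<in> H" using less.prems by simp
    then have "f j0 \<in> H" using pure_subgroupD(3) [OF H j0] by blast
    then show ?thesis using less.prems j0 by blast
  next
    case True
    then obtain j l where jl: "j \<noteq> l" "u j x \<noteq> 0" "u l x \<noteq> 0" "\<bar>u l x\<bar> \<le> \<bar>u j x\<bar>"
      using j0 by (metis linear)
    \<comment> \<open>With this sign \<open>s * u l x\<close> has the sign of \<open>u j x\<close>.
      Since \<open>u l x\<close> is nonzero and not larger in absolute value, the shear strictly
      lowers the coordinate of index \<open>j\<close> in absolute value.\<close>
    define s where "s = sgn (u j x) * sgn (u l x)"
    define f' where "f' = f(l := f l + s *s f j)"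
    define u' where "u' = u(j := \<lambda>x. u j x - s * u l x)"
    have lt: "\<bar>u j x - s * u l x\<bar> < \<bar>u j x\<bar>"
      using jl by (auto simp: s_def sgn_if abs_if split: if_splits)
    have "(\<Sum>i\<in>UNIV. \<bar>u' i x\<bar>) < (\<Sum>i\<in>UNIV. \<bar>u i x\<bar>)"
      by (rule sum_strict_mono_ex1) (use lt in \<open>auto simp: u'_def intro!: exI [of _ j]\<close>)
    moreover have "0 \<le> (\<Sum>i\<in>UNIV. \<bar>u' i x\<bar>)" by (simp add: sum_nonneg)
    ultimately have "nat (\<Sum>i\<in>UNIV. \<bar>u' i x\<bar>) < nat (\<Sum>i\<in>UNIV. \<bar>u i x\<bar>)" by linarith
    moreover have "int_basis f' u'"
      unfolding f'_def u'_def by (rule int_basis_shear [OF less.prems(1) jl(1)])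
    \<comment> \<open>The coordinates of \<open>x\<close> on \<open>I\<close> vanish, so
      \<open>j\<close> and \<open>l\<close> lie outside \<open>I\<close> and the vectors already
      placed in \<open>H\<close> stay fixed.\<close>
    moreover have "\<forall>i\<in>I. f' i \<in> H" "\<forall>i\<in>I. u' i x = 0"
      using less.prems jl by (auto simp: f'_def u'_def)
    ultimately show ?thesis using less.hyps less.prems by blast
  qed
qed

text \<open>Take a basis with as many members in \<open>H\<close> as possible, indexed by
  \<open>I\<close>. An element of \<open>H\<close> with a nonzero coordinate outside
  \<open>I\<close> would allow \<open>pure_subgroup_extend_basis\<close> to produce a basis with one
  more.\<close>

lemma pure_subgroup_basis:
  fixes H :: "(int ^ 'k::finite) set"
  assumes H: "pure_subgroup H"
  obtains f u I where "int_basis f u" "\<And>i. i \<in> I \<Longrightarrow> f i \<in> H" "H = {x. \<forall>i. i \<notin> I \<longrightarrow> u i x = 0}"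
proof -
  define P where "P I \<longleftrightarrow> (\<exists>f u. int_basis f u \<and> (\<forall>i\<in>I. f i \<in> H))" for I
  have "P {}" using int_basis_axis by (auto simp: P_def)
  moreover have "\<forall>I. P I \<longrightarrow> card I \<le> CARD('k)" by (auto intro: card_mono)
  ultimately obtain I where I: "P I" and max: "\<And>I'. P I' \<Longrightarrow> card I' \<le> card I"
    using ex_has_greatest_nat [of P "{}" card] by (metis less_Suc_eq_le)
  from I obtain f u where B: "int_basis f u" and fI: "\<forall>i\<in>I. f i \<in> H" by (auto simp: P_def)
  note D = int_basisD [OF B]
  have "x \<in> H" if "\<forall>i. i \<notin> I \<longrightarrow> u i x = 0" for x
  proof -
    have "(\<Sum>i\<in>UNIV. u i x *s f i) \<in> H"
      using that fI by (intro pure_subgroup_sum [OF H])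
        (metis H pure_subgroup_scale pure_subgroupD(1) vector_smult_lzero)
    then show ?thesis by (simp add: D)
  qed
  moreover have "u j x = 0" if x: "x \<in> H" and "j \<notin> I" for x j
  proof (rule ccontr)
    assume j: "u j x \<noteq> 0"
    \<comment> \<open>Removing the part along \<open>I\<close> stays in \<open>H\<close> and makes
      the coordinates on \<open>I\<close> vanish, as the extension lemma requires.\<close>
    define y where "y = x - (\<Sum>i\<in>I. u i x *s f i)"
    have uy: "u i y = (if i \<in> I then 0 else u i x)" for i
      by (simp add: y_def D if_distrib [of "(*) _"] cong: if_cong)
    have "y \<in> H"
      unfolding y_def using x fI H
      by (intro pure_subgroup_diff [OF H] pure_subgroup_sum [OF H] pure_subgroup_scale [OF H]) auto
    moreover have "y \<noteq> 0"
      using uy [of j] j \<open>j \<notin> I\<close> D(4) [of j 0 0] by auto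
    ultimately obtain j' where "j' \<notin> I" "P (insert j' I)"
      using pure_subgroup_extend_basis [OF H B fI] uy unfolding P_def by (metis (full_types))
    then show False using max [of "insert j' I"] by simp
  qed
  ultimately have "H = {x. \<forall>i. i \<notin> I \<longrightarrow> u i x = 0}" by blast
  then show ?thesis using that B fI by blast
qed

section \<open>Symplectic complements\<close>

definition Jperp :: "(int ^ ('n::finite + 'n)) set \<Rightarrow> (int ^ ('n + 'n)) set" where
  "Jperp N = {x. \<forall>y\<in>N. J x y = 0}"

definition JperpR :: "(int ^ ('n::finite + 'n)) set \<Rightarrow> (real ^ ('n + 'n)) set" where
  "JperpR N = {x. \<forall>y\<in>N. J x (real_vec y) = 0}"

lemma pure_subgroup_Jperp: "pure_subgroup (Jperp N)"
  by (auto simp: pure_subgroup_def Jperp_def J_add_left J_scale_left)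

lemma JperpR_WR: "x \<in> JperpR N \<longleftrightarrow> (\<forall>y\<in>WR N. J x y = 0)"
proof
  assume x: "x \<in> JperpR N"
  show "\<forall>y\<in>WR N. J x y = 0"
  proof
    fix y assume "y \<in> WR N"
    then show "J x y = 0" unfolding WR_def
      by (induction rule: span_induct_alt) (use x in \<open>auto simp: JperpR_def J_add_right J_scaleR_right\<close>)
  qed
qed (auto simp: JperpR_def WR_def intro: span_base)

lemma subspace_JperpR: "subspace (JperpR N)"
  by (auto simp: subspace_def JperpR_def J_add_left J_scaleR_left)

lemma real_vec_JperpR: "real_vec x \<in> JperpR N \<longleftrightarrow> x \<in> Jperp N"
  by (simp add: JperpR_def Jperp_def J_real_vec)

lemma linear_eq_on_lattice:
  fixes F G :: "real ^ 'k::finite \<Rightarrow> 'b::real_vector"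
  assumes "linear F" "linear G" and eq: "\<And>x. F (real_vec x) = G (real_vec x)"
  shows "F x = G x"
proof -
  have "x = (\<Sum>i\<in>UNIV. x $ i *\<^sub>R axis i 1)"
    using basis_expansion [of x] by (simp add: scalar_mult_eq_scaleR)
  moreover have "F (axis i 1) = G (axis i 1)" for i
    using eq [of "axis i 1"] by (simp add: real_vec_axis)
  then have "F (\<Sum>i\<in>UNIV. x $ i *\<^sub>R axis i 1) = G (\<Sum>i\<in>UNIV. x $ i *\<^sub>R axis i 1)"
    using assms(1,2) by (simp add: linear_sum linear_scale)
  ultimately show ?thesis by simp
qed

text \<open>\<open>J\<close> represents the coordinate functionals of an adapted basis
  \<open>f\<close> by vectors \<open>g i\<close>, which form the dual basis. The functionals of
  index outside \<open>I\<close> vanish on \<open>N\<close>, so those \<open>g i\<close> are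
  orthogonal to it. The real expansions follow because linear identities may be tested on lattice
  vectors.\<close>

lemma pure_subgroup_dual_basis:
  fixes N :: "(int ^ ('n::finite + 'n)) set"
  assumes "pure_subgroup N"
  obtains f g :: "'n + 'n \<Rightarrow> int ^ ('n + 'n)" and I where
    "\<And>x. x = (\<Sum>i\<in>UNIV. J (g i) x *s f i)" "\<And>x. x = (\<Sum>i\<in>UNIV. J x (f i) *s g i)"
    "\<And>x. x = (\<Sum>i\<in>UNIV. J (real_vec (g i)) x *\<^sub>R real_vec (f i))"
    "\<And>x. x = (\<Sum>i\<in>UNIV. J x (real_vec (f i)) *\<^sub>R real_vec (g i))"
    "\<And>i. i \<in> I \<Longrightarrow> f i \<in> N" "\<And>i. i \<notin> I \<Longrightarrow> g i \<in> Jperp N"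
proof -
  obtain f u I where B: "int_basis f u" and fI: "\<And>i. i \<in> I \<Longrightarrow> f i \<in> N"
    and N: "N = {x. \<forall>i. i \<notin> I \<longrightarrow> u i x = 0}"
    using pure_subgroup_basis [OF assms] by blast
  note D = int_basisD [OF B]
  have "\<exists>y. \<forall>x. u i x = J y x" for i
    using J_represents_int [of "u i"] D(1) by metis
  then obtain g where g: "\<And>i x. u i x = J (g i) x" by metis
  have 1: "x = (\<Sum>i\<in>UNIV. J (g i) x *s f i)" for x
    using D(2) [of x] by (simp add: g)
  have 2: "x = (\<Sum>i\<in>UNIV. J x (f i) *s g i)" for x
  proof (rule J_eqI)
    fix z
    have "J x z = J x (\<Sum>i\<in>UNIV. J (g i) z *s f i)" using 1 [of z] by simp
    also have "\<dots> = J (\<Sum>i\<in>UNIV. J x (f i) *s g i) z"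
      by (simp add: J_sum_left J_sum_right J_scale_left J_scale_right mult.commute)
    finally show "J x z = J (\<Sum>i\<in>UNIV. J x (f i) *s g i) z" .
  qed
  have 3: "x = (\<Sum>i\<in>UNIV. J (real_vec (g i)) x *\<^sub>R real_vec (f i))" for x
  proof (rule linear_eq_on_lattice [of "\<lambda>x. x"])
    show "linear (\<lambda>x. \<Sum>i\<in>UNIV. J (real_vec (g i)) x *\<^sub>R real_vec (f i))"
      by (auto intro!: linearI simp: J_add_right J_scaleR_right sum.distrib algebra_simps scaleR_sum_right)
    show "real_vec x = (\<Sum>i\<in>UNIV. J (real_vec (g i)) (real_vec x) *\<^sub>R real_vec (f i))" for x
      using arg_cong [OF 1 [of x], of real_vec] unfolding J_real_vec real_vec_sum real_vec_scale .
  qed (simp add: linear_iff)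
  have 4: "x = (\<Sum>i\<in>UNIV. J x (real_vec (f i)) *\<^sub>R real_vec (g i))" for x
  proof (rule linear_eq_on_lattice [of "\<lambda>x. x"])
    show "linear (\<lambda>x. \<Sum>i\<in>UNIV. J x (real_vec (f i)) *\<^sub>R real_vec (g i))"
      by (auto intro!: linearI simp: J_add_left J_scaleR_left sum.distrib algebra_simps scaleR_sum_right)
    show "real_vec x = (\<Sum>i\<in>UNIV. J (real_vec x) (real_vec (f i)) *\<^sub>R real_vec (g i))" for x
      using arg_cong [OF 2 [of x], of real_vec] unfolding J_real_vec real_vec_sum real_vec_scale .
  qed (simp add: linear_iff)
  have 5: "g i \<in> Jperp N" if "i \<notin> I" for i
    using that by (auto simp: Jperp_def N g)
  show ?thesis
    by (rule that [where f = f and g = g and I = I]) (fact 1 2 3 4 | erule fI 5)+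
qed

text \<open>For a vector of the double complement, the coefficient \<open>J (g i) y\<close> vanishes
  when \<open>i\<close> is outside \<open>I\<close>; what remains is a combination of the
  \<open>f i\<close> in \<open>N\<close>.\<close>

lemma Jperp_Jperp:
  fixes N :: "(int ^ ('n::finite + 'n)) set"
  assumes "pure_subgroup N" shows "Jperp (Jperp N) = N"
proof
  show "N \<subseteq> Jperp (Jperp N)" unfolding Jperp_def
    using J_antisym by (smt (verit) mem_Collect_eq subsetI)
  obtain f g :: "'n + 'n \<Rightarrow> int ^ ('n + 'n)" and I where x: "\<And>x. x = (\<Sum>i\<in>UNIV. J (g i) x *s f i)"
    and I: "\<And>i. i \<in> I \<Longrightarrow> f i \<in> N" "\<And>i. i \<notin> I \<Longrightarrow> g i \<in> Jperp N"
    by (rule pure_subgroup_dual_basis [OF assms]) (rule that; assumption)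
  show "Jperp (Jperp N) \<subseteq> N"
  proof
    fix y assume y: "y \<in> Jperp (Jperp N)"
    have "J (g i) y *s f i \<in> N" for i
      using y I J_antisym [of "g i" y] pure_subgroupD(1) [OF assms]
      by (cases "i \<in> I") (auto simp: Jperp_def intro: pure_subgroup_scale [OF assms])
    then show "y \<in> N" using pure_subgroup_sum [OF assms, of UNIV "\<lambda>i. J (g i) y *s f i"] by (subst x) simp
  qed
qed

text \<open>Here the expansion in the \<open>g i\<close> is used: for a vector orthogonal to
  \<open>N\<close> the coefficients of index in \<open>I\<close> vanish, and the other
  \<open>g i\<close> lie in \<open>Jperp N\<close>.\<close>

lemma JperpR_eq:
  fixes N :: "(int ^ ('n::finite + 'n)) set"
  assumes "pure_subgroup N" shows "JperpR N = WR (Jperp N)"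
proof
  show "WR (Jperp N) \<subseteq> JperpR N" unfolding WR_def
    by (rule span_minimal [OF _ subspace_JperpR]) (auto simp: real_vec_JperpR)
  obtain f g :: "'n + 'n \<Rightarrow> int ^ ('n + 'n)" and I where x: "\<And>x. x = (\<Sum>i\<in>UNIV. J x (real_vec (f i)) *\<^sub>R real_vec (g i))"
    and I: "\<And>i. i \<in> I \<Longrightarrow> f i \<in> N" "\<And>i. i \<notin> I \<Longrightarrow> g i \<in> Jperp N"
    by (rule pure_subgroup_dual_basis [OF assms]) (rule that; assumption)
  show "JperpR N \<subseteq> WR (Jperp N)"
  proof
    fix y assume y: "y \<in> JperpR N"
    have "J y (real_vec (f i)) *\<^sub>R real_vec (g i) \<in> WR (Jperp N)" for i
      using y I unfolding WR_def
      by (cases "i \<in> I") (auto simp: JperpR_def span_zero intro!: span_scale intro: span_base)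
    then show "y \<in> WR (Jperp N)" unfolding WR_def
      using span_sum [of UNIV "\<lambda>i. J y (real_vec (f i)) *\<^sub>R real_vec (g i)"] by (subst x) simp
  qed
qed

lemma WR_eq: "pure_subgroup N \<Longrightarrow> WR N = JperpR (Jperp N)"
  using JperpR_eq [OF pure_subgroup_Jperp, of N] by (simp add: Jperp_Jperp)

text \<open>The lattice points of \<open>JperpR N\<close> are \<open>Jperp N\<close>, whose
  complement is \<open>N\<close> by purity.\<close>

lemma JperpR_inject:
  assumes "pure_subgroup N" "pure_subgroup N'" "JperpR N = JperpR N'" shows "N = N'"
proof -
  have "Jperp N = Jperp N'"
    using assms(3) by (auto simp: real_vec_JperpR [symmetric])
  then show ?thesis using Jperp_Jperp assms(1,2) by metis
qed

section \<open>Isotropic subspaces in coordinates\<close>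

text \<open>Choosing a basis of the abstract lattice \<open>L\<close> amounts to choosing
  \<open>h\<close>; all statements about \<open>L\<close> are moved to integer vectors along
  it.\<close>

locale based_lattice = comm_group L
  for L :: "'a monoid" (structure) and h :: "int ^ 'k::finite \<Rightarrow> 'a" +
  assumes h_iso: "h \<in> iso std_lattice L"
begin

lemma h_closed [simp]: "h x \<in> carrier L"
  and h_add: "h (x + y) = h x \<otimes> h y"
  and h_inject [simp]: "h x = h y \<longleftrightarrow> x = y"
  and range_h: "range h = carrier L"
  using h_iso by (auto simp: iso_def hom_def std_lattice_def bij_betw_def inj_eq)

lemma h_zero [simp]: "h 0 = \<one>"
  using h_add [of 0 0] by (metis add_0 h_closed l_cancel_one')

lemma h_uminus: "h (- x) = inv (h x)"
  using h_add [of x "- x"] by (metis add.right_inverse h_closed h_zero inv_equality inv_comm)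

lemma h_pow: "h x [^] (n :: nat) = h (int n *s x)"
  by (induction n) (simp_all add: h_add vector_sadd_rdistrib m_comm)

lemma subgroup_h_iff:
  "subgroup (h ` H) L \<longleftrightarrow> 0 \<in> H \<and> (\<forall>x\<in>H. \<forall>y\<in>H. x + y \<in> H) \<and> (\<forall>x\<in>H. - x \<in> H)"
proof
  assume H: "subgroup (h ` H) L"
  have mem: "h x \<in> h ` H \<longleftrightarrow> x \<in> H" for x by auto
  have "h 0 \<in> h ` H" unfolding h_zero by (rule subgroup.one_closed [OF H])
  moreover have "h (x + y) \<in> h ` H" if "x \<in> H" "y \<in> H" for x y
    unfolding h_add by (intro subgroup.m_closed [OF H] imageI that)
  moreover have "h (- x) \<in> h ` H" if "x \<in> H" for x
    unfolding h_uminus by (intro subgroup.m_inv_closed [OF H] imageI that)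
  ultimately show "0 \<in> H \<and> (\<forall>x\<in>H. \<forall>y\<in>H. x + y \<in> H) \<and> (\<forall>x\<in>H. - x \<in> H)"
    unfolding mem by blast
next
  assume "0 \<in> H \<and> (\<forall>x\<in>H. \<forall>y\<in>H. x + y \<in> H) \<and> (\<forall>x\<in>H. - x \<in> H)"
  then show "subgroup (h ` H) L"
    by (intro subgroup.intro) (auto simp flip: h_zero h_add h_uminus)
qed

text \<open>\<open>is_free_abelian\<close> takes its generators from the type of the lattice itself,
  so the basis vectors \<open>h (f i)\<close> serve as generators and \<open>\<Phi>\<close> records
  the coordinates.\<close>

lemma is_free_abelian_coordinate_subgroup:
  assumes B: "int_basis f u"
  shows "is_free_abelian (L\<lparr>carrier := h ` {x. \<forall>i. i \<notin> I \<longrightarrow> u i x = 0}\<rparr>)"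
proof -
  note D = int_basisD [OF B]
  define H where "H = {x. \<forall>i. i \<notin> I \<longrightarrow> u i x = 0}"
  define \<Phi> where "\<Phi> x = (\<Sum>i\<in>I. Poly_Mapping.single (h (f i)) (u i x))" for x
  have f_inject: "f i = f j \<longleftrightarrow> i = j" for i j
    using D(3) by (metis zero_neq_one)
  have lookup: "Poly_Mapping.lookup (\<Phi> x) (h (f j)) = (if j \<in> I then u j x else 0)" for x j
    by (simp add: \<Phi>_def lookup_sum lookup_single when_def f_inject)
  have lookup_0: "Poly_Mapping.lookup (\<Phi> x) y = 0" if "y \<notin> h ` f ` I" for x y
    using that by (auto simp: \<Phi>_def lookup_sum lookup_single when_def intro!: sum.neutral)
  have add: "\<Phi> (x + y) = \<Phi> x + \<Phi> y" for x y
    by (simp add: \<Phi>_def D single_add sum.distrib)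
  have keys: "Poly_Mapping.keys (\<Phi> x) \<subseteq> h ` f ` I" for x
    using lookup_0 [of _ x] by (force simp: in_keys_iff)
  have "inj_on \<Phi> H"
  proof (rule inj_onI)
    fix x y assume xy: "x \<in> H" "y \<in> H" "\<Phi> x = \<Phi> y"
    then have "u i x = u i y" for i
      using lookup [of x i] lookup [of y i] by (cases "i \<in> I") (auto simp: H_def)
    then have "(\<Sum>i\<in>UNIV. u i x *s f i) = (\<Sum>i\<in>UNIV. u i y *s f i)" by simp
    then show "x = y" unfolding D .
  qed
  moreover have "\<exists>x\<in>H. \<Phi> x = c" if c: "Poly_Mapping.keys c \<subseteq> h ` f ` I" for c
  proof
    define x where "x = (\<Sum>i\<in>I. Poly_Mapping.lookup c (h (f i)) *s f i)"
    have ux: "u j x = (if j \<in> I then Poly_Mapping.lookup c (h (f j)) else 0)" for j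
      by (simp add: x_def D if_distrib [of "(*) _"] cong: if_cong)
    then show "x \<in> H" by (simp add: H_def)
    show "\<Phi> x = c"
    proof (rule poly_mapping_eqI)
      fix y show "Poly_Mapping.lookup (\<Phi> x) y = Poly_Mapping.lookup c y"
        using c lookup_0 [of y x] lookup [of x] ux
        by (cases "y \<in> h ` f ` I") (auto simp: in_keys_iff subset_iff)
    qed
  qed
  ultimately have bij: "bij_betw \<Phi> H {c. Poly_Mapping.keys c \<subseteq> h ` f ` I}"
    unfolding bij_betw_def using keys by blast
  have inv: "inv_into UNIV h (h x) = x" for x
    by (rule inv_into_f_f) (auto simp: inj_on_def)
  have "bij_betw (inv_into UNIV h) (h ` H) H"
    by (rule bij_betwI [where g = h]) (auto simp: inv)
  then have "bij_betw (\<Phi> \<circ> inv_into UNIV h) (h ` H) {c. Poly_Mapping.keys c \<subseteq> h ` f ` I}"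
    using bij by (rule bij_betw_trans)
  then have "\<Phi> \<circ> inv_into UNIV h \<in> iso (L\<lparr>carrier := h ` H\<rparr>) (free_Abelian_group (h ` f ` I))"
    using keys by (auto simp: iso_def hom_def free_Abelian_group_def inv add simp flip: h_add)
  then show ?thesis unfolding is_free_abelian_def is_iso_def H_def by blast
qed

text \<open>If \<open>W\<close> has a complement \<open>U\<close> and \<open>n *s x\<close> lies in
  \<open>W\<close>, the component \<open>u\<close> of \<open>x\<close> in \<open>U\<close> satisfies
  \<open>n *s u = 0\<close>, so \<open>u = 0\<close> because the lattice is torsion-free.
  Conversely, in a basis adapted to a pure \<open>W\<close> the remaining basis vectors span a
  complement.\<close>

lemma isotropic_iff:
  "isotropic L S (h ` W) \<longleftrightarrow> pure_subgroup W \<and> (\<forall>x\<in>W. \<forall>y\<in>W. S (h x) (h y) = 0)"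
proof (intro iffI conjI)
  assume iso: "isotropic L S (h ` W)"
  then show "\<forall>x\<in>W. \<forall>y\<in>W. S (h x) (h y) = 0" by (auto simp: isotropic_def)
  from iso obtain U' where "subgroup U' L" "h ` W \<inter> U' = {\<one>}" "h ` W <#> U' = carrier L"
    by (auto simp: isotropic_def)
  moreover from this obtain U where "U' = h ` U"
    using subgroup.subset [of U' L] range_h by (metis subset_imageE)
  ultimately have U: "subgroup (h ` U) L" "h ` W \<inter> h ` U = {\<one>}" "h ` W <#> h ` U = carrier L"
    by simp_all
  have W: "subgroup (h ` W) L" using iso by (simp add: isotropic_def)
  have scale: "n *s x \<in> H" if "subgroup (h ` H) L" "x \<in> H" for n x H
    using that unfolding subgroup_h_iff
    by (induction n rule: int_induct [where k = 0])
      (auto simp: vector_sadd_rdistrib vector_sub_rdistrib, metis add_uminus_conv_diff)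
  have "x \<in> W" if n: "n \<noteq> 0" and nx: "n *s x \<in> W" for n x
  proof -
    have "h x \<in> h ` W <#> h ` U" using U by simp
    then obtain w u where wu: "w \<in> W" "u \<in> U" "x = w + u"
      by (auto simp: set_mult_def simp flip: h_add)
    have "n *s u = n *s x + - (n *s w)" using wu by (simp add: vector_add_ldistrib)
    then have "n *s u \<in> W"
      using W nx scale [OF W wu(1), of n] by (metis subgroup_h_iff)
    then have "h (n *s u) \<in> h ` W \<inter> h ` U" using scale [OF U(1) wu(2)] by auto
    then have "h (n *s u) = h 0" unfolding U(2) h_zero by simp
    then have "n *s u = 0" unfolding h_inject .
    then have "u = 0" using n by (simp add: vec_eq_iff)
    then show ?thesis using wu by simp
  qed
  then show "pure_subgroup W" using W by (auto simp: pure_subgroup_def subgroup_h_iff)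
next
  assume *: "pure_subgroup W \<and> (\<forall>x\<in>W. \<forall>y\<in>W. S (h x) (h y) = 0)"
  then have "pure_subgroup W" by blast
  then obtain f u I where B: "int_basis f u" and W: "W = {x. \<forall>i. i \<notin> I \<longrightarrow> u i x = 0}"
    by (rule pure_subgroup_basis) (rule that; assumption)
  note D = int_basisD [OF B]
  have u_simps [simp]: "u i 0 = 0" "u i (- x) = - u i x" for i x
    using D(6) [of i 0 0] D(6) [of i 0 x] by simp_all
  \<comment> \<open>The double complement keeps the shape required by
    \<open>is_free_abelian_coordinate_subgroup\<close>; \<open>U\<close> is spanned by the
    \<open>f i\<close> with \<open>i\<close> outside \<open>I\<close>.\<close>
  define U where "U = {x. \<forall>i. i \<notin> - I \<longrightarrow> u i x = 0}"
  have "x = 0" if "x \<in> W" "x \<in> U" for x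
  proof -
    have "u i x = 0" for i using that by (cases "i \<in> I") (auto simp: W U_def)
    then have "(\<Sum>i\<in>UNIV. u i x *s f i) = 0" by simp
    then show ?thesis unfolding D .
  qed
  then have "h ` W \<inter> h ` U = {\<one>}"
    by (auto simp: W U_def simp flip: h_zero)
  moreover have "h x \<in> h ` W <#> h ` U" for x
  proof -
    let ?s = "\<lambda>A. \<Sum>i\<in>A. u i x *s f i"
    have "x = ?s I + ?s (- I)"
      using D(2) [of x] sum.union_disjoint [of I "- I" "\<lambda>i. u i x *s f i"] by (simp add: Compl_partition)
    moreover have "?s I \<in> W" "?s (- I) \<in> U"
      by (simp_all add: W U_def D if_distrib [of "(*) _"] cong: if_cong)
    ultimately show ?thesis unfolding set_mult_def by (metis (no_types, lifting) UN_I h_add imageI singletonI)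
  qed
  then have "h ` W <#> h ` U = carrier L"
    by (auto simp: set_mult_def) (metis (no_types, opaque_lifting) imageE range_h)
  moreover have "subgroup (h ` W) L" "subgroup (h ` U) L"
    unfolding subgroup_h_iff by (auto simp: W U_def D)
  moreover have "is_free_abelian (L\<lparr>carrier := h ` W\<rparr>)" "is_free_abelian (L\<lparr>carrier := h ` U\<rparr>)"
    unfolding W U_def by (rule is_free_abelian_coordinate_subgroup [OF B])+
  ultimately show "isotropic L S (h ` W)" using * unfolding isotropic_def by blast
qed

end

lemma based_lattice_std: "based_lattice std_lattice (\<lambda>x. x)"
proof -
  have "comm_group (std_lattice :: (int ^ 'k::finite) monoid)"
    by (rule comm_groupI) (auto simp: std_lattice_def add_ac intro: exI [of _ "- x" for x] add.right_inverse)
  then show ?thesis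
    by (simp add: based_lattice_def based_lattice_axioms_def iso_def hom_def bij_betw_def)
qed

definition isotropic_subspace :: "(int ^ ('n::finite + 'n)) set \<Rightarrow> bool" where
  "isotropic_subspace W \<longleftrightarrow> pure_subgroup W \<and> (\<forall>x\<in>W. \<forall>y\<in>W. J x y = 0)"

lemma isotropic_std_iff: "isotropic std_lattice J W \<longleftrightarrow> isotropic_subspace W"
  using based_lattice.isotropic_iff [OF based_lattice_std] by (simp add: isotropic_subspace_def)

section \<open>Real spans and symmetric forms\<close>

text \<open>This treats the two spaces with explicit carriers alike, the dual of \<open>WR W\<close>
  and \<open>real_ext L\<close>, as images of a real coordinate space. The map may have a kernel, as
  \<open>Jfun W\<close> does.\<close>

locale parametrized_space =
  fixes V :: "(real, 'v) module" and \<epsilon> :: "'b::real_vector \<Rightarrow> 'v"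
  assumes carrier_eq: "carrier V = range \<epsilon>"
    and add_eq: "\<epsilon> x \<oplus>\<^bsub>V\<^esub> \<epsilon> y = \<epsilon> (x + y)"
    and smult_eq: "c \<odot>\<^bsub>V\<^esub> \<epsilon> x = \<epsilon> (c *\<^sub>R x)"
    and zero_eq: "\<zero>\<^bsub>V\<^esub> = \<epsilon> 0"
begin

lemma abelian_monoid: "abelian_monoid V"
  by (rule abelian_monoidI) (auto simp: carrier_eq add_eq zero_eq add_ac)

lemma finsum_eq: "finite F \<Longrightarrow> (\<Oplus>\<^bsub>V\<^esub>x\<in>F. \<epsilon> (f x)) = \<epsilon> (sum f F)"
proof (induction F rule: finite_induct)
  case empty
  then show ?case using abelian_monoid.finsum_empty [OF abelian_monoid] by (simp add: zero_eq)
next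
  case (insert a F)
  then show ?case
    using abelian_monoid.finsum_insert [OF abelian_monoid, of F a "\<lambda>x. \<epsilon> (f x)"]
    by (simp add: carrier_eq add_eq Pi_def)
qed

lemma real_span_image:
  assumes inj: "inj_on \<epsilon> X"
  shows "real_span V (\<epsilon> ` X) = \<epsilon> ` span X"
proof
  have inv: "\<epsilon> (inv_into X \<epsilon> y) = y" "inv_into X \<epsilon> y \<in> X" if "y \<in> \<epsilon> ` X" for y
    using that by (auto simp: f_inv_into_f inv_into_into)
  have sum_eq: "(\<Oplus>\<^bsub>V\<^esub>y\<in>F. a y \<odot>\<^bsub>V\<^esub> y) = \<epsilon> (\<Sum>y\<in>F. a y *\<^sub>R inv_into X \<epsilon> y)"
    if F: "finite F" "F \<subseteq> \<epsilon> ` X" for a F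
  proof -
    have "a y \<odot>\<^bsub>V\<^esub> y = \<epsilon> (a y *\<^sub>R inv_into X \<epsilon> y)" if "y \<in> F" for y
      using smult_eq [of "a y" "inv_into X \<epsilon> y"] inv(1) that F by auto
    then have "(\<Oplus>\<^bsub>V\<^esub>y\<in>F. a y \<odot>\<^bsub>V\<^esub> y) = (\<Oplus>\<^bsub>V\<^esub>y\<in>F. \<epsilon> (a y *\<^sub>R inv_into X \<epsilon> y))"
      using abelian_monoid.finsum_cong' [OF abelian_monoid, of F F] by (auto simp: carrier_eq)
    then show ?thesis using finsum_eq F by simp
  qed
  show "real_span V (\<epsilon> ` X) \<subseteq> \<epsilon> ` span X"
    unfolding real_span_def
    by (auto simp: sum_eq intro!: imageI span_sum span_scale) (meson inv(2) span_base subset_iff)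
  show "\<epsilon> ` span X \<subseteq> real_span V (\<epsilon> ` X)"
  proof
    fix z assume "z \<in> \<epsilon> ` span X"
    then obtain t r where t: "finite t" "t \<subseteq> X" and z: "z = \<epsilon> (\<Sum>x\<in>t. r x *\<^sub>R x)"
      by (auto simp: span_explicit)
    define a where "a y = r (inv_into X \<epsilon> y)" for y
    have "(\<Sum>y\<in>\<epsilon> ` t. a y *\<^sub>R inv_into X \<epsilon> y) = (\<Sum>x\<in>t. r x *\<^sub>R x)"
      using t inj by (subst sum.reindex)
        (auto simp: a_def inv_into_f_f subset_iff inj_on_subset intro!: sum.cong)
    then have "z = (\<Oplus>\<^bsub>V\<^esub>y\<in>\<epsilon> ` t. a y \<odot>\<^bsub>V\<^esub> y)"
      using t by (simp add: sum_eq z image_mono)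
    then show "z \<in> real_span V (\<epsilon> ` X)"
      using t unfolding real_span_def by blast
  qed
qed

end

section \<open>Symmetric forms and their radicals\<close>

definition sym_form :: "('b::real_vector \<Rightarrow> 'b \<Rightarrow> real) \<Rightarrow> bool" where
  "sym_form q \<longleftrightarrow> (\<forall>x y. q x y = q y x) \<and> (\<forall>x y z. q (x + y) z = q x z + q y z) \<and>
     (\<forall>c x y. q (c *\<^sub>R x) y = c * q x y)"

definition radical :: "('b::real_vector \<Rightarrow> 'b \<Rightarrow> real) \<Rightarrow> 'b set" where
  "radical q = {x. \<forall>y. q x y = 0}"

lemma sym_formD:
  assumes "sym_form q"
  shows "q x y = q y x" "q (x + y) z = q x z + q y z" "q (c *\<^sub>R x) z = c * q x z"
    "q z (x + y) = q z x + q z y" "q z (c *\<^sub>R x) = c * q z x"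
    "q 0 z = 0" "q (x - y) z = q x z - q y z" "q z (x - y) = q z x - q z y"
proof -
  show *: "q x y = q y x" "q (x + y) z = q x z + q y z" "q (c *\<^sub>R x) z = c * q x z" for x y z c
    using assms unfolding sym_form_def by blast+
  show "q z (x + y) = q z x + q z y" "q z (c *\<^sub>R x) = c * q z x"
    using *(1) [of z] *(2,3) by simp_all
  show "q 0 z = 0" using *(3) [of 0 0 z] by simp
  show **: "q (x - y) z = q x z - q y z" for x y z
    using *(2) [of "x - y" y z] by simp
  show "q z (x - y) = q z x - q z y"
    using *(1) [of z] ** by simp
qed

lemma subspace_radical: "sym_form q \<Longrightarrow> subspace (radical q)"
  by (auto simp: subspace_def radical_def sym_formD(2,3,6))

lemma radical_iff_self:
  assumes q: "sym_form q" and nonneg: "\<And>x. 0 \<le> q x x"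
  shows "x \<in> radical q \<longleftrightarrow> q x x = 0"
proof
  assume x: "q x x = 0"
  have "q x y = 0" for y
  proof (rule ccontr)
    assume xy: "q x y \<noteq> 0"
    \<comment> \<open>For a null vector \<open>x\<close> the value at
      \<open>c *\<^sub>R x + y\<close> is \<open>2 * c * q x y + q y y\<close>; this
      \<open>c\<close> makes it -1.\<close>
    define c where "c = - (q y y + 1) / (2 * q x y)"
    have "q (c *\<^sub>R x + y) (c *\<^sub>R x + y) = 2 * c * q x y + q y y"
      using x sym_formD(1) [OF q, of y x] by (simp add: sym_formD(2-5) [OF q])
    also have "\<dots> = -1" using xy by (simp add: c_def field_simps)
    finally show False using nonneg [of "c *\<^sub>R x + y"] by simp
  qed
  then show "x \<in> radical q" by (simp add: radical_def)
qed (simp add: radical_def)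

section \<open>Forms on the dual of an isotropic subspace\<close>

definition Jfun :: "(int ^ ('n::finite + 'n)) set \<Rightarrow> real ^ ('n + 'n) \<Rightarrow> real ^ ('n + 'n) \<Rightarrow> real" where
  "Jfun W x = (\<lambda>w\<in>WR W. J x w)"

text \<open>For \<open>p = (W, T)\<close> this is the form \<open>Q_T\<close> in coordinates;
  \<open>Q_form p\<close> is the same form on cosets of formal sums.\<close>

definition pull_form :: "('n::finite + 'n) cone_point \<Rightarrow> real ^ ('n + 'n) \<Rightarrow> real ^ ('n + 'n) \<Rightarrow> real" where
  "pull_form p x y = snd p (Jfun (fst p) x) (Jfun (fst p) y)"

lemma subspace_WR: "subspace (WR W)"
  by (simp add: WR_def)

lemma Jfun_eq_iff: "Jfun W x = Jfun W y \<longleftrightarrow> x - y \<in> JperpR W"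
  by (simp add: Jfun_def JperpR_WR J_diff_left restrict_def fun_eq_iff) metis

lemma Jfun_closed: "Jfun W x \<in> carrier (dual_space W)"
  by (auto simp: dual_space_def Jfun_def J_add_right J_scaleR_right
      subspace_add [OF subspace_WR] subspace_scale [OF subspace_WR])

text \<open>A functional on the subspace \<open>WR W\<close> extends linearly to the whole space,
  where \<open>J\<close> represents it.\<close>

lemma Jfun_surj:
  assumes "\<phi> \<in> carrier (dual_space W)"
  obtains x where "\<phi> = Jfun W x"
proof -
  have add: "\<phi> (x + y) = \<phi> x + \<phi> y" if "x \<in> WR W" "y \<in> WR W" for x y
    using assms that by (auto simp: dual_space_def)
  have scale: "\<phi> (c *\<^sub>R x) = c * \<phi> x" if "x \<in> WR W" for c x
    using assms that by (auto simp: dual_space_def)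
  obtain B where B: "B \<subseteq> real_vec ` W" "independent B" "real_vec ` W \<subseteq> span B"
    using maximal_independent_subset by blast
  have spanB: "span B = WR W"
    unfolding WR_def using B by (metis span_mono span_span subset_antisym)
  obtain g where g: "linear g" "\<And>x. x \<in> B \<Longrightarrow> g x = \<phi> x"
    using linear_independent_extend [OF B(2), of \<phi>] by blast
  have eq: "g w = \<phi> w" if "w \<in> WR W" for w
  proof -
    have "w \<in> span B" using that spanB by simp
    then have "w \<in> WR W \<and> g w = \<phi> w"
    proof (induction rule: span_induct_alt)
      case base
      then show ?case
        using g(1) scale [of 0 0] subspace_0 [OF subspace_WR, of W] by (simp add: linear_0)
    next
      case (step c x y)
      moreover have "x \<in> WR W" using step(1) spanB span_base by blast
      ultimately show ?case
        using g
        by (simp add: linear_add linear_scale add scale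
            subspace_add [OF subspace_WR] subspace_scale [OF subspace_WR])
    qed
    then show ?thesis by simp
  qed
  obtain x where x: "\<And>w. g w = J x w"
    by (rule J_represents [of g])
      (use g(1) in \<open>auto simp: linear_add linear_scale scalar_mult_eq_scaleR\<close>)
  have "\<phi> = Jfun W x"
  proof
    fix w show "\<phi> w = Jfun W x w"
      using assms eq [of w] x [of w] by (cases "w \<in> WR W") (auto simp: Jfun_def dual_space_def)
  qed
  then show ?thesis by (rule that)
qed

lemma carrier_dual_space: "carrier (dual_space W) = range (Jfun W)"
  using Jfun_closed Jfun_surj by blast

lemma parametrized_dual_space: "parametrized_space (dual_space W) (Jfun W)"
proof
  show "carrier (dual_space W) = range (Jfun W)" by (rule carrier_dual_space)
qed (auto simp: dual_space_def Jfun_def J_add_left J_scaleR_left fun_eq_iff)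

lemma sym_form_pull_form:
  "sym_form (pull_form (W, T)) \<longleftrightarrow> sym_bilinear (dual_space W) T"
proof -
  interpret parametrized_space "dual_space W" "Jfun W" by (rule parametrized_dual_space)
  show ?thesis by (simp add: sym_form_def sym_bilinear_def carrier_eq pull_form_def add_eq smult_eq)
qed

lemma Sym2_iff:
  "T \<in> Sym2 W \<longleftrightarrow> T \<in> carrier (dual_space W) \<rightarrow>\<^sub>E (carrier (dual_space W) \<rightarrow>\<^sub>E UNIV) \<and>
     sym_form (pull_form (W, T))"
  by (simp add: Sym2_def sym_form_pull_form)

lemma pull_form_inject:
  assumes "T \<in> Sym2 W" "T' \<in> Sym2 W" "pull_form (W, T) = pull_form (W, T')"
  shows "T = T'"
proof
  fix \<phi> show "T \<phi> = T' \<phi>"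
  proof
    fix \<psi>
    have eq: "T (Jfun W x) (Jfun W y) = T' (Jfun W x) (Jfun W y)" for x y
      using assms(3) by (simp add: pull_form_def fun_eq_iff)
    show "T \<phi> \<psi> = T' \<phi> \<psi>"
    proof (cases "\<phi> \<in> carrier (dual_space W) \<and> \<psi> \<in> carrier (dual_space W)")
      case True
      then show ?thesis using eq by (auto simp: carrier_dual_space)
    next
      case False
      then show ?thesis using assms(1,2)
        by (cases "\<phi> \<in> carrier (dual_space W)") (auto simp: Sym2_def PiE_def Pi_def extensional_def)
    qed
  qed
qed

text \<open>The fibres of \<open>Jfun W\<close> are the cosets of \<open>JperpR W\<close>, on which
  \<open>q\<close> is constant in each argument; its values on arbitrary preimages
  \<open>s \<phi>\<close> therefore define \<open>T\<close>.\<close>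

lemma pull_form_surj:
  assumes q: "sym_form q" and rad: "JperpR W \<subseteq> radical q"
  obtains T where "T \<in> Sym2 W" "pull_form (W, T) = q"
proof -
  define s where "s \<phi> = (SOME x. \<phi> = Jfun W x)" for \<phi>
  define T where "T = (\<lambda>\<phi>\<in>carrier (dual_space W). \<lambda>\<psi>\<in>carrier (dual_space W). q (s \<phi>) (s \<psi>))"
  have s: "Jfun W (s (Jfun W x)) = Jfun W x" for x
    unfolding s_def using someI [of "\<lambda>y. Jfun W x = Jfun W y" x] by simp
  have q_cong: "q x y = q x' y'" if "Jfun W x = Jfun W x'" "Jfun W y = Jfun W y'" for x y x' y'
  proof -
    have "q (x - x') y = 0" "q (y - y') x' = 0"
      using that rad by (auto simp: Jfun_eq_iff radical_def)
    then show ?thesis using sym_formD(1,7) [OF q] by (metis eq_iff_diff_eq_0)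
  qed
  have pull: "pull_form (W, T) = q"
    by (rule ext, rule ext) (auto simp: pull_form_def T_def Jfun_closed intro!: q_cong s)
  moreover have "T \<in> Sym2 W"
    unfolding Sym2_iff pull using q by (auto simp: T_def)
  ultimately show ?thesis using that by blast
qed

lemma radical_pull_form:
  fixes W :: "(int ^ ('n::finite + 'n)) set"
  assumes "T \<in> PD W"
  shows "radical (pull_form (W, T)) = JperpR W"
proof -
  have q: "sym_form (pull_form (W, T))"
    using assms by (simp add: PD_def Sym2_iff)
  have zero: "\<zero>\<^bsub>dual_space W\<^esub> = Jfun W 0"
    by (rule parametrized_space.zero_eq [OF parametrized_dual_space])
  have pos: "0 < pull_form (W, T) x x" if "x \<notin> JperpR W" for x
    using that assms Jfun_eq_iff [of W x 0] Jfun_closed [of W x]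
    by (auto simp: PD_def pos_def_def zero pull_form_def)
  have "pull_form (W, T) x y = 0" if "x \<in> JperpR W" for x y
  proof -
    have "Jfun W x = Jfun W 0" using that by (simp add: Jfun_eq_iff)
    then have "pull_form (W, T) x y = pull_form (W, T) 0 y" by (simp add: pull_form_def)
    then show ?thesis using sym_formD(6) [OF q] by simp
  qed
  then show ?thesis using pos by (force simp: radical_def)
qed

lemma PD_nonneg:
  fixes W :: "(int ^ ('n::finite + 'n)) set"
  assumes "T \<in> PD W" shows "0 \<le> pull_form (W, T) x x"
proof (cases "x \<in> JperpR W")
  case True
  then have "x \<in> radical (pull_form (W, T))" by (simp only: radical_pull_form [OF assms])
  then show ?thesis by (simp add: radical_def)
next
  case False
  then show ?thesis
    using assms Jfun_eq_iff [of W x 0] Jfun_closed [of W x]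
      parametrized_space.zero_eq [OF parametrized_dual_space, of W]
    by (auto simp: PD_def pos_def_def pull_form_def less_imp_le)
qed

text \<open>These are the forms \<open>pull_form p\<close> with \<open>p\<close> in
  \<open>PD_union\<close> and also, in coordinates, the forms \<open>Q\<close> permitted in a
  tropical abelian variety.\<close>

definition tropical_form :: "(real ^ ('n::finite + 'n) \<Rightarrow> real ^ ('n + 'n) \<Rightarrow> real) \<Rightarrow> bool" where
  "tropical_form q \<longleftrightarrow> sym_form q \<and> (\<forall>x. 0 \<le> q x x) \<and>
     (\<exists>W. isotropic_subspace W \<and> radical q = JperpR W)"

lemma PD_exists:
  assumes "sym_form q" "\<And>x. 0 \<le> q x x" "radical q = JperpR W"
  obtains T where "T \<in> PD W" "pull_form (W, T) = q"
proof -
  obtain T where T: "T \<in> Sym2 W" "pull_form (W, T) = q"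
    using pull_form_surj assms(1,3) by (metis order_refl)
  have "0 < T \<phi> \<phi>" if \<phi>: "\<phi> \<in> carrier (dual_space W)" "\<phi> \<noteq> \<zero>\<^bsub>dual_space W\<^esub>" for \<phi>
  proof -
    obtain x where x: "\<phi> = Jfun W x" using Jfun_surj \<phi>(1) .
    then have "x \<notin> radical q"
      using \<phi>(2) Jfun_eq_iff [of W x 0] parametrized_space.zero_eq [OF parametrized_dual_space, of W]
      by (auto simp: assms(3))
    then have "q x x \<noteq> 0" using radical_iff_self assms(1,2) by blast
    then show ?thesis using assms(2) [of x] T(2) x by (auto simp: pull_form_def)
  qed
  then show ?thesis using T that by (auto simp: PD_def pos_def_def)
qed

lemma PD_union_iff: "(W, T) \<in> PD_union \<longleftrightarrow> isotropic_subspace W \<and> T \<in> PD W"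
  and PD_rt_union_iff: "(W, T) \<in> PD_rt_union \<longleftrightarrow> isotropic_subspace W \<and> T \<in> PD_rt W"
  by (auto simp: PD_union_def PD_rt_union_def isotropic_std_iff)

lemma tropical_form_PD_union: "p \<in> PD_union \<Longrightarrow> tropical_form (pull_form p)"
  by (cases p) (auto simp: PD_union_iff tropical_form_def PD_nonneg radical_pull_form
      PD_def Sym2_iff intro!: exI)

lemma PD_union_exists:
  assumes "tropical_form q" obtains p where "p \<in> PD_union" "pull_form p = q"
  using assms PD_exists unfolding tropical_form_def by (metis PD_union_iff)

lemma PD_subset_PD_rt: "PD W \<subseteq> PD_rt (W :: (int ^ ('n::finite + 'n)) set)"
proof
  fix T assume T: "T \<in> PD W"
  interpret parametrized_space "dual_space W" "Jfun W" by (rule parametrized_dual_space)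
  have "form_kernel (dual_space W) T = Jfun W ` radical (pull_form (W, T))"
    by (auto simp: form_kernel_def radical_def pull_form_def carrier_dual_space)
  also have "\<dots> = {Jfun W 0}"
    unfolding radical_pull_form [OF T] using Jfun_eq_iff [of W _ 0] subspace_0 [OF subspace_JperpR]
    by (auto simp: image_iff)
  \<comment> \<open>The zero kernel is rational because the empty set of lattice functionals spans
    it.\<close>
  also have "\<dots> = real_span (dual_space W) {}"
    using real_span_image [of "{}"] by simp
  finally have "form_kernel (dual_space W) T = real_span (dual_space W) {}" .
  moreover have "pos_semidef (dual_space W) T"
    using PD_nonneg [OF T] by (auto simp: pos_semidef_def carrier_dual_space pull_form_def)
  ultimately show "T \<in> PD_rt W" using T by (auto simp: PD_rt_def PD_def)
qed

lemma PD_union_subset: "PD_union \<subseteq> PD_rt_union"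
  using PD_subset_PD_rt by (auto simp: PD_union_def PD_rt_union_def)

lemma dual_lattice_integral:
  fixes W :: "(int ^ ('n::finite + 'n)) set"
  assumes W: "pure_subgroup W" and \<phi>: "\<phi> \<in> dual_lattice W"
  obtains y where "\<phi> = Jfun W (real_vec y)"
proof -
  obtain z where z: "\<phi> = Jfun W z"
    using \<phi> Jfun_surj by (metis (no_types, lifting) dual_lattice_def mem_Collect_eq)
  obtain f g :: "'n + 'n \<Rightarrow> int ^ ('n + 'n)" and I
    where x: "\<And>x. x = (\<Sum>i\<in>UNIV. J x (real_vec (f i)) *\<^sub>R real_vec (g i))"
    and I: "\<And>i. i \<in> I \<Longrightarrow> f i \<in> W" "\<And>i. i \<notin> I \<Longrightarrow> g i \<in> Jperp W"
    by (rule pure_subgroup_dual_basis [OF W]) (rule that; assumption)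
  \<comment> \<open>The floors only convert the coefficients, already known to be integral, to type
    \<open>int\<close>.\<close>
  define y where "y = (\<Sum>i\<in>I. \<lfloor>J z (real_vec (f i))\<rfloor> *s g i)"
  have "of_int \<lfloor>J z (real_vec (f i))\<rfloor> = J z (real_vec (f i))" if "i \<in> I" for i
  proof -
    have "real_vec (f i) \<in> WR W" using I(1) [OF that] by (simp add: WR_def span_base)
    then have "J z (real_vec (f i)) \<in> \<int>"
      using \<phi> I(1) [OF that] z by (auto simp: dual_lattice_def Jfun_def)
    then show ?thesis by simp
  qed
  then have y: "real_vec y = (\<Sum>i\<in>I. J z (real_vec (f i)) *\<^sub>R real_vec (g i))"
    unfolding y_def real_vec_sum real_vec_scale by (intro sum.cong) auto
  have "z - real_vec y = (\<Sum>i\<in>-I. J z (real_vec (f i)) *\<^sub>R real_vec (g i))"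
    unfolding y diff_eq_eq add.commute [of "sum _ (- I)"]
    by (subst sum.union_disjoint [symmetric]) (auto simp: Compl_partition x [of z, symmetric])
  moreover have "(\<Sum>i\<in>-I. J z (real_vec (f i)) *\<^sub>R real_vec (g i)) \<in> JperpR W"
    using I(2) by (intro subspace_sum subspace_scale subspace_JperpR) (auto simp: real_vec_JperpR)
  ultimately have "z - real_vec y \<in> JperpR W" by (simp only:)
  then show ?thesis using that z by (simp add: Jfun_eq_iff)
qed

text \<open>The integer vectors \<open>N\<close> in the radical span it, because the kernel of a form in \<open>PD_rt W\<close> is
  rational; hence the radical is the complement of the isotropic subspace \<open>Jperp N\<close>.\<close>

lemma PD_rt_radical:
  fixes W :: "(int ^ ('n::finite + 'n)) set"
  assumes W: "isotropic_subspace W" and T: "T \<in> PD_rt W"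
  obtains W0 where "W0 \<subseteq> W" "isotropic_subspace W0" "radical (pull_form (W, T)) = JperpR W0"
proof -
  have pure: "pure_subgroup W" using W by (simp add: isotropic_subspace_def)
  interpret parametrized_space "dual_space W" "Jfun W" by (rule parametrized_dual_space)
  define R where "R = radical (pull_form (W, T))"
  have q: "sym_form (pull_form (W, T))" using T by (simp add: PD_rt_def Sym2_iff)
  note R_sub = subspace_radical [OF q, folded R_def]
  obtain B where B: "B \<subseteq> dual_lattice W" and ker: "form_kernel (dual_space W) T = real_span (dual_space W) B"
    using T by (auto simp: PD_rt_def)
  have "\<exists>y. \<phi> = Jfun W (real_vec y)" if "\<phi> \<in> B" for \<phi>
    using dual_lattice_integral [OF pure] B that by blast
  then have "\<forall>\<phi>\<in>B. \<exists>y. \<phi> = Jfun W (real_vec y)" by blast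
  from bchoice [OF this] obtain s where s: "\<And>\<phi>. \<phi> \<in> B \<Longrightarrow> Jfun W (real_vec (s \<phi>)) = \<phi>"
    by metis
  \<comment> \<open>There is one integral preimage for each element of \<open>B\<close>, so
    \<open>Jfun W\<close> maps \<open>X\<close> bijectively to \<open>B\<close> and
    \<open>real_span_image\<close> applies.\<close>
  define X where "X = (\<lambda>\<phi>. real_vec (s \<phi>)) ` B"
  have "Jfun W ` X = B" using s by (force simp: X_def)
  moreover have "inj_on (Jfun W) X" unfolding X_def by (rule inj_onI) (auto simp: s)
  ultimately have ker': "form_kernel (dual_space W) T = Jfun W ` span X"
    using real_span_image ker by metis
  have R_iff: "x \<in> R \<longleftrightarrow> Jfun W x \<in> Jfun W ` span X" for x
    unfolding ker' [symmetric]
    by (auto simp: R_def form_kernel_def radical_def pull_form_def carrier_dual_space)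
  define N where "N = {y. real_vec y \<in> R}"
  have N: "pure_subgroup N"
    unfolding pure_subgroup_def
  proof (intro conjI ballI allI impI)
    show "0 \<in> N" using subspace_0 [OF R_sub] by (simp add: N_def)
    show "x + y \<in> N" if "x \<in> N" "y \<in> N" for x y
      using that subspace_add [OF R_sub] by (simp add: N_def real_vec_add)
    fix n x assume n: "n \<noteq> 0" "n *s x \<in> N"
    then show "x \<in> N"
      using subspace_scale [OF R_sub, of "of_int n *\<^sub>R real_vec x" "1 / of_int n"]
      by (simp add: N_def real_vec_scale)
  qed
  have perp: "JperpR W \<subseteq> R"
    unfolding R_iff subset_iff
    using Jfun_eq_iff [of W _ 0] span_zero [of X] by (metis diff_zero imageI)
  have "R = WR N"
  proof
    show "WR N \<subseteq> R" unfolding WR_def using R_sub by (intro span_minimal) (auto simp: N_def)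
    show "R \<subseteq> WR N"
    proof
      fix x assume "x \<in> R"
      \<comment> \<open>The two summands of \<open>x = v + (x - v)\<close> are treated apart:
        \<open>X\<close> consists of lattice vectors in the radical, and \<open>JperpR W\<close> is
        spanned by \<open>Jperp W\<close>, a subset of \<open>N\<close>.\<close>
      then obtain v where v: "v \<in> span X" "x - v \<in> JperpR W"
        unfolding R_iff by (auto simp: Jfun_eq_iff)
      have "X \<subseteq> real_vec ` N"
        unfolding X_def N_def using s by (auto simp: R_iff X_def intro!: imageI span_base)
      then have "v \<in> WR N" using v(1) span_mono unfolding WR_def by blast
      moreover have "Jperp W \<subseteq> N"
        using perp by (auto simp: N_def real_vec_JperpR [symmetric])
      then have "x - v \<in> WR N"
        using v(2) unfolding JperpR_eq [OF pure] WR_def by (meson image_mono span_mono subsetD)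
      ultimately show "x \<in> WR N" using subspace_add [OF subspace_WR] by (metis diff_add_cancel add.commute)
    qed
  qed
  then have rad: "R = JperpR (Jperp N)" by (simp add: WR_eq [OF N])
  have "Jperp W \<subseteq> N"
    using perp by (auto simp: N_def real_vec_JperpR [symmetric])
  then have "Jperp N \<subseteq> Jperp (Jperp W)" by (auto simp: Jperp_def)
  then have sub: "Jperp N \<subseteq> W" by (simp add: Jperp_Jperp [OF pure])
  then have "isotropic_subspace (Jperp N)"
    using W pure_subgroup_Jperp by (auto simp: isotropic_subspace_def)
  then show ?thesis using that sub rad by (simp add: R_def)
qed

section \<open>The congruence subgroup\<close>

lemma real_mat_vec: "real_mat A *v real_vec x = real_vec (A *v x)"
  by (simp add: real_mat_def real_vec_def matrix_vector_mult_def vec_eq_iff)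

lemma real_mat_mult: "real_mat (A ** B) = real_mat A ** real_mat B"
  by (simp add: real_mat_def matrix_matrix_mult_def vec_eq_iff)

lemma real_mat_1 [simp]: "real_mat (mat 1) = mat 1"
  by (simp add: real_mat_def mat_def vec_eq_iff)

lemma real_mat_inject [simp]: "real_mat A = real_mat B \<longleftrightarrow> A = B"
  by (simp add: real_mat_def vec_eq_iff)

lemma linear_eq_on_lattice2:
  fixes F G :: "real ^ 'k::finite \<Rightarrow> real ^ 'k \<Rightarrow> 'b::real_vector"
  assumes "\<And>y. linear (\<lambda>x. F x y)" "\<And>y. linear (\<lambda>x. G x y)" "\<And>x. linear (F x)" "\<And>x. linear (G x)"
    and eq: "\<And>x y. F (real_vec x) (real_vec y) = G (real_vec x) (real_vec y)"
  shows "F x y = G x y"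
  by (rule linear_eq_on_lattice [of "\<lambda>x. F x y" "\<lambda>x. G x y"], (rule assms)+,
      rule linear_eq_on_lattice [of "F _"], (rule assms)+)

lemma J_real_mat:
  assumes "A \<in> Sp"
  shows "J (real_mat A *v x) (real_mat A *v y) = J x y"
proof (rule linear_eq_on_lattice2 [where F = "\<lambda>x y. J (real_mat A *v x) (real_mat A *v y)"])
  show "J (real_mat A *v real_vec x) (real_mat A *v real_vec y) = J (real_vec x) (real_vec y)" for x y
    using assms by (simp add: real_mat_vec J_real_vec Sp_def)
qed (auto intro!: linearI simp: J_add_left J_add_right J_scaleR_left J_scaleR_right
    matrix_vector_right_distrib matrix_vector_mult_scaleR)

lemma Gamma_iff:
  "A \<in> Gamma m \<longleftrightarrow> A \<in> Sp \<and> (\<forall>x i. [(A *v x) $ i = x $ i] (mod int m))"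
proof -
  have "[(A *v x) $ i = x $ i] (mod int m)"
    if "\<forall>i j. [A $ i $ j = mat 1 $ i $ j] (mod int m)" for x :: "int ^ ('a + 'a)" and i
  proof -
    have "[(A *v x) $ i = (mat 1 *v x) $ i] (mod int m)"
      unfolding matrix_vector_mult_def using that
      by (auto intro!: cong_sum cong_mult)
    then show ?thesis by simp
  qed
  moreover have "[A $ i $ j = mat 1 $ i $ j] (mod int m)"
    if "\<forall>x i. [(A *v x) $ i = x $ i] (mod int m)" for i j
  proof -
    have "(A *v axis j 1) $ i = A $ i $ j"
      by (simp add: matrix_vector_mult_def axis_def if_distrib [of "(*) _"] cong: if_cong)
    then show ?thesis
      using that [rule_format, of "axis j 1" i] by (simp add: axis_def mat_def)
  qed
  ultimately show ?thesis unfolding Gamma_def by blast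
qed

lemma matrix_vector_mult_scale:
  fixes A :: "'a::comm_semiring_1 ^ 'k::finite ^ 'l"
  shows "A *v (c *s x) = c *s (A *v x)"
  by (simp add: matrix_vector_mult_def vec_eq_iff sum_distrib_left mult_ac)

lemma additive_matrix:
  fixes a :: "int ^ 'k::finite \<Rightarrow> int ^ 'k"
  assumes add: "\<And>x y. a (x + y) = a x + a y"
  obtains A where "\<And>x. A *v x = a x"
proof
  define A where "A = (\<chi> i j. a (axis j 1) $ i)"
  fix x
  have scale: "a (c *s x) = c *s a x" for c x
    using additive_int_scale [of "\<lambda>x. a x $ _"] add by (simp add: vec_eq_iff)
  have "a x = a (\<Sum>j\<in>UNIV. x $ j *s axis j 1)" by (simp add: basis_expansion)
  also have "\<dots> = A *v x"
    by (simp add: additive_int_simps(4) [of a, OF add] scale A_def matrix_vector_mult_def vec_eq_iff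
        mult.commute)
  finally show "A *v x = a x" by simp
qed

lemma Gamma_one: "mat 1 \<in> Gamma m"
  by (simp add: Gamma_def Sp_def)

lemma Gamma_mult: "A \<in> Gamma m \<Longrightarrow> B \<in> Gamma m \<Longrightarrow> A ** B \<in> Gamma m"
  unfolding Gamma_iff Sp_def by (simp flip: matrix_vector_mul_assoc) (meson cong_trans)

text \<open>The inverse of a symplectic matrix is its adjoint with respect to \<open>J\<close>, hence integral.\<close>

lemma Gamma_inverse:
  assumes A: "A \<in> Gamma m"
  obtains B where "B \<in> Gamma m" "A ** B = mat 1" "B ** A = mat 1"
proof -
  have J_A: "J (A *v x) (A *v y) = J x y" for x y
    using A by (simp add: Gamma_def Sp_def)
  have "\<exists>z. \<forall>x. J (A *v x) y = J x z" for y
  proof -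
    obtain z where "\<And>x. J (A *v x) y = J z x"
      by (rule J_represents_int [of "\<lambda>x. J (A *v x) y"])
        (auto simp: matrix_vector_right_distrib J_add_left)
    then have "J (A *v x) y = J x (- z)" for x
      using J_antisym [of x z] by (simp add: J_minus_right)
    then show ?thesis by blast
  qed
  then obtain a where a: "\<And>x y. J (A *v x) y = J x (a y)" by metis
  have eqI: "x = y" if "\<And>z. J z x = J z y" for x y :: "int ^ ('a + 'a)"
    using J_eqI [of x y] that J_antisym by metis
  obtain B where B: "\<And>x. B *v x = a x"
    by (rule additive_matrix [of a]) (auto intro!: eqI simp: J_add_right simp flip: a)
  have "B *v (A *v x) = x" for x
    unfolding B by (rule eqI) (simp add: J_A flip: a)
  then have BA: "B ** A = mat 1"
    by (simp add: matrix_eq flip: matrix_vector_mul_assoc)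
  \<comment> \<open>A one-sided inverse of a square real matrix is two-sided, and injectivity of
    \<open>real_mat\<close> brings the identity back to the integers.\<close>
  then have "real_mat B ** real_mat A = mat 1" by (simp flip: real_mat_mult)
  then have "real_mat A ** real_mat B = mat 1" by (simp add: matrix_left_right_inverse)
  then have AB: "A ** B = mat 1" by (simp flip: real_mat_mult real_mat_1)
  then have A_B: "A *v (B *v x) = x" for x by (simp add: matrix_vector_mul_assoc)
  have "J (B *v x) (B *v y) = J x y" for x y
    using J_A [of "B *v x" "B *v y"] by (simp add: A_B)
  moreover have "[(B *v x) $ i = x $ i] (mod int m)" for x i
    using A A_B [of x] unfolding Gamma_iff by (metis cong_sym)
  ultimately have "B \<in> Gamma m" by (auto simp: Gamma_iff Sp_def)
  then show ?thesis using that AB BA by blast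
qed

section \<open>The equivalence relation on cone points\<close>

definition Gamma_equiv ::
    "nat \<Rightarrow> (real ^ ('n::finite + 'n) \<Rightarrow> real ^ ('n + 'n) \<Rightarrow> real) \<Rightarrow>
      (real ^ ('n + 'n) \<Rightarrow> real ^ ('n + 'n) \<Rightarrow> real) \<Rightarrow> bool" where
  "Gamma_equiv m q q' \<longleftrightarrow>
     (\<exists>A\<in>Gamma m. \<forall>x y. q' (real_mat A *v x) (real_mat A *v y) = q x y)"

lemma Gamma_equiv_refl: "Gamma_equiv m q q"
  using Gamma_one by (force simp: Gamma_equiv_def)

lemma Gamma_equiv_sym:
  assumes "Gamma_equiv m q q'" shows "Gamma_equiv m q' q"
proof -
  obtain A where A: "A \<in> Gamma m" "\<And>x y. q' (real_mat A *v x) (real_mat A *v y) = q x y"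
    using assms by (auto simp: Gamma_equiv_def)
  obtain B where B: "B \<in> Gamma m" "A ** B = mat 1" by (rule Gamma_inverse [OF A(1)])
  have "real_mat A *v (real_mat B *v x) = x" for x
    by (simp add: matrix_vector_mul_assoc B flip: real_mat_mult)
  then show ?thesis using A(2) [of "real_mat B *v _" "real_mat B *v _"] B(1)
    unfolding Gamma_equiv_def by metis
qed

lemma Gamma_equiv_trans:
  assumes "Gamma_equiv m q q'" "Gamma_equiv m q' q''" shows "Gamma_equiv m q q''"
proof -
  obtain A where A: "A \<in> Gamma m" "\<And>x y. q' (real_mat A *v x) (real_mat A *v y) = q x y"
    using assms(1) by (auto simp: Gamma_equiv_def)
  obtain B where B: "B \<in> Gamma m" "\<And>x y. q'' (real_mat B *v x) (real_mat B *v y) = q' x y"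
    using assms(2) by (auto simp: Gamma_equiv_def)
  have "q'' (real_mat (B ** A) *v x) (real_mat (B ** A) *v y) = q x y" for x y
    by (simp add: real_mat_mult A B flip: matrix_vector_mul_assoc)
  then show ?thesis using Gamma_mult [OF B(1) A(1)] unfolding Gamma_equiv_def by blast
qed

text \<open>Since \<open>A\<close> preserves \<open>J\<close>, the functional represented by
  \<open>A x\<close> pulls back along \<open>A\<close> to the one represented by \<open>x\<close>.
  On pulled-back forms the push-forward is thus a mere change of variables, whatever the target
  \<open>W'\<close>.\<close>

lemma pull_form_push_form:
  assumes A: "A \<in> Gamma m" and sub: "(*v) A ` W \<subseteq> W'"
  shows "pull_form (W', push_form A W W' T) (real_mat A *v x) (real_mat A *v y) = pull_form (W, T) x y"
proof -
  have img: "real_mat A *v w \<in> WR W'" if "w \<in> WR W" for w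
    using that unfolding WR_def
  proof (induction rule: span_induct_alt)
    case (step c v w)
    then obtain u where "u \<in> W" "v = real_vec u" by auto
    then show ?case
      using sub step unfolding matrix_vector_right_distrib matrix_vector_mult_scaleR
      by (auto intro!: span_add span_scale simp: real_mat_vec intro: span_base)
  qed (simp add: span_zero)
  have "pull_dual A W (Jfun W' (real_mat A *v x)) = Jfun W x" for x
    using img J_real_mat [of A x] A
    by (auto simp: pull_dual_def Jfun_def Gamma_def restrict_def fun_eq_iff)
  then show ?thesis by (simp add: pull_form_def push_form_def Jfun_closed)
qed

lemma push_form_Sym2:
  assumes A: "A \<in> Gamma m" and sub: "(*v) A ` W \<subseteq> W'" and T: "T \<in> Sym2 W"
  shows "push_form A W W' T \<in> Sym2 W'"
proof -
  obtain B where B: "A ** B = mat 1" by (rule Gamma_inverse [OF A])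
  have AB: "real_mat A *v (real_mat B *v x) = x" for x
    by (simp add: matrix_vector_mul_assoc B flip: real_mat_mult)
  have "pull_form (W', push_form A W W' T) x y = pull_form (W, T) (real_mat B *v x) (real_mat B *v y)" for x y
    using pull_form_push_form [OF A sub, of T "real_mat B *v x" "real_mat B *v y"] by (simp add: AB)
  moreover have "sym_form (pull_form (W, T))" using T by (simp add: Sym2_iff)
  ultimately have "sym_form (pull_form (W', push_form A W W' T))"
    unfolding sym_form_def
    by (simp add: sym_formD(2,3) matrix_vector_right_distrib matrix_vector_mult_scaleR)
      (metis sym_formD(1))
  then show ?thesis by (auto simp: Sym2_iff push_form_def)
qed

lemma trop_step_Gamma_equiv:
  "trop_step m p q \<Longrightarrow> Gamma_equiv m (pull_form p) (pull_form q)"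
  unfolding trop_step_def Gamma_equiv_def
  by (cases p, cases q) (auto intro!: bexI pull_form_push_form)

lemma equivclp_Gamma_equiv:
  "equivclp (trop_step m) p q \<Longrightarrow> Gamma_equiv m (pull_form p) (pull_form q)"
proof (induction rule: equivclp_induct)
  case base
  show ?case by (rule Gamma_equiv_refl)
next
  case (step y z)
  then show ?case
    using trop_step_Gamma_equiv Gamma_equiv_sym Gamma_equiv_trans by blast
qed

text \<open>The radical of the form of \<open>p\<close> is \<open>JperpR W0\<close>, so the form
  descends to a definite one on the dual of \<open>W0\<close>. The step back to \<open>p\<close> is
  the inclusion of \<open>W0\<close> in \<open>W\<close>, realized by \<open>mat 1\<close>;
  injectivity of \<open>pull_form\<close> shows that it ends at the given point.\<close>

lemma trop_step_from_PD:
  assumes "p \<in> PD_rt_union"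
  obtains p0 where "p0 \<in> PD_union" "trop_step m p0 p" "pull_form p0 = pull_form p"
proof -
  obtain W T where p: "p = (W, T)" "isotropic_subspace W" "T \<in> PD_rt W"
    using assms by (cases p) (auto simp: PD_rt_union_iff)
  then have T: "T \<in> Sym2 W" by (simp add: PD_rt_def)
  obtain W0 where W0: "W0 \<subseteq> W" "isotropic_subspace W0" "radical (pull_form (W, T)) = JperpR W0"
    using PD_rt_radical p(2,3) .
  have "0 \<le> pull_form (W, T) x x" for x
    using p(3) by (auto simp: PD_rt_def pos_semidef_def pull_form_def Jfun_closed)
  then obtain T0 where T0: "T0 \<in> PD W0" "pull_form (W0, T0) = pull_form (W, T)"
    using PD_exists [OF _ _ W0(3)] T by (metis Sym2_iff)
  have sub: "(*v) (mat 1) ` W0 \<subseteq> W" using W0(1) by auto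
  have "T0 \<in> Sym2 W0" using T0 by (simp add: PD_def)
  then have "T = push_form (mat 1) W0 W T0"
    using push_form_Sym2 [OF Gamma_one sub] pull_form_push_form [OF Gamma_one sub, of T0] T T0
    by (intro pull_form_inject) (auto simp: fun_eq_iff)
  then have "trop_step m (W0, T0) (W, T)"
    using W0(2) T0(1) p(2) PD_subset_PD_rt sub
    by (auto simp: trop_step_def PD_rt_union_iff isotropic_std_iff intro!: bexI [OF _ Gamma_one])
  then show ?thesis using that [of "(W0, T0)"] W0 T0 p by (simp add: PD_union_iff)
qed

text \<open>\<open>A\<close> carries one radical to the other. These are \<open>JperpR W\<close> and
  \<open>JperpR W'\<close>, so purity forces the image of \<open>W\<close> under \<open>A\<close> to
  be \<open>W'\<close>, and a single step suffices.\<close>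

lemma trop_step_PD_union:
  assumes p: "p \<in> PD_union" and q: "q \<in> PD_union" and "Gamma_equiv m (pull_form p) (pull_form q)"
  shows "trop_step m p q"
proof -
  obtain W T W' T' where WT: "p = (W, T)" "q = (W', T')" by (cases p, cases q)
  have W: "isotropic_subspace W" "T \<in> PD W" "isotropic_subspace W'" "T' \<in> PD W'"
    using p q by (auto simp: WT PD_union_iff)
  obtain A where A: "A \<in> Gamma m"
    and eq: "\<And>x y. pull_form (W', T') (real_mat A *v x) (real_mat A *v y) = pull_form (W, T) x y"
    using assms(3) by (auto simp: WT Gamma_equiv_def)
  obtain B where B: "B \<in> Gamma m" "A ** B = mat 1" "B ** A = mat 1" by (rule Gamma_inverse [OF A])
  have AB [simp]: "real_mat A *v (real_mat B *v x) = x" "A *v (B *v y) = y" "B *v (A *v y) = y" for x y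
    by (simp_all add: matrix_vector_mul_assoc B flip: real_mat_mult)
  have surj: "(\<forall>y. P (real_mat A *v y)) \<longleftrightarrow> (\<forall>y. P y)" for P
    using AB(1) by metis
  have "pure_subgroup ((*v) A ` W)"
  proof -
    have "(*v) A ` W = {x. B *v x \<in> W}" by (force simp: image_iff)
    then show ?thesis using W(1)
      by (auto simp: isotropic_subspace_def pure_subgroup_def matrix_vector_right_distrib
          matrix_vector_mult_scale)
  qed
  moreover have "JperpR ((*v) A ` W) = JperpR W'"
  proof -
    have "x \<in> JperpR ((*v) A ` W) \<longleftrightarrow> x \<in> JperpR W'" for x
    proof -
      have "x \<in> JperpR ((*v) A ` W) \<longleftrightarrow> real_mat B *v x \<in> JperpR W"
      proof -
        have "J x (real_vec (A *v w)) = J (real_mat B *v x) (real_vec w)" for w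
          using J_real_mat [of A "real_mat B *v x" "real_vec w"] A
          by (simp add: real_mat_vec Gamma_def)
        then show ?thesis by (simp add: JperpR_def)
      qed
      also have "\<dots> \<longleftrightarrow> real_mat B *v x \<in> radical (pull_form (W, T))"
        by (simp add: radical_pull_form [OF W(2)])
      also have "\<dots> \<longleftrightarrow> (\<forall>y. pull_form (W', T') x (real_mat A *v y) = 0)"
        by (simp add: radical_def flip: eq)
      also have "\<dots> \<longleftrightarrow> x \<in> radical (pull_form (W', T'))"
        using surj [of "\<lambda>z. pull_form (W', T') x z = 0"] by (simp add: radical_def)
      finally show ?thesis by (simp add: radical_pull_form [OF W(4)])
    qed
    then show ?thesis by blast
  qed
  ultimately have img: "(*v) A ` W = W'"
    using W(3) JperpR_inject unfolding isotropic_subspace_def by blast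
  then have sub: "(*v) A ` W \<subseteq> W'" by simp
  have Sym: "T \<in> Sym2 W" "T' \<in> Sym2 W'" using W by (auto simp: PD_def)
  have "pull_form (W', T') x y = pull_form (W', push_form A W W' T) x y" for x y
    using eq [of "real_mat B *v x" "real_mat B *v y"]
      pull_form_push_form [OF A sub, of T "real_mat B *v x" "real_mat B *v y"] by simp
  then have "T' = push_form A W W' T"
    using push_form_Sym2 [OF A sub Sym(1)] Sym(2) by (intro pull_form_inject) (auto simp: fun_eq_iff)
  then show ?thesis
    using W A sub PD_subset_PD_rt
    by (auto simp: WT trop_step_def PD_rt_union_iff isotropic_std_iff)
qed

lemma trop_rel_iff:
  assumes p: "p \<in> PD_rt_union" and q: "q \<in> PD_rt_union"
  shows "(p, q) \<in> trop_rel m \<longleftrightarrow> Gamma_equiv m (pull_form p) (pull_form q)"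
proof
  assume *: "Gamma_equiv m (pull_form p) (pull_form q)"
  obtain p0 where p0: "p0 \<in> PD_union" "trop_step m p0 p" "pull_form p0 = pull_form p"
    using trop_step_from_PD [OF p] .
  obtain q0 where q0: "q0 \<in> PD_union" "trop_step m q0 q" "pull_form q0 = pull_form q"
    using trop_step_from_PD [OF q] .
  have "trop_step m p0 q0" using trop_step_PD_union p0 q0 * by metis
  then have "equivclp (trop_step m) p q"
    using p0(2) q0(2) by (meson equivclp_sym equivclp_trans r_into_equivclp)
  then show "(p, q) \<in> trop_rel m" using p q by (simp add: trop_rel_def)
qed (simp add: trop_rel_def equivclp_Gamma_equiv)

lemma trop_rel_equiv: "equiv PD_rt_union (trop_rel m)"
  unfolding equiv_def refl_on_def sym_def trans_def trop_rel_def
  by (auto intro: equivclp_sym equivclp_trans)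

section \<open>Unimodular integer matrices\<close>

lemma prod_UNIV_sum:
  fixes f :: "'n::finite + 'm::finite \<Rightarrow> 'a::comm_monoid_mult"
  shows "prod f UNIV = (\<Prod>i\<in>UNIV. f (Inl i)) * (\<Prod>i\<in>UNIV. f (Inr i))"
proof -
  have "prod f UNIV = prod f (range Inl) * prod f (range Inr)"
    unfolding UNIV_sum by (intro prod.union_disjoint) auto
  then show ?thesis by (simp add: prod.reindex)
qed

text \<open>The parameter \<open>F\<close> allows the sign to be computed by induction, one
  transposition per element.\<close>

definition swap_on :: "'n set \<Rightarrow> 'n + 'n \<Rightarrow> 'n + 'n" where
  "swap_on F k = (case k of Inl i \<Rightarrow> if i \<in> F then Inr i else Inl i
    | Inr i \<Rightarrow> if i \<in> F then Inl i else Inr i)"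

lemma swap_on_permutation:
  assumes "finite F" shows "permutation (swap_on F) \<and> sign (swap_on F) = (- 1) ^ card F"
  using assms
proof (induction F rule: finite_induct)
  case empty
  have "swap_on {} = (id :: 'a + 'a \<Rightarrow> 'a + 'a)"
    by (auto simp: swap_on_def fun_eq_iff split: sum.split)
  then show ?case by (simp add: permutation_id)
next
  case (insert a F)
  let ?t = "Transposition.transpose (Inl a) (Inr a) :: 'a + 'a \<Rightarrow> 'a + 'a"
  have eq: "swap_on (insert a F) = ?t \<circ> swap_on F"
    using insert.hyps by (auto simp: swap_on_def fun_eq_iff Transposition.transpose_def split: sum.split)
  have t: "permutation ?t" by (rule permutation_swap_id)
  have "sign (?t \<circ> swap_on F) = sign ?t * sign (swap_on F)"
    using t insert.IH by (blast intro: sign_compose)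
  moreover have "sign ?t = - 1" by (simp add: sign_swap_id)
  ultimately have "sign (swap_on (insert a F)) = (- 1) ^ card (insert a F)"
    unfolding eq using insert by simp
  then show ?case using t insert.IH permutation_compose unfolding eq by blast
qed

lemma axis_component: "axis i x $ j = (if j = i then x else 0)"
  by (simp add: axis_def)

lemma J_axis:
  "J (axis a 1) (axis b (1 :: 'r::comm_ring_1)) =
    (case (a, b) of (Inl i, Inr j) \<Rightarrow> if i = j then 1 else 0
      | (Inr i, Inl j) \<Rightarrow> if i = j then - 1 else 0 | _ \<Rightarrow> 0)"
  by (cases a; cases b) (auto simp: J_axis_Inl J_axis_Inr axis_component)

text \<open>Only \<open>swap_on UNIV\<close> contributes to the Leibniz sum. Its sign and its
  product of entries are both \<open>(- 1) ^ CARD('n)\<close> and cancel.\<close>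

lemma det_J: "det (\<chi> a b. J (axis a 1) (axis b 1) :: int ^ ('n::finite + 'n) ^ ('n + 'n)) = 1"
proof -
  define A :: "int ^ ('n + 'n) ^ ('n + 'n)" where "A = (\<chi> a b. J (axis a 1) (axis b 1))"
  define s where "s = (swap_on UNIV :: 'n + 'n \<Rightarrow> 'n + 'n)"
  have s: "permutation s" "sign s = (- 1) ^ CARD('n)"
    unfolding s_def using swap_on_permutation [of "UNIV :: 'n set"] by simp_all
  have s_simps: "s (Inl i) = Inr i" "s (Inr i) = Inl i" for i
    by (simp_all add: s_def swap_on_def)
  have prod_s: "(\<Prod>a\<in>UNIV. A $ a $ s a) = (- 1) ^ CARD('n)"
    by (simp add: prod_UNIV_sum A_def s_simps J_axis)
  have prod_0: "(\<Prod>a\<in>UNIV. A $ a $ p a) = 0" if "p \<noteq> s" for p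
  proof -
    obtain a where "p a \<noteq> s a" using \<open>p \<noteq> s\<close> by auto
    then have "A $ a $ p a = 0"
      by (cases a; cases "p a") (auto simp: A_def J_axis s_simps)
    then show ?thesis by (metis UNIV_I finite prod_zero)
  qed
  have "det A = (\<Sum>p\<in>{p. p permutes UNIV}. if p = s then sign p * (\<Prod>a\<in>UNIV. A $ a $ p a) else 0)"
    unfolding det_def using prod_0 by (intro sum.cong) auto
  also have "\<dots> = sign s * (\<Prod>a\<in>UNIV. A $ a $ s a)"
  proof -
    have "s permutes UNIV"
      using permutation_bijective [OF s(1)] by (simp add: permutes_univ bij_iff)
    then show ?thesis by simp
  qed
  also have "\<dots> = 1" unfolding prod_s s(2) by (simp flip: power_mult_distrib)
  finally show ?thesis by (simp add: A_def)
qed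

lemma det_real_mat: "det (real_mat A) = real_of_int (det A)"
  by (simp add: det_def real_mat_def of_int_sum of_int_prod)

text \<open>Cramer's rule gives a real solution with denominator \<open>det A\<close>; dividing by 1
  or -1 is multiplying by it, so the solution is integral.\<close>

lemma unimodular_solve:
  fixes A :: "int ^ 'k::finite ^ 'k"
  assumes "\<bar>det A\<bar> = 1"
  obtains x where "A *v x = b"
proof -
  define D where "D k = det (\<chi> i j. if j = k then b $ i else A $ i $ j)" for k
  have "real_of_int (D k) = det (\<chi> i j. if j = k then real_vec b $ i else real_mat A $ i $ j)" for k
    unfolding D_def det_real_mat [symmetric]
    by (rule arg_cong [of _ _ det]) (simp add: real_mat_def real_vec_def vec_eq_iff)
  then have "real_mat A *v (\<chi> k. real_of_int (D k) / det (real_mat A)) = real_vec b"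
    using cramer [of "real_mat A" "\<chi> k. real_of_int (D k) / det (real_mat A)" "real_vec b"] assms
    by (auto simp: det_real_mat)
  moreover have "(\<chi> k. real_of_int (D k) / det (real_mat A)) = real_vec (\<chi> k. D k * det A)"
  proof -
    have "det A = 1 \<or> det A = - 1" using assms by auto
    then show ?thesis by (auto simp: det_real_mat real_vec_def)
  qed
  ultimately show ?thesis using that by (simp add: real_mat_vec)
qed

section \<open>Lifting symplectic bases\<close>

locale unimodular_form =
  fixes S :: "int ^ ('n::finite + 'n) \<Rightarrow> int ^ ('n + 'n) \<Rightarrow> int"
  assumes add_left: "S (x + y) z = S x z + S y z"
    and add_right: "S z (x + y) = S z x + S z y"
    and self [simp]: "S x x = 0"
    and nondegenerate: "(\<And>y. S x y = 0) \<Longrightarrow> x = 0"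
    and det_Gram: "det (\<chi> a b. S (axis a 1) (axis b 1)) = 1"
begin

lemma antisym: "S y x = - S x y"
  using self [of "x + y"] self [of x] self [of y] unfolding add_left add_right by linarith

lemma zero_left [simp]: "S 0 x = 0" and minus_left: "S (- x) y = - S x y"
  and diff_left: "S (x - y) z = S x z - S y z"
  and sum_left: "S (sum f A) z = (\<Sum>i\<in>A. S (f i) z)"
  and scale_left: "S (c *s x) z = c * S x z"
  using additive_int_simps [of "\<lambda>x. S x _"] additive_int_scale [of "\<lambda>x. S x _"] add_left by simp_all

lemma zero_right [simp]: "S x 0 = 0" and minus_right: "S y (- x) = - S y x"
  and diff_right: "S z (x - y) = S z x - S z y"
  and sum_right: "S z (sum f A) = (\<Sum>i\<in>A. S z (f i))"
  and scale_right: "S z (c *s x) = c * S z x"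
  using additive_int_simps [of "S _"] additive_int_scale [of "S _"] add_right by simp_all

lemmas bilinear = add_left add_right minus_left minus_right diff_left diff_right sum_left sum_right
  scale_left scale_right

text \<open>The conditions on \<open>y\<close> form a linear system with the transposed Gram matrix,
  which has determinant 1 and is therefore solvable over the integers.\<close>

lemma represents:
  assumes add: "\<And>x y. \<phi> (x + y) = \<phi> x + \<phi> y"
  obtains y where "\<And>x. \<phi> x = S y x"
proof -
  define G where "G = (\<chi> a b. S (axis a 1) (axis b 1))"
  obtain y where y: "transpose G *v y = (\<chi> b. \<phi> (axis b 1))"
    by (rule unimodular_solve [of "transpose G"]) (simp add: det_transpose G_def det_Gram)
  have "\<phi> x = S y x" for x
  proof -
    have axis: "S y (axis b 1) = \<phi> (axis b 1)" for b
    proof -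
      have "S y (axis b 1) = S (\<Sum>a\<in>UNIV. y $ a *s axis a 1) (axis b 1)"
        by (simp add: basis_expansion)
      also have "\<dots> = (transpose G *v y) $ b"
        by (simp add: sum_left scale_left matrix_vector_mult_def Finite_Cartesian_Product.transpose_def G_def mult.commute)
      finally show ?thesis unfolding y by simp
    qed
    have "\<phi> x = \<phi> (\<Sum>b\<in>UNIV. x $ b *s axis b 1)" by (simp add: basis_expansion)
    also have "\<dots> = S y (\<Sum>b\<in>UNIV. x $ b *s axis b 1)"
      by (simp add: additive_int_simps(4) [of \<phi>, OF add] additive_int_scale [of \<phi>, OF add] bilinear axis)
    finally show ?thesis by (simp add: basis_expansion)
  qed
  then show ?thesis using that by blast
qed

text \<open>\<open>t\<close> is the least positive value \<open>n\<close> of \<open>S x\<close>.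
  Division with remainder shows that it divides all values, so \<open>S x\<close> divided by
  \<open>n\<close> is an integral functional, and the vector \<open>y\<close> representing it is
  \<open>x\<close> divided by \<open>n\<close>.\<close>

lemma primitive_part:
  assumes "x \<noteq> 0"
  obtains t y u where "t \<noteq> 0" "x = t *s y" "S y u = 1"
proof -
  obtain u0 where "S x u0 \<noteq> 0" using nondegenerate assms by blast
  then have "0 < S x u0 \<or> 0 < S x (- u0)" by (auto simp: minus_right)
  then have "\<exists>n. 0 < n \<and> (\<exists>u. S x u = int n)" by (metis zero_less_imp_eq_int)
  then obtain n u where n: "0 < n" "S x u = int n"
    and least: "\<And>n' u'. 0 < n' \<Longrightarrow> S x u' = int n' \<Longrightarrow> n \<le> n'"
    using exists_least_iff [of "\<lambda>n. 0 < n \<and> (\<exists>u. S x u = int n)"] by (metis not_le)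
  have dvd: "int n dvd S x w" for w
  proof (rule ccontr)
    assume "\<not> int n dvd S x w"
    moreover have "S x (w - (S x w div int n) *s u) = S x w mod int n"
      by (simp add: bilinear n(2) minus_div_mult_eq_mod)
    moreover have "S x w mod int n \<noteq> 0" "0 \<le> S x w mod int n" "S x w mod int n < int n"
      using \<open>\<not> int n dvd S x w\<close> n(1) by (simp_all add: dvd_eq_mod_eq_0)
    ultimately show False
      using least [of "nat (S x w mod int n)" "w - (S x w div int n) *s u"] by linarith
  qed
  have "S x (v + w) div int n = S x v div int n + S x w div int n" for v w
    using dvd by (simp add: add_right div_plus_div_distrib_dvd_left)
  then obtain y where y: "\<And>w. S x w div int n = S y w"
    using represents [of "\<lambda>w. S x w div int n"] by blast
  have "S (x - int n *s y) w = 0" for w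
    using dvd [of w] by (simp add: bilinear flip: y)
  then have "x = int n *s y" using nondegenerate [of "x - int n *s y"] by simp
  moreover have "S y u = 1" using n by (simp flip: y)
  ultimately show ?thesis using that n(1) by (metis less_numeral_extra(3) of_nat_eq_0_iff)
qed

section \<open>Hyperbolic pairs and their complements\<close>

definition symplectic_on :: "'n set \<Rightarrow> ('n \<Rightarrow> int ^ ('n + 'n)) \<Rightarrow> ('n \<Rightarrow> int ^ ('n + 'n)) \<Rightarrow> bool" where
  "symplectic_on F c d \<longleftrightarrow> (\<forall>i\<in>F. \<forall>j\<in>F. S (c i) (c j) = 0 \<and> S (d i) (d j) = 0 \<and>
     S (c i) (d j) = (if i = j then 1 else 0))"

text \<open>Projection onto the complement of the hyperbolic planes already built: the coefficient
  along \<open>c j\<close> is read off by pairing with \<open>d j\<close>, and the one along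
  \<open>d j\<close>, with opposite sign, by pairing with \<open>c j\<close>.\<close>

definition proj where
  "proj F c d x = x - (\<Sum>j\<in>F. S x (d j) *s c j - S x (c j) *s d j)"

definition compl where
  "compl F c d = {x. \<forall>j\<in>F. S x (c j) = 0 \<and> S x (d j) = 0}"

lemma proj_compl:
  assumes "symplectic_on F c d" shows "proj F c d x \<in> compl F c d"
proof -
  have "S (proj F c d x) (c l) = 0 \<and> S (proj F c d x) (d l) = 0" if l: "l \<in> F" for l
  proof -
    have "(\<Sum>j\<in>F. S x (d j) * S (c j) (c l) - S x (c j) * S (d j) (c l)) =
        (\<Sum>j\<in>F. if j = l then S x (c l) else 0)"
      using assms l antisym [of "d _" "c l"] unfolding symplectic_on_def
      by (intro sum.cong) auto
    moreover have "(\<Sum>j\<in>F. S x (d j) * S (c j) (d l) - S x (c j) * S (d j) (d l)) =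
        (\<Sum>j\<in>F. if j = l then S x (d l) else 0)"
      using assms l unfolding symplectic_on_def by (intro sum.cong) auto
    ultimately show ?thesis using l by (simp add: proj_def bilinear)
  qed
  then show ?thesis by (simp add: compl_def)
qed

lemma S_proj:
  assumes "x \<in> compl F c d" shows "S x (proj F c d y) = S x y"
  using assms by (simp add: proj_def compl_def bilinear)

lemma compl_closed:
  "x \<in> compl F c d \<Longrightarrow> y \<in> compl F c d \<Longrightarrow> x + y \<in> compl F c d"
  "x \<in> compl F c d \<Longrightarrow> y \<in> compl F c d \<Longrightarrow> x - y \<in> compl F c d"
  "x \<in> compl F c d \<Longrightarrow> n *s x \<in> compl F c d"
  "t \<noteq> 0 \<Longrightarrow> t *s x \<in> compl F c d \<Longrightarrow> x \<in> compl F c d"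
  by (auto simp: compl_def bilinear)

text \<open>If all projections vanished, the \<open>2 * card F\<close> vectors \<open>c j\<close>
  and \<open>d j\<close> would span a space of dimension \<open>2 * CARD('n)\<close>, impossible for
  a proper subset \<open>F\<close>.\<close>

lemma compl_nontrivial:
  fixes F :: "'n set"
  assumes "F \<noteq> UNIV"
  obtains z where "proj F c d z \<noteq> 0"
proof (rule ccontr)
  assume "\<not> thesis"
  then have proj: "proj F c d z = 0" for z using that by blast
  define X where "X = (real_vec \<circ> c) ` F \<union> (real_vec \<circ> d) ` F"
  have "axis k (1 :: real) \<in> span X" for k
  proof -
    have "axis k 1 = (\<Sum>j\<in>F. S (axis k 1) (d j) *s c j - S (axis k 1) (c j) *s d j)"
      using proj [of "axis k 1"] by (simp add: proj_def)
    then have "axis k (1 :: real) = real_vec (\<Sum>j\<in>F. S (axis k 1) (d j) *s c j - S (axis k 1) (c j) *s d j)"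
      by (metis real_vec_axis)
    also have "\<dots> \<in> span X"
      unfolding real_vec_sum real_vec_diff real_vec_scale
      by (intro span_sum span_diff span_scale span_base) (auto simp: X_def)
    finally show ?thesis .
  qed
  then have "(Basis :: (real ^ ('n + 'n)) set) \<subseteq> span X" by (auto simp: Basis_vec_def)
  then have "dim (Basis :: (real ^ ('n + 'n)) set) \<le> card X"
    by (rule dim_le_card) (simp add: X_def finite_imageI)
  then have "CARD('n + 'n) \<le> card X"
    by (simp add: dim_eq_card_independent independent_Basis)
  also have "card X \<le> card F + card F"
    unfolding X_def by (intro order_trans [OF card_Un_le] add_mono card_image_le) auto
  also have "\<dots> < CARD('n + 'n)"
    using psubset_card_mono [of UNIV F] assms by (simp add: UNIV_Plus_UNIV [symmetric] card_Plus psubset_eq del: UNIV_Plus_UNIV)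
  finally show False by simp
qed

text \<open>If \<open>x = t y\<close> with \<open>S y u = 1\<close>, then \<open>x + m u\<close> is primitive as soon as \<open>t\<close> is prime to \<open>m\<close>, and
  this holds because \<open>S x e \<equiv> 1\<close> modulo \<open>m\<close>. For \<open>x = 0\<close> the modulus is \<open>1\<close> and any primitive vector
  will do.\<close>

lemma primitive_lift:
  fixes m :: nat
  assumes symp: "symplectic_on F c d" and "F \<noteq> UNIV"
    and x: "x \<in> compl F c d" and e: "e \<in> compl F c d" and xe: "int m dvd S x e - 1"
  obtains x' v z where "x' = x + int m *s z" "x' \<in> compl F c d" "v \<in> compl F c d" "S x' v = 1"
proof (cases "x = 0")
  case False
  obtain t y u where t: "t \<noteq> 0" "x = t *s y" "S y u = 1" using primitive_part [OF False] .
  have y: "y \<in> compl F c d" using compl_closed(4) t x by blast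
  \<comment> \<open>Projecting \<open>u\<close> keeps the corrected vector inside the complement and
    leaves the pairing with \<open>y\<close> unchanged, because \<open>y\<close> lies there
    too.\<close>
  define w where "w = proj F c d u"
  have w: "w \<in> compl F c d" "S y w = 1"
    using proj_compl [OF symp] S_proj [OF y] t by (auto simp: w_def)
  obtain r where r: "t * S y e - 1 = int m * r" using xe t(2) by (auto simp: bilinear)
  \<comment> \<open>The pairing is \<open>t * S y e - m * r\<close>, since \<open>S y w = 1\<close>
    and \<open>S w y = -1\<close>; it equals 1 by the choice of \<open>r\<close>.\<close>
  have "S (x + int m *s w) (S y e *s w + r *s y) = 1"
    using r w(2) antisym [of w y] t(2) by (simp add: bilinear algebra_simps)
  moreover have "x + int m *s w \<in> compl F c d" "S y e *s w + r *s y \<in> compl F c d"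
    by (intro compl_closed(1,3) x y w)+
  ultimately show ?thesis using that by blast
next
  case True
  then have m: "m = 1" using xe by simp
  obtain z where z: "proj F c d z \<noteq> 0" using compl_nontrivial [OF \<open>F \<noteq> UNIV\<close>] .
  obtain t y u where t: "t \<noteq> 0" "proj F c d z = t *s y" "S y u = 1" using primitive_part [OF z] .
  have y: "y \<in> compl F c d" using compl_closed(4) t proj_compl [OF symp] by metis
  show ?thesis
    by (rule that [of y y "proj F c d u"])
      (use t y proj_compl [OF symp] S_proj [OF y] in \<open>auto simp: m True\<close>)
qed

text \<open>\<open>C\<close> and \<open>D\<close> are symplectic only modulo \<open>m\<close>. A new
  pair is projected to the complement of the lifted ones, its first member is made primitive there
  by \<open>primitive_lift\<close>, and its second member is corrected; every change is a multiple
  of \<open>m\<close>.\<close>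

lemma symplectic_lift_on:
  fixes m :: nat
  assumes CC: "\<And>i j. int m dvd S (C i) (C j)" and DD: "\<And>i j. int m dvd S (D i) (D j)"
    and CD: "\<And>i j. int m dvd S (C i) (D j) - (if i = j then 1 else 0)"
  shows "\<exists>c d. symplectic_on F c d \<and> (\<forall>i\<in>F. (\<exists>z. c i = C i + int m *s z) \<and> (\<exists>z. d i = D i + int m *s z))"
  using finite [of F]
proof (induction F rule: finite_induct)
  case empty
  then show ?case by (simp add: symplectic_on_def)
next
  case (insert a F)
  then obtain c d where symp: "symplectic_on F c d"
    and cong: "\<And>i. i \<in> F \<Longrightarrow> \<exists>z. c i = C i + int m *s z" "\<And>i. i \<in> F \<Longrightarrow> \<exists>z. d i = D i + int m *s z"
    by blast
  \<comment> \<open>The projection subtracts multiples by the pairings with \<open>c j\<close> and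
    \<open>d j\<close>, all divisible by \<open>m\<close>, so residues survive.\<close>
  have proj_cong: "\<exists>z. proj F c d x = x + int m *s z"
    if "\<And>j. j \<in> F \<Longrightarrow> int m dvd S x (C j)" "\<And>j. j \<in> F \<Longrightarrow> int m dvd S x (D j)" for x
  proof -
    have dvd: "int m dvd S x (c j)" "int m dvd S x (d j)" if "j \<in> F" for j
      using cong [OF that] \<open>\<And>j. j \<in> F \<Longrightarrow> int m dvd S x (C j)\<close> [OF that]
        \<open>\<And>j. j \<in> F \<Longrightarrow> int m dvd S x (D j)\<close> [OF that] by (auto simp: bilinear)
    have "proj F c d x = x + int m *s (\<Sum>j\<in>F. (S x (c j) div int m) *s d j - (S x (d j) div int m) *s c j)"
      using dvd
      by (auto simp: proj_def vec_eq_iff sum_distrib_left right_diff_distrib mult.assoc [symmetric]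
          sum_subtractf intro!: sum.cong)
    then show ?thesis by blast
  qed
  define x where "x = proj F c d (C a)"
  define e where "e = proj F c d (D a)"
  have a: "a \<notin> F" by fact
  have CD': "int m dvd S (C i) (D j)" if "i \<noteq> j" for i j
    using CD [of i j] that by simp
  have DC: "int m dvd S (D i) (C j)" if "i \<noteq> j" for i j
    using CD [of j i] antisym [of "C j" "D i"] that by simp
  obtain z1 where z1: "x = C a + int m *s z1"
    using proj_cong [of "C a"] CC CD' a unfolding x_def by metis
  obtain z2 where z2: "e = D a + int m *s z2"
    using proj_cong [of "D a"] DD DC a unfolding e_def by metis
  have comp: "x \<in> compl F c d" "e \<in> compl F c d"
    by (simp_all add: x_def e_def proj_compl [OF symp])
  have xe: "S x e - 1 = (S (C a) (D a) - 1) + int m * (S z1 (D a) + S (C a) z2 + int m * S z1 z2)"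
    by (simp add: z1 z2 bilinear algebra_simps)
  have "int m dvd S x e - 1"
    unfolding xe using CD [of a a] by (intro dvd_add dvd_triv_left) simp
  moreover have ne: "F \<noteq> UNIV" using a by blast
  ultimately obtain x' v z where x': "x' = x + int m *s z" "x' \<in> compl F c d" "v \<in> compl F c d" "S x' v = 1"
    using primitive_lift [OF symp ne comp] by metis
  have "S x' e - 1 = (S x e - 1) + int m * S z e" by (simp add: x'(1) bilinear)
  then have "int m dvd S x' e - 1"
    using \<open>int m dvd S x e - 1\<close> by (metis dvd_add dvd_triv_left)
  then obtain k where "S x' e - 1 = int m * k" by blast
  then have k: "S x' e = 1 + int m * k" by simp
  \<comment> \<open>\<open>S x' e = 1 + m * k\<close> and \<open>S x' v = 1\<close>, so this
    multiple of \<open>v\<close> removes the excess without altering residues.\<close>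
  define e' where "e' = e - (int m * k) *s v"
  have e': "e' \<in> compl F c d" "S x' e' = 1"
    unfolding e'_def using comp(2) x'(3) by (intro compl_closed(2,3)) (simp_all add: diff_right scale_right k x'(4))
  have "symplectic_on (insert a F) (c(a := x')) (d(a := e'))"
    using symp a x'(2) e' antisym [of "c _" x'] antisym [of "d _" x'] antisym [of "c _" e'] antisym [of "d _" e']
    by (auto simp: symplectic_on_def compl_def)
  moreover have "\<exists>z. x' = C a + int m *s z"
    by (rule exI [of _ "z1 + z"]) (simp add: x'(1) z1 vec_eq_iff algebra_simps)
  moreover have "\<exists>z. e' = D a + int m *s z"
    by (rule exI [of _ "z2 - k *s v"]) (simp add: e'_def z2 vec_eq_iff algebra_simps)
  ultimately have "symplectic_on (insert a F) (c(a := x')) (d(a := e')) \<and>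
      (\<forall>i\<in>insert a F. (\<exists>z. (c(a := x')) i = C i + int m *s z) \<and> (\<exists>z. (d(a := e')) i = D i + int m *s z))"
    using cong by simp
  then show ?case by blast
qed

lemma Gram_congruence:
  "(\<chi> a b. S (A *v axis a 1) (A *v axis b 1)) =
    transpose A ** (\<chi> a b. S (axis a 1) (axis b 1)) ** A"
proof -
  have col: "A *v axis a 1 = (\<Sum>k\<in>UNIV. A $ k $ a *s axis k 1)" for a
    by (simp add: vec_eq_iff matrix_vector_mult_def axis_def if_distrib [of "(*) _"] cong: if_cong)
  show ?thesis
    unfolding col bilinear
    by (simp add: vec_eq_iff matrix_matrix_mult_def transpose_def sum_distrib_left sum_distrib_right mult_ac)
qed

lemma symplectic_basis_lift:
  fixes m :: nat and C :: "'n + 'n \<Rightarrow> int ^ ('n + 'n)"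
  assumes C: "\<And>a b. [S (C a) (C b) = J (axis a 1) (axis b 1)] (mod int m)"
  obtains A where "\<And>x y. S (A *v x) (A *v y) = J x y" "\<And>y. \<exists>x. A *v x = y"
    "\<And>b. \<exists>z. A *v axis b 1 = C b + int m *s z"
proof -
  have C_dvd: "int m dvd S (C a) (C b) - J (axis a 1) (axis b 1)" for a b
    using C [of a b] by (simp add: cong_iff_dvd_diff)
  obtain c d where symp: "symplectic_on UNIV c d"
    and cong: "\<And>i. \<exists>z. c i = C (Inl i) + int m *s z" "\<And>i. \<exists>z. d i = C (Inr i) + int m *s z"
    using symplectic_lift_on [of m "\<lambda>i. C (Inl i)" "\<lambda>i. C (Inr i)" UNIV]
      C_dvd [of "Inl _" "Inl _"] C_dvd [of "Inr _" "Inr _"] C_dvd [of "Inl _" "Inr _"]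
    by (auto simp: J_axis)
  define A :: "int ^ ('n + 'n) ^ ('n + 'n)"
    where "A = (\<chi> k a. case a of Inl i \<Rightarrow> c i $ k | Inr i \<Rightarrow> d i $ k)"
  have A_axis: "A *v axis a 1 = (case a of Inl i \<Rightarrow> c i | Inr i \<Rightarrow> d i)" for a
    by (simp add: vec_eq_iff matrix_vector_mult_def axis_def A_def if_distrib [of "(*) _"]
        split: sum.split cong: if_cong)
  have S_axis: "S (A *v axis a 1) (A *v axis b 1) = J (axis a 1) (axis b 1)" for a b
    using symp antisym [of "d _" "c _"]
    by (cases a; cases b) (auto simp: A_axis J_axis symplectic_on_def)
  have "S (A *v x) (A *v y) = J x y" for x y
  proof -
    have x: "x = (\<Sum>a\<in>UNIV. x $ a *s axis a 1)" and y: "y = (\<Sum>a\<in>UNIV. y $ a *s axis a 1)"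
      by (simp_all add: basis_expansion)
    have A_sum: "A *v (\<Sum>a\<in>UNIV. x $ a *s axis a 1) = (\<Sum>a\<in>UNIV. x $ a *s (A *v axis a 1))" for x
      by (simp add: additive_int_simps(4) [of "(*v) A"] matrix_vector_right_distrib matrix_vector_mult_scale)
    show ?thesis
      by (subst x, subst y, subst (2) x, subst (2) y, unfold A_sum)
        (simp add: bilinear J_sum_left J_sum_right J_scale_left J_scale_right S_axis)
  qed
  moreover have "\<exists>x. A *v x = y" for y
  proof -
    \<comment> \<open>Both Gram matrices have determinant 1, so \<open>det A\<close> squares to 1
      and \<open>A\<close> is invertible over the integers.\<close>
    have "det (\<chi> a b. S (A *v axis a 1) (A *v axis b 1)) = det A * det A"
      unfolding Gram_congruence by (simp add: det_mul det_transpose det_Gram)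
    then have "det A * det A = 1" by (simp add: S_axis det_J)
    then have "\<bar>det A\<bar> = 1" by (metis abs_mult_self_eq abs_square_eq_1 power2_eq_square)
    then show ?thesis using unimodular_solve by metis
  qed
  moreover have "\<exists>z. A *v axis b 1 = C b + int m *s z" for b
    using cong by (cases b) (auto simp: A_axis)
  ultimately show ?thesis using that by blast
qed

end

section \<open>Extension of scalars in coordinates\<close>

interpretation fscale: vector_space fscale
  by (rule vector_space_fscale)

definition flin :: "('a \<Rightarrow> 'b::real_vector) \<Rightarrow> ('a \<Rightarrow>\<^sub>0 real) \<Rightarrow> 'b" where
  "flin g \<xi> = (\<Sum>x\<in>Poly_Mapping.keys \<xi>. Poly_Mapping.lookup \<xi> x *\<^sub>R g x)"

lemma flin_superset:
  assumes "finite A" "Poly_Mapping.keys \<xi> \<subseteq> A"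
  shows "flin g \<xi> = (\<Sum>x\<in>A. Poly_Mapping.lookup \<xi> x *\<^sub>R g x)"
  unfolding flin_def using assms by (intro sum.mono_neutral_left) (auto simp: in_keys_iff)

lemma flin_zero [simp]: "flin g 0 = 0"
  by (simp add: flin_def)

lemma flin_add: "flin g (\<xi> + \<eta>) = flin g \<xi> + flin g \<eta>"
proof -
  let ?A = "Poly_Mapping.keys \<xi> \<union> Poly_Mapping.keys \<eta>"
  have A: "finite ?A" by simp
  show ?thesis
    by (simp add: flin_superset [OF A keys_add] flin_superset [OF A, of \<xi>] flin_superset [OF A, of \<eta>]
        lookup_add scaleR_add_left sum.distrib)
qed

lemma flin_diff: "flin g (\<xi> - \<eta>) = flin g \<xi> - flin g \<eta>"
  using flin_add [of g "\<xi> - \<eta>" \<eta>] by simp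

lemma flin_single: "flin g (Poly_Mapping.single x c) = c *\<^sub>R g x"
  by (simp add: flin_def)

lemma keys_fscale: "Poly_Mapping.keys (fscale c \<xi>) \<subseteq> Poly_Mapping.keys \<xi>"
  by (auto simp: in_keys_iff)

lemma flin_fscale: "flin g (fscale c \<xi>) = c *\<^sub>R flin g \<xi>"
  unfolding flin_superset [OF finite_keys keys_fscale]
  by (simp add: flin_def scaleR_sum_right)

lemma poly_mapping_expand:
  "\<xi> = (\<Sum>x\<in>Poly_Mapping.keys \<xi>. Poly_Mapping.single x (Poly_Mapping.lookup \<xi> x))"
proof (rule poly_mapping_eqI)
  fix y
  have "Poly_Mapping.lookup (\<Sum>x\<in>Poly_Mapping.keys \<xi>. Poly_Mapping.single x (Poly_Mapping.lookup \<xi> x)) y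
    = (\<Sum>x\<in>Poly_Mapping.keys \<xi>. if x = y then Poly_Mapping.lookup \<xi> y else 0)"
    unfolding lookup_sum lookup_single by (intro sum.cong) (auto simp: when_def)
  then show "Poly_Mapping.lookup \<xi> y =
      Poly_Mapping.lookup (\<Sum>x\<in>Poly_Mapping.keys \<xi>. Poly_Mapping.single x (Poly_Mapping.lookup \<xi> x)) y"
    by (simp add: in_keys_iff)
qed

text \<open>Subtraction alone generates the lattice from the basis vectors: \<open>0 = a - a\<close>
  and \<open>a + b = a - (0 - b)\<close>.\<close>

lemma int_vec_induct [case_names axis diff]:
  fixes x :: "int ^ 'k::finite"
  assumes axis: "\<And>i. P (axis i 1)" and diff: "\<And>x y. P x \<Longrightarrow> P y \<Longrightarrow> P (x - y)"
  shows "P x"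
proof -
  have 0: "P 0" using diff [OF axis axis] by (metis diff_self)
  have add: "P (x + y)" if "P x" "P y" for x y
    using diff [OF that(1) diff [OF 0 that(2)]] by simp
  have scale: "P (c *s axis i 1)" for c i
    by (induction c rule: int_induct [where k = 0])
      (simp_all add: 0 add diff axis vector_sadd_rdistrib vector_sub_rdistrib)
  have "P (\<Sum>i\<in>A. x $ i *s axis i 1)" for A
    by (induction A rule: infinite_finite_induct) (simp_all add: 0 add scale)
  then show ?thesis by (metis basis_expansion)
qed

definition coord :: "(int ^ 'k::finite \<Rightarrow> 'a) \<Rightarrow> ('a \<Rightarrow>\<^sub>0 real) \<Rightarrow> real ^ 'k" where
  "coord h = flin (\<lambda>x. real_vec (inv_into UNIV h x))"

text \<open>The element of \<open>L \<otimes> \<real>\<close>, a coset, with coordinate vector \<open>v\<close> in the basis given by \<open>h\<close>.\<close>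

definition ext_point :: "'a monoid \<Rightarrow> (int ^ 'k::finite \<Rightarrow> 'a) \<Rightarrow> real ^ 'k \<Rightarrow> ('a \<Rightarrow>\<^sub>0 real) set" where
  "ext_point L h v = {\<xi>. Poly_Mapping.keys \<xi> \<subseteq> carrier L \<and> coord h \<xi> = v}"

lemma ext_pointD:
  assumes "\<xi> \<in> ext_point L h v"
  shows "Poly_Mapping.keys \<xi> \<subseteq> carrier L" "coord h \<xi> = v"
  using assms by (auto simp: ext_point_def)

lemma the_elem_const:
  assumes "X \<noteq> {}" "\<And>x. x \<in> X \<Longrightarrow> f x = c" shows "the_elem (f ` X) = c"
proof -
  have "f ` X = {c}" using assms by force
  then show ?thesis by simp
qed

context based_lattice begin

lemma inv_h [simp]: "inv_into UNIV h (h x) = x"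
  by (rule inv_into_f_f) (auto simp: inj_on_def)

lemma h_inv [simp]: "x \<in> carrier L \<Longrightarrow> h (inv_into UNIV h x) = x"
  using range_h by (metis f_inv_into_f)

lemma carrierE:
  assumes "x \<in> carrier L" obtains a where "x = h a"
  using assms by (metis h_inv)

lemma ext_point_add: "\<xi> \<in> ext_point L h v \<Longrightarrow> \<eta> \<in> ext_point L h w \<Longrightarrow> \<xi> + \<eta> \<in> ext_point L h (v + w)"
  using keys_add [of \<xi> \<eta>] by (auto simp: ext_point_def coord_def flin_add)

lemma ext_point_diff: "\<xi> \<in> ext_point L h v \<Longrightarrow> \<eta> \<in> ext_point L h w \<Longrightarrow> \<xi> - \<eta> \<in> ext_point L h (v - w)"
  using keys_diff [of \<xi> \<eta>] by (auto simp: ext_point_def coord_def flin_diff)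

lemma ext_point_fscale: "\<xi> \<in> ext_point L h v \<Longrightarrow> fscale c \<xi> \<in> ext_point L h (c *\<^sub>R v)"
  using keys_fscale [of c \<xi>] by (auto simp: ext_point_def coord_def flin_fscale)

lemma ext_point_single: "Poly_Mapping.single (h x) c \<in> ext_point L h (c *\<^sub>R real_vec x)"
  by (auto simp: ext_point_def coord_def flin_single)

lemma ext_point_sum:
  assumes "\<And>i. i \<in> A \<Longrightarrow> f i \<in> ext_point L h (g i)"
  shows "sum f A \<in> ext_point L h (sum g A)"
  using assms
proof (induction A rule: infinite_finite_induct)
  case (insert a A)
  then show ?case by (simp add: ext_point_add)
qed (simp_all add: ext_point_def coord_def)

lemma ext_point_nonempty: "ext_point L h v \<noteq> {}"
proof -
  have "(\<Sum>i\<in>UNIV. Poly_Mapping.single (h (axis i 1)) (v $ i)) \<in>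
      ext_point L h (\<Sum>i\<in>UNIV. v $ i *\<^sub>R real_vec (axis i 1))"
    by (intro ext_point_sum ext_point_single)
  then show ?thesis using basis_expansion [of v] by (auto simp: real_vec_axis scalar_mult_eq_scaleR)
qed

lemma ext_point_inject [simp]: "ext_point L h v = ext_point L h w \<longleftrightarrow> v = w"
  using ext_point_nonempty [of v] by (auto simp: ext_point_def)

lemma tensor_relations_subset: "tensor_relations L \<subseteq> ext_point L h 0"
  unfolding tensor_relations_def
proof (rule fscale.span_minimal)
  show "fscale.subspace (ext_point L h 0)"
    unfolding fscale.subspace_def
    using ext_point_add [of _ 0 _ 0] ext_point_fscale [of _ 0]
    by (auto simp: ext_point_def coord_def)
  show "{Poly_Mapping.single (x \<otimes> y) 1 - Poly_Mapping.single x 1 - Poly_Mapping.single y 1 |x y.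
      x \<in> carrier L \<and> y \<in> carrier L} \<subseteq> ext_point L h 0"
  proof safe
    fix x y assume "x \<in> carrier L" "y \<in> carrier L"
    then obtain a b where ab: "x = h a" "y = h b" using range_h by blast
    have "Poly_Mapping.single (h (a + b)) 1 - Poly_Mapping.single (h a) 1 - Poly_Mapping.single (h b) 1
        \<in> ext_point L h (1 *\<^sub>R real_vec (a + b) - 1 *\<^sub>R real_vec a - 1 *\<^sub>R real_vec b)"
      by (intro ext_point_diff ext_point_single)
    then show "Poly_Mapping.single (x \<otimes> y) 1 - Poly_Mapping.single x 1 - Poly_Mapping.single y 1
        \<in> ext_point L h 0"
      by (simp add: ab real_vec_add h_add)
  qed
qed

text \<open>Modulo the relations every formal sum equals the one on the basis \<open>h (axis i 1)\<close> with the same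
  coordinates; \<open>U\<close> is the difference of the two.\<close>

lemma tensor_relations_eq: "tensor_relations L = ext_point L h 0"
proof (rule antisym [OF tensor_relations_subset], rule subsetI)
  let ?T = "tensor_relations L"
  have T: "fscale.subspace ?T"
    unfolding tensor_relations_def by (rule fscale.subspace_span)
  have T_gen: "Poly_Mapping.single (h (a + b)) 1 - Poly_Mapping.single (h a) 1 - Poly_Mapping.single (h b) 1 \<in> ?T" for a b
    unfolding tensor_relations_def h_add by (rule fscale.span_base, rule CollectI) (blast intro: h_closed)
  define U where "U \<xi> = \<xi> - (\<Sum>i\<in>UNIV. Poly_Mapping.single (h (axis i 1)) (coord h \<xi> $ i))" for \<xi>
  have U_add: "U (\<xi> + \<eta>) = U \<xi> + U \<eta>" for \<xi> \<eta>
    by (simp add: U_def coord_def flin_add single_add sum.distrib)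
  have U_diff: "U (\<xi> - \<eta>) = U \<xi> - U \<eta>" for \<xi> \<eta>
    using U_add [of "\<xi> - \<eta>" \<eta>] by simp
  have U_sum: "U (sum f A) = (\<Sum>x\<in>A. U (f x))" if "finite A" for f and A :: "'a set"
    using that by induction (simp_all add: U_add, simp add: U_def coord_def)
  have U_single: "U (Poly_Mapping.single x c) = fscale c (U (Poly_Mapping.single x 1))" for x c
    by (rule poly_mapping_eqI)
      (simp add: U_def coord_def flin_single lookup_minus lookup_sum lookup_single when_def
        right_diff_distrib sum_distrib_left if_distrib [of "(*) c"] cong: if_cong)
  have single_T: "U (Poly_Mapping.single (h a) 1) \<in> ?T" for a
  proof (induction a rule: int_vec_induct)
    case (axis j)
    have "(\<Sum>i\<in>UNIV. Poly_Mapping.single (h (axis i 1)) (axis j (1 :: real) $ i)) =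
        (\<Sum>i\<in>UNIV. if i = j then Poly_Mapping.single (h (axis j 1)) 1 else 0)"
      by (intro sum.cong) (auto simp: axis_component)
    then have "U (Poly_Mapping.single (h (axis j 1)) 1) = 0"
      by (simp add: U_def coord_def flin_single real_vec_axis)
    then show ?case using fscale.subspace_diff [OF T T_gen T_gen] by (metis diff_self)
  next
    case (diff a b)
    \<comment> \<open>A relation has coordinate vector 0, so \<open>U\<close> leaves it
      unchanged.\<close>
    have gen: "U (Poly_Mapping.single (h a) 1 - Poly_Mapping.single (h (a - b)) 1 - Poly_Mapping.single (h b) 1) \<in> ?T"
      using T_gen [of "a - b" b] tensor_relations_subset
      by (auto simp: U_def dest!: subsetD dest: ext_pointD)
    have "U (Poly_Mapping.single (h (a - b)) 1) = U (Poly_Mapping.single (h a) 1) - U (Poly_Mapping.single (h b) 1)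
        - U (Poly_Mapping.single (h a) 1 - Poly_Mapping.single (h (a - b)) 1 - Poly_Mapping.single (h b) 1)"
      by (simp add: U_diff)
    then show ?case using fscale.subspace_diff [OF T] diff gen by metis
  qed
  fix \<xi> assume \<xi>: "\<xi> \<in> ext_point L h 0"
  have "U (\<Sum>x\<in>Poly_Mapping.keys \<xi>. Poly_Mapping.single x (Poly_Mapping.lookup \<xi> x)) \<in> ?T"
    unfolding U_sum [OF finite_keys]
  proof (rule fscale.subspace_sum [OF T])
    fix x assume "x \<in> Poly_Mapping.keys \<xi>"
    then obtain a where "x = h a" using ext_pointD(1) [OF \<xi>] range_h by blast
    then show "U (Poly_Mapping.single x (Poly_Mapping.lookup \<xi> x)) \<in> ?T"
      unfolding U_single [of x "Poly_Mapping.lookup \<xi> x"] by (intro fscale.subspace_scale [OF T]) (simp add: single_T)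
  qed
  then have "U \<xi> \<in> ?T" by (simp flip: poly_mapping_expand)
  then show "\<xi> \<in> ?T" using ext_pointD(2) [OF \<xi>] by (simp add: U_def)
qed

text \<open>By \<open>tensor_relations_eq\<close>, formal sums on \<open>L\<close> differ by
  relations exactly when their coordinates agree; the cosets are the fibres of
  \<open>coord h\<close>.\<close>

lemma coset_ext_point:
  assumes "\<xi> \<in> ext_point L h v"
  shows "tensor_relations L #>\<^bsub>formal_sums L\<^esub> \<xi> = ext_point L h v"
proof
  show "tensor_relations L #>\<^bsub>formal_sums L\<^esub> \<xi> \<subseteq> ext_point L h v"
    using ext_point_add [of _ 0 \<xi> v] assms by (auto simp: r_coset_def formal_sums_def tensor_relations_eq)
  show "ext_point L h v \<subseteq> tensor_relations L #>\<^bsub>formal_sums L\<^esub> \<xi>"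
  proof
    fix \<eta> assume "\<eta> \<in> ext_point L h v"
    then have "\<eta> - \<xi> \<in> tensor_relations L"
      using ext_point_diff [of \<eta> v \<xi> v] assms by (simp add: tensor_relations_eq)
    then show "\<eta> \<in> tensor_relations L #>\<^bsub>formal_sums L\<^esub> \<xi>"
      by (auto simp: r_coset_def formal_sums_def intro!: bexI [of _ "\<eta> - \<xi>"])
  qed
qed

lemma set_mult_ext_point:
  assumes X: "X \<subseteq> ext_point L h w" "X \<noteq> {}"
  shows "ext_point L h v <#>\<^bsub>formal_sums L\<^esub> X = ext_point L h (v + w)"
proof
  show "ext_point L h v <#>\<^bsub>formal_sums L\<^esub> X \<subseteq> ext_point L h (v + w)"
    using ext_point_add X by (auto simp: set_mult_def formal_sums_def)
  obtain \<eta> where \<eta>: "\<eta> \<in> X" using X by blast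
  show "ext_point L h (v + w) \<subseteq> ext_point L h v <#>\<^bsub>formal_sums L\<^esub> X"
  proof
    fix \<xi> assume "\<xi> \<in> ext_point L h (v + w)"
    then have "\<xi> - \<eta> \<in> ext_point L h v"
      using ext_point_diff [of \<xi> "v + w" \<eta> w] X \<eta> by auto
    moreover have "\<xi> = (\<xi> - \<eta>) \<otimes>\<^bsub>formal_sums L\<^esub> \<eta>" by (simp add: formal_sums_def)
    ultimately show "\<xi> \<in> ext_point L h v <#>\<^bsub>formal_sums L\<^esub> X"
      using \<eta> unfolding set_mult_def by blast
  qed
qed

lemma parametrized_real_ext: "parametrized_space (real_ext L) (ext_point L h)"
proof
  have "carrier (real_ext L) = {tensor_relations L #>\<^bsub>formal_sums L\<^esub> \<xi> |\<xi>. Poly_Mapping.keys \<xi> \<subseteq> carrier L}"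
    by (auto simp: real_ext_def FactGroup_def RCOSETS_def formal_sums_def)
  also have "\<dots> = range (ext_point L h)"
  proof safe
    fix \<xi> :: "'a \<Rightarrow>\<^sub>0 real" assume "Poly_Mapping.keys \<xi> \<subseteq> carrier L"
    then show "tensor_relations L #>\<^bsub>formal_sums L\<^esub> \<xi> \<in> range (ext_point L h)"
      using coset_ext_point [of \<xi> "coord h \<xi>"] by (auto simp: ext_point_def)
  next
    fix v
    obtain \<xi> where "\<xi> \<in> ext_point L h v" using ext_point_nonempty by blast
    then show "\<exists>\<xi>. ext_point L h v = tensor_relations L #>\<^bsub>formal_sums L\<^esub> \<xi> \<and>
        Poly_Mapping.keys \<xi> \<subseteq> carrier L"
      using coset_ext_point ext_pointD by metis
  qed
  finally show "carrier (real_ext L) = range (ext_point L h)" .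
  show "ext_point L h x \<oplus>\<^bsub>real_ext L\<^esub> ext_point L h y = ext_point L h (x + y)" for x y
    using set_mult_ext_point [OF subset_refl ext_point_nonempty] by (simp add: real_ext_def FactGroup_def)
  show "c \<odot>\<^bsub>real_ext L\<^esub> ext_point L h x = ext_point L h (c *\<^sub>R x)" for c x
    using set_mult_ext_point [of "fscale c ` ext_point L h x" "c *\<^sub>R x" 0] ext_point_fscale ext_point_nonempty
    by (auto simp: real_ext_def tensor_relations_eq)
  show "\<zero>\<^bsub>real_ext L\<^esub> = ext_point L h 0"
    by (simp add: real_ext_def FactGroup_def tensor_relations_eq)
qed

lemma ext_elem_h: "ext_elem L (h x) = ext_point L h (real_vec x)"
  unfolding ext_elem_def using ext_point_single [of x 1] by (intro coset_ext_point) simp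

lemma map_ext_h:
  assumes \<alpha>: "based_lattice L' (\<alpha> \<circ> h)"
  shows "map_ext L' \<alpha> (ext_point L h v) = ext_point L' (\<alpha> \<circ> h) v"
proof -
  interpret L': based_lattice L' "\<alpha> \<circ> h" by (rule \<alpha>)
  have "(\<Sum>x\<in>Poly_Mapping.keys \<xi>. Poly_Mapping.single (\<alpha> x) (Poly_Mapping.lookup \<xi> x)) \<in> ext_point L' (\<alpha> \<circ> h) v"
    if \<xi>: "\<xi> \<in> ext_point L h v" for \<xi>
  proof -
    have single: "Poly_Mapping.single (\<alpha> x) (Poly_Mapping.lookup \<xi> x) \<in>
        ext_point L' (\<alpha> \<circ> h) (Poly_Mapping.lookup \<xi> x *\<^sub>R real_vec (inv_into UNIV h x))"
      if "x \<in> Poly_Mapping.keys \<xi>" for x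
    proof -
      have "x \<in> carrier L" using ext_pointD(1) [OF \<xi>] that by (rule subsetD)
      then obtain a where "x = h a" by (rule carrierE)
      then show ?thesis using L'.ext_point_single [of a "Poly_Mapping.lookup \<xi> x"] by simp
    qed
    have "v = (\<Sum>x\<in>Poly_Mapping.keys \<xi>. Poly_Mapping.lookup \<xi> x *\<^sub>R real_vec (inv_into UNIV h x))"
      using ext_pointD(2) [OF \<xi>] by (simp add: coord_def flin_def)
    then show ?thesis by (simp only: L'.ext_point_sum [OF single])
  qed
  then show ?thesis
    unfolding map_ext_def L'.tensor_relations_eq using ext_point_nonempty [of v]
    by (subst L'.set_mult_ext_point [of _ v 0]) auto
qed

lemma residue_class_h: "residue_class m L (h x) = range (\<lambda>z. h (x + int m *s z))"
proof -
  have "mult_subgroup m L = range (\<lambda>z. h (int m *s z))"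
    by (simp add: mult_subgroup_def h_pow image_image flip: range_h)
  then show ?thesis
    by (auto simp: residue_class_def r_coset_def add.commute simp flip: h_add)
qed

lemma residue_class_eqI: "residue_class m L (h (x + int m *s z)) = residue_class m L (h x)"
proof -
  have "h (x + int m *s z + int m *s w) \<in> range (\<lambda>z. h (x + int m *s z))" for w
    by (rule range_eqI [of _ _ "z + w"]) (simp add: vector_add_ldistrib)
  moreover have "h (x + int m *s w) \<in> range (\<lambda>w. h (x + int m *s z + int m *s w))" for w
    by (rule range_eqI [of _ _ "w - z"]) (simp add: vector_ssub_ldistrib)
  ultimately show ?thesis unfolding residue_class_h by blast
qed

lemma residue_class_mult:
  "residue_class m L (h x) <#> residue_class m L (h y) = residue_class m L (h (x + y))"
proof -
  have A: "residue_class m L (h x) <#> residue_class m L (h y) =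
      (\<Union>z. \<Union>w. {h (x + int m *s z + (y + int m *s w))})"
    by (simp add: residue_class_h set_mult_def flip: h_add)
  have B: "h (x + int m *s z + (y + int m *s w)) \<in> range (\<lambda>z. h (x + y + int m *s z))" for z w
    by (rule range_eqI [of _ _ "z + w"]) (simp add: vector_add_ldistrib)
  have C: "h (x + y + int m *s z) \<in> (\<Union>z. \<Union>w. {h (x + int m *s z + (y + int m *s w))})" for z
    by (rule UN_I [of z], simp, rule UN_I [of 0]) simp_all
  show ?thesis unfolding A residue_class_h [of m "x + y"] using B C by blast
qed

lemma carrier_residue: "carrier (L Mod mult_subgroup m L) = range (\<lambda>x. residue_class m L (h x))"
  by (auto simp: FactGroup_def RCOSETS_def residue_class_def simp flip: range_h)

end

lemma form_ext_J:
  assumes "based_lattice L h" and S: "\<And>x y. S (h x) (h y) = J x y"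
  shows "form_ext S (ext_point L h v) (ext_point L h w) = J v w"
proof -
  interpret based_lattice L h by fact
  have "(\<Sum>x\<in>Poly_Mapping.keys \<xi>. \<Sum>y\<in>Poly_Mapping.keys \<eta>.
       Poly_Mapping.lookup \<xi> x * Poly_Mapping.lookup \<eta> y * real_of_int (S x y)) = J v w"
    if \<xi>: "\<xi> \<in> ext_point L h v" and \<eta>: "\<eta> \<in> ext_point L h w" for \<xi> \<eta>
  proof -
    have S': "real_of_int (S x y) = J (real_vec (inv_into UNIV h x)) (real_vec (inv_into UNIV h y))"
      if "x \<in> Poly_Mapping.keys \<xi>" "y \<in> Poly_Mapping.keys \<eta>" for x y
    proof -
      have "x \<in> carrier L" "y \<in> carrier L"
        using that ext_pointD(1) [OF \<xi>] ext_pointD(1) [OF \<eta>] by blast+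
      then obtain a b where "x = h a" "y = h b" using carrierE by metis
      then show ?thesis by (simp add: S J_real_vec)
    qed
    have "J v w = J (coord h \<xi>) (coord h \<eta>)" using ext_pointD(2) \<xi> \<eta> by metis
    also have "\<dots> = (\<Sum>x\<in>Poly_Mapping.keys \<xi>. \<Sum>y\<in>Poly_Mapping.keys \<eta>.
       Poly_Mapping.lookup \<xi> x * Poly_Mapping.lookup \<eta> y * real_of_int (S x y))"
      unfolding coord_def flin_def J_sum_left J_scaleR_left
      unfolding J_sum_right J_scaleR_right sum_distrib_left
      by (intro sum.cong refl) (simp add: S' mult.assoc)
    finally show ?thesis by simp
  qed
  then show ?thesis
    unfolding form_ext_def using ext_point_nonempty
    by (intro the_elem_const) auto
qed

lemma ext_vec_std: "ext_vec (ext_point std_lattice (\<lambda>x. x) v) = v"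
  unfolding ext_vec_def
  by (rule the_elem_const)
    (use based_lattice.ext_point_nonempty [OF based_lattice_std] in
      \<open>auto simp: ext_point_def coord_def flin_def\<close>)

section \<open>Frames of tropical abelian varieties\<close>

text \<open>A frame \<open>h\<close> identifies \<open>(L, S, i, Q)\<close> with \<open>(\<int>\<^sup>2\<^sup>g, J, id, q)\<close>.\<close>

definition frame ::
    "nat \<Rightarrow> ('a, 'n::finite) pptav \<Rightarrow> (int ^ ('n + 'n) \<Rightarrow> 'a) \<Rightarrow>
      (real ^ ('n + 'n) \<Rightarrow> real ^ ('n + 'n) \<Rightarrow> real) \<Rightarrow> bool" where
  "frame m = (\<lambda>(L, S, i, Q) h q. based_lattice L h \<and> (\<forall>x y. S (h x) (h y) = J x y) \<and>
     (\<forall>x. i (residue_class m L (h x)) = (\<lambda>k. x $ k mod int m)) \<and>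
     (\<forall>v w. Q (ext_point L h v) (ext_point L h w) = q v w))"

lemma frame_std:
  fixes p :: "('n::finite + 'n) cone_point"
  shows
  "frame m (std_lattice, J, std_level m, Q_form p) (\<lambda>x. x) (pull_form p)"
proof -
  have "std_level m (residue_class m std_lattice x) = (\<lambda>k. x $ k mod int m)"
    for x :: "int ^ ('n + 'n)"
    unfolding std_level_def based_lattice.residue_class_h [OF based_lattice_std]
    by (rule the_elem_const) (auto simp: fun_eq_iff)
  moreover have "Q_form p (ext_point std_lattice (\<lambda>x. x) v) (ext_point std_lattice (\<lambda>x. x) w) = pull_form p v w"
    for v w
    by (cases p) (simp add: Q_form_def ext_vec_std pull_form_def Jfun_def)
  ultimately show ?thesis by (simp add: frame_def based_lattice_std)
qed

section \<open>Frames under isomorphism and change of basis\<close>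

lemma based_lattice_comp_iso:
  assumes "based_lattice L h" "comm_group L'" "\<alpha> \<in> iso L L'"
  shows "based_lattice L' (\<alpha> \<circ> h)"
  using assms iso_set_trans [of h std_lattice L \<alpha> L']
  by (auto simp: based_lattice_def based_lattice_axioms_def)

lemma frame_iso:
  assumes X: "frame m X h q" and iso: "pptav_iso m X Y" and Y: "is_pptav m Y"
  obtains h' where "frame m Y h' q"
proof -
  obtain L S i Q L' S' i' Q' where XY: "X = (L, S, i, Q)" "Y = (L', S', i', Q')"
    by (cases X, cases Y)
  obtain \<alpha> where \<alpha>: "\<alpha> \<in> iso L L'" "\<And>x y. x \<in> carrier L \<Longrightarrow> y \<in> carrier L \<Longrightarrow> S' (\<alpha> x) (\<alpha> y) = S x y"
    "\<And>x. x \<in> carrier L \<Longrightarrow> i' (residue_class m L' (\<alpha> x)) = i (residue_class m L x)"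
    "\<And>X Y. X \<in> carrier (real_ext L) \<Longrightarrow> Y \<in> carrier (real_ext L) \<Longrightarrow> Q' (map_ext L' \<alpha> X) (map_ext L' \<alpha> Y) = Q X Y"
    using iso by (auto simp: pptav_iso_def XY)
  have L: "based_lattice L h" using X by (simp add: frame_def XY)
  interpret based_lattice L h by (rule L)
  have L': "based_lattice L' (\<alpha> \<circ> h)"
    using based_lattice_comp_iso [OF L _ \<alpha>(1)] Y by (simp add: is_pptav_def XY)
  have "ext_point L h v \<in> carrier (real_ext L)" for v
    using parametrized_space.carrier_eq [OF parametrized_real_ext] by simp
  then have "frame m Y (\<alpha> \<circ> h) q"
    using X L' \<alpha>(2-4) map_ext_h [OF L', symmetric] by (auto simp: frame_def XY)
  then show ?thesis using that by blast
qed

text \<open>A frame expresses all data of its object through \<open>q\<close>, so one frame composed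
  with the inverse of the other is an isomorphism.\<close>

lemma frames_imp_iso:
  assumes X: "frame m X h q" and Y: "frame m Y h' q"
  shows "pptav_iso m X Y"
proof -
  obtain L S i Q L' S' i' Q' where XY: "X = (L, S, i, Q)" "Y = (L', S', i', Q')"
    by (cases X, cases Y)
  have L: "based_lattice L h" and L': "based_lattice L' h'" using X Y by (simp_all add: frame_def XY)
  interpret based_lattice L h by (rule L)
  interpret L': based_lattice L' h' by (rule L')
  define \<alpha> where "\<alpha> = h' \<circ> inv_into UNIV h"
  have \<alpha>_h: "\<alpha> (h x) = h' x" for x by (simp add: \<alpha>_def)
  then have comp: "\<alpha> \<circ> h = h'" by auto
  have "bij_betw \<alpha> (carrier L) (carrier L')"
    by (rule bij_betwI [where g = "h \<circ> inv_into UNIV h'"]) (auto simp: \<alpha>_def)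
  then have "\<alpha> \<in> iso L L'"
    by (auto simp: iso_def hom_def \<alpha>_h h_add [symmetric] L'.h_add [symmetric] simp flip: range_h)
  moreover have "map_ext L' \<alpha> (ext_point L h v) = ext_point L' h' v" for v
    using map_ext_h [of L' \<alpha> v] L' by (simp add: comp)
  ultimately show ?thesis
    using X Y unfolding pptav_iso_def XY frame_def
    by (auto simp: \<alpha>_h parametrized_space.carrier_eq [OF parametrized_real_ext] simp flip: range_h
        intro!: bexI [of _ \<alpha>])
qed

text \<open>Coordinates with respect to \<open>h\<close> are \<open>A\<close> times those with
  respect to \<open>h'\<close>; invertibility of \<open>A\<close> turns this into an equality of
  fibres.\<close>

lemma ext_point_change:
  assumes L: "based_lattice L h" and L': "based_lattice L h'"
    and A: "A \<in> Gamma m" and h': "\<And>x. h' x = h (A *v x)"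
  shows "ext_point L h' v = ext_point L h (real_mat A *v v)"
proof -
  interpret based_lattice L h by (rule L)
  interpret L': based_lattice L h' by (rule L')
  obtain B where B: "B ** A = mat 1" by (rule Gamma_inverse [OF A])
  have BA: "real_mat B *v (real_mat A *v v) = v" for v
    by (simp add: matrix_vector_mul_assoc B flip: real_mat_mult)
  have coord: "coord h \<xi> = real_mat A *v coord h' \<xi>" if \<xi>: "Poly_Mapping.keys \<xi> \<subseteq> carrier L" for \<xi>
  proof -
    have "inv_into UNIV h x = A *v inv_into UNIV h' x" if "x \<in> Poly_Mapping.keys \<xi>" for x
    proof -
      have "x \<in> carrier L" using \<xi> that by blast
      then obtain a where "x = h' a" by (rule L'.carrierE)
      then show ?thesis by simp (simp add: h')
    qed
    then show ?thesis
      by (simp add: coord_def flin_def real_mat_vec matrix_vector_mult_scaleR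
          linear_sum [OF matrix_vector_mul_linear])
  qed
  show ?thesis
    unfolding ext_point_def using coord BA by (metis (no_types, lifting))
qed

text \<open>The two frames differ by an integer matrix \<open>A\<close>. Comparing the symplectic
  forms makes it symplectic, comparing the level structures makes it the identity modulo
  \<open>m\<close>.\<close>

lemma frames_Gamma_equiv:
  assumes h: "frame m X h q" and h': "frame m X h' q'"
  shows "Gamma_equiv m q' q"
proof -
  obtain L S i Q where X: "X = (L, S, i, Q)" by (cases X)
  have L: "based_lattice L h" and L': "based_lattice L h'" using h h' by (simp_all add: frame_def X)
  interpret based_lattice L h by (rule L)
  interpret L': based_lattice L h' by (rule L')
  have "inv_into UNIV h (h' (x + y)) = inv_into UNIV h (h' x) + inv_into UNIV h (h' y)" for x y
    by (metis L'.h_add L'.h_closed h_add h_inv inv_h)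
  then obtain A where "\<And>x. A *v x = inv_into UNIV h (h' x)"
    using additive_matrix [of "\<lambda>x. inv_into UNIV h (h' x)"] by blast
  then have A: "h' x = h (A *v x)" for x by simp
  have "J (A *v x) (A *v y) = J x y" for x y
    using h h' unfolding frame_def X by (simp flip: A) (metis A)
  moreover have "(A *v x) $ k mod int m = x $ k mod int m" for x k
  proof -
    have "(\<lambda>k. (A *v x) $ k mod int m) = i (residue_class m L (h (A *v x)))"
      using h by (simp add: frame_def X)
    also have "\<dots> = (\<lambda>k. x $ k mod int m)" using h' by (simp add: frame_def X flip: A)
    finally show ?thesis by meson
  qed
  ultimately have A_Gamma: "A \<in> Gamma m" by (simp add: Gamma_iff Sp_def cong_def)
  have "q (real_mat A *v v) (real_mat A *v w) = q' v w" for v w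
    using h h' ext_point_change [OF L L' A_Gamma A] by (simp add: frame_def X)
  then show ?thesis using A_Gamma by (auto simp: Gamma_equiv_def)
qed

lemma frame_change:
  assumes h: "frame m X h q" and "Gamma_equiv m q' q"
  obtains h' where "frame m X h' q'"
proof -
  obtain L S i Q where X: "X = (L, S, i, Q)" by (cases X)
  have L: "based_lattice L h" using h by (simp add: frame_def X)
  obtain A where A: "A \<in> Gamma m" and q: "\<And>x y. q (real_mat A *v x) (real_mat A *v y) = q' x y"
    using assms(2) by (auto simp: Gamma_equiv_def)
  obtain B where B: "A ** B = mat 1" "B ** A = mat 1" by (rule Gamma_inverse [OF A])
  have "bij ((*v) A)"
    by (rule o_bij [of "(*v) B"]) (auto simp: fun_eq_iff matrix_vector_mul_assoc B)
  then have "(*v) A \<in> iso std_lattice std_lattice"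
    by (simp add: iso_def hom_def std_lattice_def matrix_vector_right_distrib)
  then have L': "based_lattice L (h \<circ> (*v) A)"
    using L iso_set_trans [of "(*v) A" std_lattice std_lattice h L]
    by (auto simp: based_lattice_def based_lattice_axioms_def)
  have "frame m X (h \<circ> (*v) A) q'"
    using h L' ext_point_change [OF L L' A] A
    by (auto simp: frame_def X q Gamma_iff Sp_def cong_def)
  then show ?thesis using that by blast
qed

section \<open>The axioms of a tropical abelian variety read in a frame\<close>

lemma free_iso_std:
  obtains f where "f \<in> iso (free_Abelian_group (UNIV :: 'k::finite set)) std_lattice"
    "\<And>i. f (frag_of i) = axis i 1"
proof
  define f :: "('k \<Rightarrow>\<^sub>0 int) \<Rightarrow> int ^ 'k" where "f c = (\<chi> i. Poly_Mapping.lookup c i)" for c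
  have "inj f" by (rule injI) (auto simp: f_def vec_eq_iff intro: poly_mapping_eqI)
  moreover have "\<exists>c. f c = x" for x
  proof
    show "f (\<Sum>i\<in>UNIV. Poly_Mapping.single i (x $ i)) = x"
      by (simp add: f_def vec_eq_iff lookup_sum lookup_single when_def)
  qed
  ultimately have "bij f" by (metis bijI surjI surj_def)
  then show "f \<in> iso (free_Abelian_group (UNIV :: 'k set)) std_lattice"
    by (auto simp: iso_def hom_def free_Abelian_group_def std_lattice_def f_def lookup_add vec_eq_iff
        bij_betw_def)
  show "f (frag_of i) = axis i 1" for i
    by (simp add: f_def vec_eq_iff axis_component lookup_single when_def)
qed

lemma std_form_mod:
  "[std_form (\<lambda>k. x $ k mod int m) (\<lambda>k. y $ k mod int m) = J x y] (mod int m)"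
  unfolding J_def std_form_def
  by (intro cong_sum cong_diff cong_mult) (simp_all add: cong_def)

lemma sym_form_ext:
  assumes "based_lattice L h" and Q: "\<And>v w. Q (ext_point L h v) (ext_point L h w) = q v w"
  shows "sym_bilinear (real_ext L) Q \<longleftrightarrow> sym_form q"
    and "pos_semidef (real_ext L) Q \<longleftrightarrow> (\<forall>v. 0 \<le> q v v)"
    and "form_kernel (real_ext L) Q = ext_point L h ` radical q"
proof -
  interpret based_lattice L h by fact
  interpret R: parametrized_space "real_ext L" "ext_point L h" by (rule parametrized_real_ext)
  show "sym_bilinear (real_ext L) Q \<longleftrightarrow> sym_form q"
    by (simp add: sym_bilinear_def sym_form_def R.carrier_eq R.add_eq R.smult_eq Q)
  show "pos_semidef (real_ext L) Q \<longleftrightarrow> (\<forall>v. 0 \<le> q v v)"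
    by (simp add: pos_semidef_def R.carrier_eq Q)
  show "form_kernel (real_ext L) Q = ext_point L h ` radical q"
    by (auto simp: form_kernel_def radical_def R.carrier_eq Q)
qed

lemma perp_ext_h:
  assumes "based_lattice L h" and S: "\<And>x y. S (h x) (h y) = J x y"
  shows "perp_ext L S (h ` W) = ext_point L h ` JperpR W"
proof -
  interpret based_lattice L h by fact
  interpret R: parametrized_space "real_ext L" "ext_point L h" by (rule parametrized_real_ext)
  have "ext_elem L ` h ` W = ext_point L h ` real_vec ` W"
    by (simp add: image_image ext_elem_h)
  then have "real_span (real_ext L) (ext_elem L ` h ` W) = ext_point L h ` WR W"
    using R.real_span_image [of "real_vec ` W"] by (simp add: inj_on_def WR_def)
  then show ?thesis
    by (auto simp: perp_ext_def R.carrier_eq form_ext_J [OF assms] JperpR_WR)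
qed

lemma frame_is_pptav:
  fixes X :: "('a, 'n::finite) pptav"
  assumes X: "frame m X h q" and q: "tropical_form q" and m: "m \<ge> 1"
  shows "is_pptav m X"
proof -
  obtain L S i Q where XL: "X = (L, S, i, Q)" by (cases X)
  have L: "based_lattice L h" and S: "\<And>x y. S (h x) (h y) = J x y"
    and i: "\<And>x. i (residue_class m L (h x)) = (\<lambda>k. x $ k mod int m)"
    and Q: "\<And>v w. Q (ext_point L h v) (ext_point L h w) = q v w"
    using X by (auto simp: frame_def XL)
  interpret based_lattice L h by (rule L)
  obtain f :: "('n + 'n \<Rightarrow>\<^sub>0 int) \<Rightarrow> int ^ ('n + 'n)"
    where f: "f \<in> iso (free_Abelian_group UNIV) std_lattice" "\<And>i. f (frag_of i) = axis i 1"
    using free_iso_std by blast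
  have hf: "h \<circ> f \<in> iso (free_Abelian_group UNIV) L" by (rule iso_set_trans [OF f(1) h_iso])
  then have iso: "L \<cong> free_Abelian_group (UNIV :: ('n + 'n) set)"
    by (meson group.iso_sym group_free_Abelian_group is_isoI)
  have "unimodular_symplectic TYPE('n) L S"
    unfolding unimodular_symplectic_def
    using hf det_J J_nondegenerate
    by (auto simp: S J_add_left J_add_right f(2) simp flip: range_h h_add h_zero
        intro!: bexI [of _ "h \<circ> f"])
  moreover have "i \<in> iso (L Mod mult_subgroup m L) (level_group m)"
  proof -
    \<comment> \<open>Here \<open>m \<ge> 1\<close> matters: \<open>integer_mod_group 0\<close> is
      the group of all integers, for which the upper bound would fail.\<close>
    have carrier: "carrier (level_group m) = {\<phi> :: 'n + 'n \<Rightarrow> int. \<forall>k. 0 \<le> \<phi> k \<and> \<phi> k < int m}"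
      using m by (auto simp: level_group_def carrier_integer_mod_group)
    have "inj_on i (carrier (L Mod mult_subgroup m L))"
    proof (rule inj_onI)
      fix A B assume "A \<in> carrier (L Mod mult_subgroup m L)" "B \<in> carrier (L Mod mult_subgroup m L)" "i A = i B"
      then obtain x y where xy: "A = residue_class m L (h x)" "B = residue_class m L (h y)"
        "(\<lambda>k. x $ k mod int m) = (\<lambda>k. y $ k mod int m)"
        by (auto simp: carrier_residue i)
      have "x = y + int m *s (\<chi> k. (x $ k - y $ k) div int m)"
        using fun_cong [OF xy(3)] by (simp add: vec_eq_iff mod_eq_dvd_iff)
      then show "A = B" using residue_class_eqI [of m y] xy by metis
    qed
    moreover have "i ` carrier (L Mod mult_subgroup m L) = carrier (level_group m)"
    proof
      show "i ` carrier (L Mod mult_subgroup m L) \<subseteq> carrier (level_group m)"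
        using m by (auto simp: carrier carrier_residue i)
      show "carrier (level_group m) \<subseteq> i ` carrier (L Mod mult_subgroup m L)"
      proof
        fix \<phi> :: "'n + 'n \<Rightarrow> int" assume "\<phi> \<in> carrier (level_group m)"
        then have "\<phi> = i (residue_class m L (h (\<chi> k. \<phi> k)))" by (simp add: i carrier fun_eq_iff)
        then show "\<phi> \<in> i ` carrier (L Mod mult_subgroup m L)" by (simp add: carrier_residue)
      qed
    qed
    moreover have "i (A <#>\<^bsub>L\<^esub> B) = i A \<otimes>\<^bsub>level_group m\<^esub> i B"
      if "A \<in> carrier (L Mod mult_subgroup m L)" "B \<in> carrier (L Mod mult_subgroup m L)" for A B
      using that by (auto simp: carrier_residue residue_class_mult i level_group_def mod_add_eq)
    ultimately show ?thesis
      by (auto simp: iso_def hom_def bij_betw_def)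
  qed
  moreover have "[std_form (i (residue_class m L x)) (i (residue_class m L y)) = S x y] (mod int m)"
    if xy: "x \<in> carrier L" "y \<in> carrier L" for x y
  proof -
    obtain a b where "x = h a" "y = h b" using carrierE xy by metis
    then show ?thesis by (simp add: i S std_form_mod)
  qed
  moreover obtain W where W: "isotropic_subspace W" "radical q = JperpR W"
    using q by (auto simp: tropical_form_def)
  then have "isotropic L S (h ` W) \<and> form_kernel (real_ext L) Q = perp_ext L S (h ` W)"
    using isotropic_iff [of S W] S sym_form_ext(3) [where Q = Q and q = q, OF L Q] perp_ext_h [OF L S]
    by (simp add: isotropic_subspace_def)
  ultimately show ?thesis
    using iso q sym_form_ext(1,2) [where Q = Q and q = q, OF L Q]
    by (auto simp: is_pptav_def XL tropical_form_def comm_group_axioms)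
qed

text \<open>Surjectivity of \<open>i\<close> supplies lattice vectors \<open>C b\<close> over the
  standard basis, symplectic only modulo \<open>m\<close>. Replacing them by a genuine symplectic
  basis with the same residues turns \<open>S\<close> into \<open>J\<close> and \<open>i\<close>
  into the identity at once.\<close>

lemma pptav_frame:
  fixes X :: "('a, 'n::finite) pptav"
  assumes X: "is_pptav m X" and m: "m \<ge> 1"
  obtains h q where "frame m X h q" "tropical_form q"
proof -
  obtain L S i Q where XL: "X = (L, S, i, Q)" by (cases X)
  have cg: "comm_group L" and uni: "unimodular_symplectic TYPE('n) L S"
    and i_iso: "i \<in> iso (L Mod mult_subgroup m L) (level_group m)"
    and i_form: "\<And>x y. x \<in> carrier L \<Longrightarrow> y \<in> carrier L \<Longrightarrow>
      [std_form (i (residue_class m L x)) (i (residue_class m L y)) = S x y] (mod int m)"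
    and Q: "sym_bilinear (real_ext L) Q" "pos_semidef (real_ext L) Q"
    and ker: "\<exists>W. isotropic L S W \<and> form_kernel (real_ext L) Q = perp_ext L S W"
    using X by (auto simp: is_pptav_def XL)
  obtain h0 where h0: "h0 \<in> iso (free_Abelian_group UNIV) L"
    and det0: "det (\<chi> i j :: 'n + 'n. S (h0 (frag_of i)) (h0 (frag_of j))) = 1"
    using uni by (auto simp: unimodular_symplectic_def)
  obtain f :: "('n + 'n \<Rightarrow>\<^sub>0 int) \<Rightarrow> int ^ ('n + 'n)"
    where f: "f \<in> iso (free_Abelian_group UNIV) std_lattice" "\<And>i. f (frag_of i) = axis i 1"
    using free_iso_std by blast
  define h1 where "h1 = h0 \<circ> inv_into (carrier (free_Abelian_group UNIV)) f"
  have "h1 \<in> iso std_lattice L"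
    unfolding h1_def by (rule iso_set_trans [OF group.iso_set_sym [OF group_free_Abelian_group f(1)] h0])
  then have L1: "based_lattice L h1"
    using cg by (simp add: based_lattice_def based_lattice_axioms_def)
  interpret L1: based_lattice L h1 by (rule L1)
  have "inj_on f (carrier (free_Abelian_group UNIV))" using f(1) by (auto simp: iso_def bij_betw_def)
  then have h1_axis: "h1 (axis k 1) = h0 (frag_of k)" for k
    using inv_into_f_f [of f "carrier (free_Abelian_group UNIV)" "frag_of k"] by (simp add: h1_def flip: f(2))
  define S1 where "S1 x y = S (h1 x) (h1 y)" for x y
  interpret S1: unimodular_form S1
  proof
    show "S1 (x + y) z = S1 x z + S1 y z" "S1 z (x + y) = S1 z x + S1 z y" "S1 x x = 0" for x y z
      using uni by (auto simp: S1_def unimodular_symplectic_def L1.h_add)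
    show "x = 0" if "\<And>y. S1 x y = 0" for x
    proof -
      have "\<forall>y\<in>carrier L. S (h1 x) y = 0" using that by (auto simp: S1_def simp flip: L1.range_h)
      then have "h1 x = h1 0" using uni by (simp add: unimodular_symplectic_def)
      then show ?thesis unfolding L1.h_inject .
    qed
    show "det (\<chi> a b. S1 (axis a 1) (axis b 1)) = 1" using det0 by (simp add: S1_def h1_axis)
  qed
  have i_bij: "i ` carrier (L Mod mult_subgroup m L) = carrier (level_group m)"
    using i_iso by (auto simp: iso_def bij_betw_def)
  have "\<exists>c. i (residue_class m L (h1 c)) = (\<lambda>k. axis b 1 $ k mod int m)" for b :: "'n + 'n"
  proof -
    have "(\<lambda>k. axis b 1 $ k mod int m) \<in> carrier (level_group m)"
      using m by (auto simp: level_group_def carrier_integer_mod_group)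
    then show ?thesis unfolding i_bij [symmetric] L1.carrier_residue by auto
  qed
  then obtain C where C: "\<And>b. i (residue_class m L (h1 (C b))) = (\<lambda>k. axis b 1 $ k mod int m)"
    by metis
  have C_form: "[S1 (C a) (C b) = J (axis a 1) (axis b 1)] (mod int m)" for a b
  proof -
    have "[std_form (\<lambda>k. axis a 1 $ k mod int m) (\<lambda>k. axis b 1 $ k mod int m) = S1 (C a) (C b)] (mod int m)"
      using i_form [of "h1 (C a)" "h1 (C b)"] by (simp add: C S1_def)
    then show ?thesis using std_form_mod [of "axis a 1" m "axis b 1"] cong_sym cong_trans by blast
  qed
  then obtain A where A: "\<And>x y. S1 (A *v x) (A *v y) = J x y" "\<And>y. \<exists>x. A *v x = y"
    "\<And>b. \<exists>z. A *v axis b 1 = C b + int m *s z"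
    by (rule S1.symplectic_basis_lift) (rule that; assumption)
  define h where "h x = h1 (A *v x)" for x
  have S: "S (h x) (h y) = J x y" for x y
    using A(1) by (simp add: h_def S1_def)
  have "inj ((*v) A)"
  proof (rule injI)
    fix x y assume "A *v x = A *v y"
    then have "J x z = J y z" for z using A(1) by metis
    then show "x = y" by (rule J_eqI)
  qed
  moreover have "surj ((*v) A)" using A(2) by (metis surj_def)
  ultimately have "(*v) A \<in> iso std_lattice std_lattice"
    by (simp add: iso_def hom_def std_lattice_def matrix_vector_right_distrib bij_betw_def)
  then have "h1 \<circ> (*v) A \<in> iso std_lattice L" by (rule iso_set_trans [OF _ L1.h_iso])
  moreover have "h = h1 \<circ> (*v) A" by (simp add: h_def fun_eq_iff)
  ultimately have L: "based_lattice L h"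
    using cg by (simp add: based_lattice_def based_lattice_axioms_def)
  interpret based_lattice L h by (rule L)
  \<comment> \<open>The values of \<open>i\<close> are reduced residues, so congruences between them
    are equalities.\<close>
  have i_range: "i (residue_class m L (h x)) k mod int m = i (residue_class m L (h x)) k" for x k
  proof -
    have "i (residue_class m L (h x)) \<in> carrier (level_group m)"
      unfolding i_bij [symmetric] carrier_residue by blast
    then show ?thesis using m by (auto simp: level_group_def carrier_integer_mod_group PiE_iff)
  qed
  have i_add: "i (residue_class m L (h (x + y))) k =
      (i (residue_class m L (h x)) k + i (residue_class m L (h y)) k) mod int m" for x y k
  proof -
    have "i (residue_class m L (h x) <#>\<^bsub>L\<^esub> residue_class m L (h y)) =
        i (residue_class m L (h x)) \<otimes>\<^bsub>level_group m\<^esub> i (residue_class m L (h y))"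
      using i_iso carrier_residue [of m] by (auto simp: iso_def hom_def FactGroup_def)
    then show ?thesis by (simp add: residue_class_mult level_group_def)
  qed
  \<comment> \<open>Both sides are additive modulo \<open>m\<close> and agree on the basis vectors,
    since the lift moved \<open>C b\<close> only by a multiple of \<open>m\<close>.\<close>
  have i: "i (residue_class m L (h x)) = (\<lambda>k. x $ k mod int m)" for x
  proof (induction x rule: int_vec_induct)
    case (axis b)
    obtain z where "A *v axis b 1 = C b + int m *s z" using A(3) by blast
    then show ?case unfolding h_def by (simp add: L1.residue_class_eqI C)
  next
    case (diff x y)
    show ?case
    proof
      fix k
      have "x $ k mod int m = (i (residue_class m L (h (x - y))) k + y $ k mod int m) mod int m"
        using i_add [of "x - y" y k] diff by simp
      then have "(x $ k - y $ k) mod int m = i (residue_class m L (h (x - y))) k mod int m"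
        by (metis add_diff_cancel_right' mod_add_right_eq mod_diff_left_eq)
      then show "i (residue_class m L (h (x - y))) k = (x - y) $ k mod int m"
        by (simp add: i_range)
    qed
  qed
  define q where "q v w = Q (ext_point L h v) (ext_point L h w)" for v w
  note Q_q = sym_form_ext [where Q = Q and q = q, OF L q_def [symmetric]]
  obtain W' where W': "isotropic L S W'" "form_kernel (real_ext L) Q = perp_ext L S W'"
    using ker by blast
  then obtain W where W: "W' = h ` W"
    using subgroup.subset range_h unfolding isotropic_def by (metis subset_imageE)
  have "isotropic_subspace W"
    using W' isotropic_iff [of S W] S unfolding isotropic_subspace_def W by simp
  moreover have "radical q = JperpR W"
    using W'(2) unfolding W Q_q(3) perp_ext_h [OF L S] by (simp add: inj_image_eq_iff inj_def)
  ultimately have "tropical_form q"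
    using Q Q_q by (auto simp: tropical_form_def)
  moreover have "frame m X h q"
    by (simp add: frame_def XL L S i q_def)
  ultimately show ?thesis using that by blast
qed

section \<open>Isomorphism classes in an infinite universe\<close>

lemma frame_exists:
  fixes q :: "real ^ ('n::finite + 'n) \<Rightarrow> real ^ ('n + 'n) \<Rightarrow> real"
  obtains X :: "('u::infinite, 'n) pptav" and h where "frame m X h q"
proof -
  \<comment> \<open>The standard lattice is countable, so it embeds in any infinite type; all
    structure is transported along the embedding.\<close>
  obtain e :: "nat \<Rightarrow> 'u" where "inj e"
    using infinite_countable_subset [OF infinite_UNIV] by blast
  define h :: "int ^ ('n + 'n) \<Rightarrow> 'u" where "h = e \<circ> to_nat"
  have "inj h" unfolding h_def using \<open>inj e\<close> by (intro inj_compose) auto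
  then have inv: "inv_into UNIV h (h x) = x" for x by simp
  define L where "L = \<lparr>carrier = range h, monoid.mult = \<lambda>a b. h (inv_into UNIV h a + inv_into UNIV h b), one = h 0\<rparr>"
  have "comm_group L"
  proof (rule comm_groupI)
    fix x assume "x \<in> carrier L"
    then obtain a where "x = h a" by (auto simp: L_def)
    then show "\<exists>y\<in>carrier L. y \<otimes>\<^bsub>L\<^esub> x = \<one>\<^bsub>L\<^esub>"
      by (intro bexI [of _ "h (- a)"]) (auto simp: L_def inv)
  qed (auto simp: L_def inv add_ac)
  moreover have "h \<in> iso std_lattice L"
    using \<open>inj h\<close> by (auto simp: iso_def hom_def bij_betw_def std_lattice_def L_def inv)
  ultimately have L: "based_lattice L h"
    by (simp add: based_lattice_def based_lattice_axioms_def)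
  interpret based_lattice L h by (rule L)
  define S where "S a b = J (inv_into UNIV h a) (inv_into UNIV h b)" for a b
  define i where "i A = the_elem ((\<lambda>a k. inv_into UNIV h a $ k mod int m) ` A)" for A
  define Q where "Q A B = q (inv_into UNIV (ext_point L h) A) (inv_into UNIV (ext_point L h) B)" for A B
  have inv_ext: "inv_into UNIV (ext_point L h) (ext_point L h v) = v" for v
    by (rule inv_into_f_f) (auto simp: inj_on_def)
  have "i (residue_class m L (h x)) = (\<lambda>k. x $ k mod int m)" for x
    unfolding i_def residue_class_h by (rule the_elem_const) (auto simp: fun_eq_iff)
  then have "frame m (L, S, i, Q) h q"
    by (simp add: frame_def L S_def Q_def inv_ext)
  then show ?thesis using that by blast
qed

text \<open>The right-hand side depends on \<open>q\<close> alone. This makes classes of objects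
  over different types comparable, in particular those of \<open>Phi\<close>, whose lattice consists
  of integer vectors.\<close>

lemma pptav_class_eq:
  fixes X :: "('a, 'n::finite) pptav"
  assumes X: "frame m X h q" and q: "tropical_form q" and m: "m \<ge> 1"
  shows "pptav_class m X = {Y :: ('u::infinite, 'n) pptav. \<exists>h. frame m Y h q}"
proof (rule equalityI; rule subsetI)
  fix Y :: "('u, 'n) pptav" assume "Y \<in> pptav_class m X"
  then have Y: "pptav_iso m X Y" "is_pptav m Y" by (simp_all add: pptav_class_def)
  obtain h' where "frame m Y h' q" by (rule frame_iso [OF X Y])
  then show "Y \<in> {Y. \<exists>h. frame m Y h q}" by blast
next
  fix Y :: "('u, 'n) pptav" assume "Y \<in> {Y. \<exists>h. frame m Y h q}"
  then obtain h' where Y: "frame m Y h' q" by blast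
  then show "Y \<in> pptav_class m X"
    using frames_imp_iso [OF X Y] frame_is_pptav [OF Y q m] by (simp add: pptav_class_def)
qed

theorem theorem3p3:
  fixes m :: nat
  assumes "m \<ge> 1"
  shows "\<exists>\<Psi>. bij_betw \<Psi> (Ag_trop m :: ('n::finite + 'n) cone_point set set)
                        (pptav_classes m :: ('u::infinite, 'n) pptav set set) \<and>
             (\<forall>p\<in>PD_union. \<Psi> (trop_proj m p) = Phi m p)"
proof -
  \<comment> \<open>Collecting over all points of \<open>C\<close>, boundary points of cones
    included, avoids a choice of representative; the fact \<open>proj\<close> below shows that each
    of them contributes the same objects.\<close>
  define \<Psi> :: "('n + 'n) cone_point set \<Rightarrow> ('u, 'n) pptav set"
    where "\<Psi> C = {Y. \<exists>p\<in>C. \<exists>h. frame m Y h (pull_form p)}" for C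
  have Phi: "Phi m p = {Y :: ('u, 'n) pptav. \<exists>h. frame m Y h (pull_form p)}" if "p \<in> PD_union" for p
    unfolding Phi_def
    by (rule pptav_class_eq [OF frame_std tropical_form_PD_union [OF that] assms])
  have proj: "\<Psi> (trop_proj m p) = Phi m p" if p: "p \<in> PD_union" for p
  proof -
    have p_rt: "p \<in> PD_rt_union" using p PD_union_subset by blast
    have self: "p \<in> trop_proj m p"
      using p_rt equiv_class_self [OF trop_rel_equiv] by (simp add: trop_proj_def)
    have "\<exists>h. frame m Y h (pull_form p)" if p': "p' \<in> trop_proj m p" and Y: "frame m Y h' (pull_form p')"
      for Y :: "('u, 'n) pptav" and p' h'
    proof -
      have rel: "(p, p') \<in> trop_rel m" using p' by (simp add: trop_proj_def)
      then have "p' \<in> PD_rt_union" by (simp add: trop_rel_def)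
      then have "Gamma_equiv m (pull_form p) (pull_form p')" using trop_rel_iff [OF p_rt] rel by blast
      then obtain h where "frame m Y h (pull_form p)" by (rule frame_change [OF Y])
      then show ?thesis by blast
    qed
    then show ?thesis using self by (auto simp: \<Psi>_def Phi [OF p])
  qed
  have Ag: "\<exists>p\<in>PD_union. C = trop_proj m p" if C: "C \<in> Ag_trop m" for C :: "('n + 'n) cone_point set"
  proof -
    obtain p where p: "p \<in> PD_rt_union" "C = trop_proj m p"
      using C by (auto simp: Ag_trop_def trop_proj_def elim: quotientE)
    obtain p0 where p0: "p0 \<in> PD_union" "pull_form p0 = pull_form p"
      using trop_step_from_PD [OF p(1)] by metis
    then have "(p0, p) \<in> trop_rel m"
      using trop_rel_iff [of p0 p m] p(1) PD_union_subset Gamma_equiv_refl by auto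
    then show ?thesis
      using p0(1) p(2) equiv_class_eq [OF trop_rel_equiv] unfolding trop_proj_def by blast
  qed
  have proj_Ag: "trop_proj m p \<in> Ag_trop m" if "p \<in> PD_union" for p :: "('n + 'n) cone_point"
    using that PD_union_subset by (auto simp: Ag_trop_def trop_proj_def intro: quotientI)
  have "inj_on \<Psi> (Ag_trop m)"
  proof (rule inj_onI)
    fix C C' :: "('n + 'n) cone_point set"
    assume C: "C \<in> Ag_trop m" "C' \<in> Ag_trop m" and eq: "\<Psi> C = \<Psi> C'"
    obtain p where p: "p \<in> PD_union" "C = trop_proj m p" using Ag [OF C(1)] by blast
    obtain p' where p': "p' \<in> PD_union" "C' = trop_proj m p'" using Ag [OF C(2)] by blast
    \<comment> \<open>A common member is needed to compare the two forms, so the class of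
      \<open>p\<close> must be known to be inhabited.\<close>
    obtain X :: "('u, 'n) pptav" and h where X: "frame m X h (pull_form p)"
      using frame_exists by blast
    have "X \<in> Phi m p" unfolding Phi [OF p(1)] using X by blast
    then have "X \<in> Phi m p'" using eq proj p p' by metis
    then obtain h' where X': "frame m X h' (pull_form p')" unfolding Phi [OF p'(1)] by blast
    have "(p, p') \<in> trop_rel m"
      using frames_Gamma_equiv [OF X' X] trop_rel_iff p(1) p'(1) PD_union_subset by blast
    then show "C = C'"
      using p(2) p'(2) equiv_class_eq [OF trop_rel_equiv] unfolding trop_proj_def by blast
  qed
  moreover have "\<Psi> ` Ag_trop m = pptav_classes m"
  proof
    show "\<Psi> ` Ag_trop m \<subseteq> pptav_classes m"
    proof
      fix K assume "K \<in> \<Psi> ` Ag_trop m"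
      then obtain p where p: "p \<in> PD_union" "K = Phi m p" using Ag proj by blast
      obtain X :: "('u, 'n) pptav" and h where X: "frame m X h (pull_form p)"
        using frame_exists by blast
      note q = tropical_form_PD_union [OF p(1)]
      have "K = pptav_class m X"
        unfolding p(2) Phi [OF p(1)] by (rule pptav_class_eq [OF X q assms, symmetric])
      then show "K \<in> pptav_classes m"
        using frame_is_pptav [OF X q assms] by (auto simp: pptav_classes_def)
    qed
    show "pptav_classes m \<subseteq> \<Psi> ` Ag_trop m"
    proof
      fix K :: "('u, 'n) pptav set" assume "K \<in> pptav_classes m"
      then obtain X :: "('u, 'n) pptav" where X: "is_pptav m X" "K = pptav_class m X"
        by (auto simp: pptav_classes_def)
      obtain h q where h: "frame m X h q" "tropical_form q" using pptav_frame [OF X(1) assms] .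
      obtain p where p: "p \<in> PD_union" "pull_form p = q" using PD_union_exists [OF h(2)] .
      have "K = \<Psi> (trop_proj m p)"
        unfolding X(2) proj [OF p(1)] Phi [OF p(1)] p(2) by (rule pptav_class_eq [OF h assms])
      then show "K \<in> \<Psi> ` Ag_trop m" using proj_Ag [OF p(1)] by blast
    qed
  qed
  ultimately show ?thesis using proj unfolding bij_betw_def by blast
qed

end
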